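(* Let $n\ge1$ and $\sigma_0,\mu\in\mathcal{W}_{2,ac}(\mathbb{R}^n)$. Assume: (A1) There is a set $K\subseteq \mathcal{W}_{2,ac}(\mathbb{R}^n)$, compact with respect to $W_2$, such that (i) for every choice of step sizes $\gamma_k\in[0,1]$ and directions $\theta_k\in S^{n-1}$ $(k\ge 0)$, the sequence $\{\sigma_k\}_{k\ge 1}$ produced from $\sigma_0$ by the single-slice matching scheme $$\sigma_{k+1}=\bigl((1-\gamma_k)\,\mathrm{id}+\gamma_k T_{\sigma_k,\theta_k}\bigr)_\sharp\sigma_k,\qquad k\ge 0,$$ stays in $K$; (ii) if $\eta\in K$ and $H'(\eta)=0$ $\eta$-a.e., then $\eta=\mu$. (A2) $(\gamma_k)_{k\ge 0}\subset[0,1]$ is a sequence with $\sum_{k=0}^\infty\gamma_k=\infty$ and $\sum_{k=0}^\infty\gamma_k^2<\infty$. Let $\theta_k$, $k\ge0$, be i.i.d. random vectors distributed according to the uniform probability measure $u$ on $S^{n-1}$, and let $(\sigma_k)_{k\ge 0}$ be the (random) sequence generated from $\sigma_0$ by the single-slice matching scheme above with these $\theta_k$ and the step sizes $\gamma_k$ of (A2). Then, almost surely, $$W_2(\sigma_k,\mu)\to 0\quad\text{as } k\to\infty .$$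
   Context: $\mathcal{W}_2(\mathbb{R}^n)$ is the space of Borel probability measures on $\mathbb{R}^n$ with finite second moment, equipped with the quadratic Wasserstein distance $W_2$; $\mathcal{W}_{2,ac}(\mathbb{R}^n)$ is the subset of those absolutely continuous with respect to Lebesgue measure. For $\theta\in S^{n-1}$ and a probability measure $\sigma$ on $\mathbb{R}^n$, $\sigma^\theta$ denotes the pushforward of $\sigma$ under $x\mapsto x\cdot\theta$. Single-slice matching map (the target $\mu$ is fixed): for $\sigma\in\mathcal{W}_{2,ac}(\mathbb{R}^n)$ and $\theta\in S^{n-1}$, $$T_{\sigma,\theta}(x)=x+\bigl(T^\theta(x\cdot\theta)-x\cdot\theta\bigr)\theta ,$$ where $T^{\theta}=F_{\mu^{\theta}}^{-1}\circ F_{\sigma^{\theta}}$ is the one-dimensional optimal transport map from $\sigma^{\theta}$ to $\mu^{\theta}$; here $F_\nu(x)=\nu((-\infty,x])$ and $F_\nu^{-1}(y)=\min\{z:F_\nu(z)\ge y\}$. For $\eta\in\mathcal{W}_{2,ac}(\mathbb{R}^n)$, the function $H'(\eta):\mathbb{R}^n\to\mathbb{R}^n$ (the formal Fréchet derivative of $H(\sigma)=\frac12\int_{S^{n-1}}W_2^2(\sigma^\theta,\mu^\theta)\,du(\theta)$) is defined by $$H'(\eta)(x)=\int_{S^{n-1}}\bigl(x-T_{\eta,\theta}(x)\bigr)\,du(\theta).$$ If $\sigma_0,\mu\in\mathcal{W}_{2,ac}(\mathbb{R}^n)$, then all iterates $\sigma_k$ are in $\mathcal{W}_{2,ac}(\mathbb{R}^n)$,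 so the scheme is well defined. *)

theory Defs
  imports "HOL-Probability.Probability"
begin

definition W2_space :: "'a::euclidean_space measure set" where
  "W2_space = {\<sigma>. prob_space \<sigma> \<and> sets \<sigma> = sets borel \<and> integrable \<sigma> (\<lambda>x. (norm x)\<^sup>2)}"

definition W2_ac :: "'a::euclidean_space measure set" where
  "W2_ac = {\<sigma> \<in> W2_space. absolutely_continuous lborel \<sigma>}"

definition couplings ::
    "'a::euclidean_space measure \<Rightarrow> 'a measure \<Rightarrow> ('a \<times> 'a) measure set" where
  "couplings \<mu> \<nu> =
     {\<pi>. sets \<pi> = sets (borel \<Otimes>\<^sub>M borel) \<and> distr \<pi> borel fst = \<mu> \<and> distr \<pi> borel snd = \<nu>}"

text \<open>The infimum is finite on \<open>W2_space\<close>, so that \<open>enn2real\<close> is harmless there.\<close>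

definition W2 :: "'a::euclidean_space measure \<Rightarrow> 'a measure \<Rightarrow> real" where
  "W2 \<mu> \<nu> = sqrt (enn2real
     (INF \<pi>\<in>couplings \<mu> \<nu>. \<integral>\<^sup>+z. ennreal ((dist (fst z) (snd z))\<^sup>2) \<partial>\<pi>))"

definition W2_compact :: "'a::euclidean_space measure set \<Rightarrow> bool" where
  "W2_compact K \<longleftrightarrow> compactin (Metric_space.mtopology W2_space W2) K"

text \<open>
  The uniform probability measure on the unit sphere, as a Borel measure on the ambient space:
  the law of the direction of a uniformly distributed point of the unit ball. It is carried by
  the sphere and invariant under orthogonal transformations, as shown below.
\<close>

definition uniform_sphere :: "'a::euclidean_space measure" where
  "uniform_sphere = distr (uniform_measure lborel (cball 0 1)) borel sgn"

definition slice :: "'a::euclidean_space \<Rightarrow> 'a measure \<Rightarrow> real measure" where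
  "slice \<theta> \<sigma> = distr \<sigma> borel (\<lambda>x. x \<bullet> \<theta>)"

text \<open>
  The minimum exists for \<open>0 < y < 1\<close>. Outside this range it may not exist, and then
  \<open>LEAST\<close> is a fixed but unspecified real number. For \<open>\<sigma>\<close> in \<open>W2_ac\<close> and \<open>\<theta>\<close> a unit vector,
  \<open>cdf (slice \<theta> \<sigma>) (x \<bullet> \<theta>)\<close> lies strictly between 0 and 1 for \<open>\<sigma>\<close>-almost every \<open>x\<close>.
\<close>

definition quantile :: "real measure \<Rightarrow> real \<Rightarrow> real" where
  "quantile \<nu> y = (LEAST z. cdf \<nu> z \<ge> y)"

definition slice_map ::
    "'a::euclidean_space measure \<Rightarrow> 'a measure \<Rightarrow> 'a \<Rightarrow> 'a \<Rightarrow> 'a" where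
  "slice_map \<mu> \<sigma> \<theta> x =
     x + (quantile (slice \<theta> \<mu>) (cdf (slice \<theta> \<sigma>) (x \<bullet> \<theta>)) - x \<bullet> \<theta>) *\<^sub>R \<theta>"

text \<open>
  For \<open>\<mu>\<close> and \<open>\<eta>\<close> in \<open>W2_ac\<close> the integrand is integrable for \<open>\<eta>\<close>-almost every \<open>x\<close>.
\<close>

definition H_deriv ::
    "'a::euclidean_space measure \<Rightarrow> 'a measure \<Rightarrow> 'a \<Rightarrow> 'a" where
  "H_deriv \<mu> \<eta> x = (\<integral>\<theta>. x - slice_map \<mu> \<eta> \<theta> x \<partial>uniform_sphere)"

primrec slice_iter ::
    "'a::euclidean_space measure \<Rightarrow> 'a measure \<Rightarrow> (nat \<Rightarrow> real) \<Rightarrow> (nat \<Rightarrow> 'a) \<Rightarrow> nat \<Rightarrow> 'a measure"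
where
  "slice_iter \<mu> \<sigma>\<^sub>0 \<gamma> \<theta> 0 = \<sigma>\<^sub>0"
| "slice_iter \<mu> \<sigma>\<^sub>0 \<gamma> \<theta> (Suc k) =
     distr (slice_iter \<mu> \<sigma>\<^sub>0 \<gamma> \<theta> k) borel
       (\<lambda>x. (1 - \<gamma> k) *\<^sub>R x + \<gamma> k *\<^sub>R slice_map \<mu> (slice_iter \<mu> \<sigma>\<^sub>0 \<gamma> \<theta> k) (\<theta> k) x)"

lemma emeasure_unit_cball:
  "emeasure lborel (cball (0::'a::euclidean_space) 1) \<noteq> 0"
  "emeasure lborel (cball (0::'a::euclidean_space) 1) \<noteq> \<infinity>"
proof -
  have "unit_ball_vol (real DIM('a)) > 0"
    by simp
  then show "emeasure lborel (cball (0::'a) 1) \<noteq> 0" "emeasure lborel (cball (0::'a) 1) \<noteq> \<infinity>"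
    by (auto simp: emeasure_cball simp del: unit_ball_vol_pos)
qed

lemma sgn_borel_measurable [measurable]:
  "(sgn :: 'a::euclidean_space \<Rightarrow> 'a) \<in> borel_measurable borel"
  by (simp add: sgn_div_norm[abs_def])

lemma prob_space_uniform_sphere: "prob_space uniform_sphere"
  unfolding uniform_sphere_def
  by (intro prob_space.prob_space_distr prob_space_uniform_measure emeasure_unit_cball) simp

lemma AE_uniform_sphere: "AE \<theta> in uniform_sphere. \<theta> \<in> sphere 0 1"
proof -
  have "AE x in lborel. x \<in> cball (0::'a) 1 \<longrightarrow> sgn x \<in> sphere 0 1"
    using AE_lborel_singleton[of 0] by eventually_elim (simp add: norm_sgn)
  then show ?thesis
    unfolding uniform_sphere_def by (subst AE_distr_iff) (auto intro!: AE_uniform_measureI)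
qed

lemma nn_integral_lborel_translation:
  fixes h :: "'a::euclidean_space \<Rightarrow> ennreal"
  assumes [measurable]: "h \<in> borel_measurable borel"
  shows "(\<integral>\<^sup>+x. h (x - c) \<partial>lborel) = (\<integral>\<^sup>+x. h x \<partial>lborel)"
proof -
  have "(\<integral>\<^sup>+x. h x \<partial>lborel) = (\<integral>\<^sup>+x. h x \<partial>distr lborel borel ((+) (- c)))"
    by (simp add: lborel_distr_plus)
  also have "\<dots> = (\<integral>\<^sup>+x. h (x - c) \<partial>lborel)"
    by (subst nn_integral_distr) auto
  finally show ?thesis ..
qed

lemma nn_integral_lborel_reflection:
  fixes h :: "'a::euclidean_space \<Rightarrow> ennreal"
  assumes [measurable]: "h \<in> borel_measurable borel"
  shows "(\<integral>\<^sup>+x. h (c - x) \<partial>lborel) = (\<integral>\<^sup>+x. h x \<partial>lborel)"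
proof -
  have "lborel = distr lborel borel (\<lambda>x::'a. c - x)"
    using lborel_affine[of "-1" c] by (simp add: density_1)
  then have "(\<integral>\<^sup>+x. h x \<partial>lborel) = (\<integral>\<^sup>+x. h x \<partial>distr lborel borel (\<lambda>x. c - x))"
    by simp
  also have "\<dots> = (\<integral>\<^sup>+x. h (c - x) \<partial>lborel)"
    by (subst nn_integral_distr) auto
  finally show ?thesis ..
qed

lemma lborel_distr_orthogonal:
  fixes f :: "'a::euclidean_space \<Rightarrow> 'a"
  assumes f: "orthogonal_transformation f"
  shows "distr lborel borel f = lborel"
proof (rule measure_eqI)
  fix S assume "S \<in> sets (distr lborel borel f)"
  then have [measurable]: "S \<in> sets borel" by simp
  define B :: "'a set" where "B = cball 0 1"
  have [measurable]: "B \<in> sets borel" by (simp add: B_def)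
  have lin: "linear f" and norm: "\<And>x. norm (f x) = norm x"
    using f by (auto simp: orthogonal_transformation)
  have [measurable]: "f \<in> borel_measurable borel"
    using lin by (intro borel_measurable_continuous_onI linear_continuous_on linear_conv_bounded_linear[THEN iffD1])
  define b s :: "'a \<Rightarrow> ennreal" where "b = indicator B" and "s = indicator S"
  have [measurable]: "b \<in> borel_measurable borel" "s \<in> borel_measurable borel"
    by (auto simp: b_def s_def)
  have bf: "b (f y) = b y" for y
    by (simp add: b_def B_def norm indicator_def)
  have refl: "(\<integral>\<^sup>+y. b (x - f y) * s (f y) \<partial>lborel) = (\<integral>\<^sup>+y. b y * s (x - f y) \<partial>lborel)" for x
  proof -
    obtain z where z: "x = f z"
      using orthogonal_transformation_surj[OF f] by (metis surjD)
    have "(\<integral>\<^sup>+y. b (x - f y) * s (f y) \<partial>lborel)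
        = (\<integral>\<^sup>+y. b (x - f (z - y)) * s (f (z - y)) \<partial>lborel)"
      by (rule nn_integral_lborel_reflection[symmetric]) measurable
    also have "\<dots> = (\<integral>\<^sup>+y. b y * s (x - f y) \<partial>lborel)"
      by (simp add: linear_diff[OF lin] z bf)
    finally show ?thesis .
  qed
  have "(\<integral>\<^sup>+x. b x \<partial>lborel) * (\<integral>\<^sup>+y. s (f y) \<partial>lborel)
      = (\<integral>\<^sup>+y. \<integral>\<^sup>+x. b x * s (f y) \<partial>lborel \<partial>lborel)"
    by (simp add: nn_integral_multc nn_integral_cmult)
  also have "\<dots> = (\<integral>\<^sup>+y. \<integral>\<^sup>+x. b (x - f y) * s (f y) \<partial>lborel \<partial>lborel)"
    by (simp add: nn_integral_multc nn_integral_lborel_translation)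
  also have "\<dots> = (\<integral>\<^sup>+x. \<integral>\<^sup>+y. b (x - f y) * s (f y) \<partial>lborel \<partial>lborel)"
    by (rule lborel_pair.Fubini') measurable
  also have "\<dots> = (\<integral>\<^sup>+x. \<integral>\<^sup>+y. b y * s (x - f y) \<partial>lborel \<partial>lborel)"
    by (simp add: refl)
  also have "\<dots> = (\<integral>\<^sup>+y. \<integral>\<^sup>+x. b y * s (x - f y) \<partial>lborel \<partial>lborel)"
    by (rule lborel_pair.Fubini') measurable
  also have "\<dots> = (\<integral>\<^sup>+x. b x \<partial>lborel) * (\<integral>\<^sup>+x. s x \<partial>lborel)"
    by (simp add: nn_integral_cmult nn_integral_multc nn_integral_lborel_translation)
  finally have "emeasure lborel B * (\<integral>\<^sup>+y. s (f y) \<partial>lborel) = emeasure lborel B * emeasure lborel S"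
    by (simp add: b_def s_def)
  moreover have "(\<integral>\<^sup>+y. s (f y) \<partial>lborel) = emeasure (distr lborel borel f) S"
    using nn_integral_distr[of f lborel borel s] by (simp add: s_def)
  ultimately show "emeasure (distr lborel borel f) S = emeasure lborel S"
    using emeasure_unit_cball[where 'a='a] by (auto simp: B_def ennreal_mult_cancel_left)
qed simp

lemma uniform_sphere_invariant:
  fixes f :: "'a::euclidean_space \<Rightarrow> 'a"
  assumes f: "orthogonal_transformation f"
  shows "distr uniform_sphere borel f = uniform_sphere"
proof -
  let ?U = "uniform_measure lborel (cball (0::'a) 1)"
  have lin: "linear f" and norm: "\<And>x. norm (f x) = norm x"
    using f by (auto simp: orthogonal_transformation)
  have [measurable]: "f \<in> borel_measurable borel"
    using lin by (intro borel_measurable_continuous_onI linear_continuous_on linear_conv_bounded_linear[THEN iffD1])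
  have U: "distr ?U borel f = ?U"
  proof (rule measure_eqI)
    fix S assume "S \<in> sets (distr ?U borel f)"
    then have [measurable]: "S \<in> sets borel" by simp
    have "emeasure lborel (cball 0 1 \<inter> f -` S) = emeasure (distr lborel borel f) (cball 0 1 \<inter> S)"
      by (subst emeasure_distr) (auto simp: norm intro!: arg_cong[where f="emeasure lborel"])
    then show "emeasure (distr ?U borel f) S = emeasure ?U S"
      using measurable_sets[of f borel borel S]
      by (simp add: lborel_distr_orthogonal[OF f] emeasure_distr)
  qed simp
  have "distr uniform_sphere borel f = distr ?U borel (\<lambda>x. f (sgn x))"
    unfolding uniform_sphere_def by (subst distr_distr) (auto simp: o_def)
  also have "(\<lambda>x. f (sgn x)) = (\<lambda>x. sgn (f x))"
    by (simp add: sgn_div_norm linear_scale[OF lin] norm)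
  also have "distr ?U borel (\<lambda>x. sgn (f x)) = distr (distr ?U borel f) borel sgn"
    by (subst distr_distr) (auto simp: o_def)
  finally show ?thesis
    by (simp add: U uniform_sphere_def)
qed

end

theory Submission
  imports Defs
begin

text \<open>
  Write \<open>D \<theta> x = x \<bullet> \<theta> - T\<close> for the signed displacement of \<open>x\<close> in direction \<open>\<theta>\<close> and \<open>H\<close> for the average
  of \<open>D\<^sup>2\<close> over \<open>x\<close> and \<open>\<theta>\<close>; then \<open>H'\<close> is the average of \<open>D \<theta> x *\<^sub>R \<theta>\<close> over \<open>\<theta>\<close>. Since monotone
  transport is optimal on the line, the map that moves \<open>\<sigma>\<^sub>k\<close> to \<open>\<sigma>\<^sub>k\<^sub>+\<^sub>1\<close> gives an upper bound for
  \<open>H \<sigma>\<^sub>k\<^sub>+\<^sub>1\<close>, whose mean over the random direction is at most \<open>(1 + \<gamma>\<^sup>2) H - 2\<gamma> norm H'\<^sup>2\<close>, where the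
  norm is that of \<open>L\<^sup>2 \<sigma>\<^sub>k\<close>. Summing, \<open>\<gamma>\<^sub>k norm H'\<^sup>2\<close> is almost surely summable, so \<open>norm H'\<close> has
  lower limit 0. Slice transports are stable under \<open>W2\<close> convergence, hence by compactness a small
  gradient forces a small \<open>H\<close>, and \<open>H\<close> therefore comes arbitrarily close to 0. As \<open>H\<close> is, up to a
  summable error, a nonnegative supermartingale, it converges to 0, and compactness turns this into
  convergence in \<open>W2\<close>.
\<close>

text \<open>The squared cost is rewritten through crossing probabilities because these serve twice.
  For optimality, the monotone map meets a lower bound that every coupling obeys at each pair of
  thresholds. For stability, transported projections have the law of the slice of \<mu> whatever the
  source, so one dominating function built from \<mu> alone serves all sources and directions, and
  L2 convergence reduces to pointwise convergence of probabilities. The delicate point is what is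
  known about the iterates. Their absolute continuity is taken from (A1), also for a step in an
  arbitrary direction; the initial measure need not lie in \<open>K\<close>, so index 0 is treated
  apart. Infima over couplings are never assumed attained: near-optimal couplings carry every
  comparison, and energies are compared only up to factors 2, which do no harm when the limit is 0.
  Since the energy is known to come close to 0, a maximal inequality for the time after such a visit
  takes the place of a general convergence theorem.\<close>

subsection \<open>Quantiles and distribution functions on the line\<close>

text \<open>Right continuity of the distribution function puts the infimum of the superlevel set
  into the set, and \<open>0 < y\<close> bounds that set from below, so \<open>LEAST\<close> is a
  true minimum. Optimality and stability below see quantiles only through this equivalence.\<close>

lemma quantile_le_iff:
  assumes "real_distribution \<rho>" and y: "0 < y" and ex: "\<exists>z. y \<le> cdf \<rho> z"
  shows "quantile \<rho> y \<le> s \<longleftrightarrow> y \<le> cdf \<rho> s"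
proof -
  interpret real_distribution \<rho> by fact
  let ?Z = "{z. y \<le> cdf \<rho> z}"
  have "eventually (\<lambda>z. cdf \<rho> z < y) at_bot"
    using cdf_lim_at_bot y by (rule order_tendstoD)
  then obtain b where b: "\<And>z. z \<le> b \<Longrightarrow> cdf \<rho> z < y"
    by (auto simp: eventually_at_bot_linorder)
  have bdd: "bdd_below ?Z"
  proof (rule bdd_belowI)
    show "b \<le> z" if "z \<in> ?Z" for z
      using b[of z] that by (cases "z \<le> b") auto
  qed
  define i where "i = Inf ?Z"
  have up: "y \<le> cdf \<rho> z" if "i < z" for z
  proof -
    have "?Z \<noteq> {}" "Inf ?Z < z"
      using ex that by (auto simp: i_def)
    then obtain z' where "z' \<in> ?Z" "z' < z"
      by (rule cInf_lessD[THEN bexE])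
    then show ?thesis
      using cdf_nondecreasing[of z' z] by auto
  qed
  have "((cdf \<rho>) \<longlongrightarrow> cdf \<rho> i) (at_right i)"
    using cdf_is_right_cont[of i] by (simp add: continuous_within)
  then have "y \<le> cdf \<rho> i"
    by (rule tendsto_lowerbound) (auto intro: up eventually_at_right_less eventually_mono[OF eventually_at_right_less])
  moreover have "i \<le> z" if "y \<le> cdf \<rho> z" for z
    unfolding i_def using that bdd by (intro cInf_lower) auto
  ultimately have "quantile \<rho> y = i"
    unfolding quantile_def by (intro Least_equality) auto
  with \<open>y \<le> cdf \<rho> i\<close> \<open>\<And>z. y \<le> cdf \<rho> z \<Longrightarrow> i \<le> z\<close> show ?thesis
    using cdf_nondecreasing[of i s] by auto
qed

lemma (in real_distribution) ex_cdf_ge: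
  assumes "y < 1" shows "\<exists>z. y \<le> cdf M z"
proof -
  have "eventually (\<lambda>z. y < cdf M z) at_top"
    using cdf_lim_at_top_prob assms by (rule order_tendstoD)
  then show ?thesis
    by (auto simp: eventually_at_top_linorder intro: less_imp_le)
qed

lemma (in real_distribution) ex_cdf_eq:
  assumes c: "\<And>x. isCont (cdf M) x" and y: "0 < y" "y < 1"
  shows "\<exists>z. cdf M z = y"
proof -
  have "eventually (\<lambda>z. cdf M z < y) at_bot"
    using cdf_lim_at_bot y(1) by (rule order_tendstoD)
  then obtain a where a: "cdf M a < y"
    by (auto simp: eventually_at_bot_linorder)
  obtain b where b: "y \<le> cdf M b"
    using ex_cdf_ge[OF y(2)] by auto
  have "a \<le> b"
    using a b cdf_nondecreasing[of b a] by linarith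
  then show ?thesis
    using IVT[of "cdf M" a y b] a b c by auto
qed

lemma (in real_distribution) borel_measurable_cdf [measurable]: "cdf M \<in> borel_measurable borel"
  by (intro borel_measurable_mono monoI cdf_nondecreasing)

text \<open>Probability integral transform: a sample of a continuous law, inserted into its own
  distribution function, is uniform. The levels 0 and 1 are separated because they need not be
  attained at any point.\<close>

lemma (in real_distribution) measure_cdf_le:
  assumes c: "\<And>x. isCont (cdf M) x" and y: "0 \<le> y" "y \<le> 1"
  shows "measure M {a. cdf M a \<le> y} = y"
proof (cases "y = 1")
  case True
  then have "{a. cdf M a \<le> y} = space M"
    using cdf_bounded_prob by auto
  then show ?thesis
    using prob_space True by simp
next
  case False
  \<comment> \<open>The distribution function may be flat at level \<open>y\<close>, so a point of
    that level need not bound the set; a point of a slightly higher level \<open>z\<close>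
    does.\<close>
  have le: "measure M {a. cdf M a \<le> y} \<le> z" if "y < z" "z < 1" for z
  proof -
    have "0 < z" using that y by linarith
    then obtain x where x: "cdf M x = z"
      using ex_cdf_eq[OF c, of z] \<open>z < 1\<close> by auto
    have "a \<le> x" if "cdf M a \<le> y" for a
      using cdf_nondecreasing[of x a] x that \<open>y < z\<close> by (cases "a \<le> x") auto
    then have "{a. cdf M a \<le> y} \<subseteq> {..x}"
      by auto
    then have "measure M {a. cdf M a \<le> y} \<le> cdf M x"
      unfolding cdf_def by (intro finite_measure_mono) auto
    then show ?thesis by (simp add: x)
  qed
  have "measure M {a. cdf M a \<le> y} \<le> y"
  proof (rule dense_ge_bounded[of y 1])
    show "y < 1" using False y by simp
  qed (use le in auto)
  moreover have "y \<le> measure M {a. cdf M a \<le> y}"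
  proof (cases "y = 0")
    case False
    with \<open>y \<noteq> 1\<close> obtain x where x: "cdf M x = y"
      using ex_cdf_eq[OF c, of y] y by auto
    have "measure M {..x} \<le> measure M {a. cdf M a \<le> y}"
      using cdf_nondecreasing[of _ x] x by (intro finite_measure_mono) auto
    then show ?thesis using x by (simp add: cdf_def)
  qed simp
  ultimately show ?thesis by simp
qed

text \<open>The levels 0 and 1 are those at which \<open>quantile\<close> may return the unspecified
  value of \<open>LEAST\<close>; a continuous law almost never produces them.\<close>

lemma (in real_distribution) AE_cdf_in_01:
  assumes c: "\<And>x. isCont (cdf M) x"
  shows "AE a in M. 0 < cdf M a \<and> cdf M a < 1"
proof -
  have "measure M {a. cdf M a \<le> 0} = 0"
    by (rule measure_cdf_le[OF c]) auto
  then have "{a. cdf M a \<le> 0} \<in> null_sets M"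
    by (simp add: null_sets_def emeasure_eq_measure)
  then have 0: "AE a in M. 0 < cdf M a"
    by (rule AE_I') auto
  have "measure M {a. 1 \<le> cdf M a} \<le> e" if "0 < e" "e < 1" for e
  proof -
    have "measure M {a. 1 \<le> cdf M a} \<le> measure M (space M - {a. cdf M a \<le> 1 - e})"
      using that by (intro finite_measure_mono) auto
    also have "\<dots> = e"
      using measure_cdf_le[OF c, of "1 - e"] that by (subst prob_compl) auto
    finally show ?thesis .
  qed
  then have "measure M {a. 1 \<le> cdf M a} \<le> 0"
    by (intro dense_ge_bounded[of 0 1]) auto
  then have "{a. 1 \<le> cdf M a} \<in> null_sets M"
    by (simp add: null_sets_def emeasure_eq_measure measure_le_0_iff)
  then have 1: "AE a in M. cdf M a < 1"
    by (rule AE_I') auto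
  show ?thesis using 0 1 by eventually_elim simp
qed

subsection \<open>Quadratic cost and distribution functions\<close>

lemma square_diff_eq_nn_integral:
  fixes a b :: real
  shows "ennreal ((a - b)\<^sup>2) = (\<integral>\<^sup>+s. \<integral>\<^sup>+t. indicator {a..<b} s * indicator {a..<b} t
            + indicator {b..<a} s * indicator {b..<a} t \<partial>lborel \<partial>lborel)"
proof -
  have "(\<integral>\<^sup>+s. \<integral>\<^sup>+t. indicator {a..<b} s * indicator {a..<b} t
            + indicator {b..<a} s * indicator {b..<a} t \<partial>lborel \<partial>lborel)
      = emeasure lborel {a..<b} * emeasure lborel {a..<b} + emeasure lborel {b..<a} * emeasure lborel {b..<a}"
    by (simp add: nn_integral_add nn_integral_cmult nn_integral_multc)
  also have "\<dots> = ennreal ((a - b)\<^sup>2)"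
    by (cases "a \<le> b") (simp_all add: ennreal_mult[symmetric] power2_eq_square algebra_simps)
  finally show ?thesis ..
qed

text \<open>
  \<open>(a - b)\<^sup>2\<close> is the area of a square with diagonal from \<open>(a, a)\<close> to \<open>(b, b)\<close>. By Tonelli the quadratic
  cost is therefore an integral of crossing probabilities, and these are minimized pointwise by
  the monotone coupling.
\<close>

definition cross_prob :: "'w measure \<Rightarrow> ('w \<Rightarrow> real) \<Rightarrow> ('w \<Rightarrow> real) \<Rightarrow> real \<Rightarrow> real \<Rightarrow> ennreal" where
  "cross_prob N A B s t =
     emeasure N {w \<in> space N. A w \<le> min s t \<and> max s t < B w}
     + emeasure N {w \<in> space N. B w \<le> min s t \<and> max s t < A w}"

lemma nn_integral_square_diff:
  assumes "sigma_finite_measure N"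
    and [measurable]: "A \<in> borel_measurable N" "B \<in> borel_measurable N"
  shows "(\<integral>\<^sup>+w. ennreal ((A w - B w)\<^sup>2) \<partial>N)
       = (\<integral>\<^sup>+s. \<integral>\<^sup>+t. cross_prob N A B s t \<partial>lborel \<partial>lborel)"
proof -
  interpret N: sigma_finite_measure N by fact
  interpret L: pair_sigma_finite N "lborel :: real measure" ..
  interpret L2: pair_sigma_finite N "lborel \<Otimes>\<^sub>M lborel :: (real \<times> real) measure"
    unfolding pair_sigma_finite_def using sigma_finite_pair_measure[OF sigma_finite_lborel sigma_finite_lborel] N.sigma_finite_measure_axioms
    by auto
  define f where "f w s t = (indicator {A w..<B w} s * indicator {A w..<B w} t
            + indicator {B w..<A w} s * indicator {B w..<A w} t :: ennreal)" for w s t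
  \<comment> \<open>Both \<open>s\<close> and \<open>t\<close> lie in the interval exactly when it
    starts at or before the smaller and ends after the larger of them. For fixed \<open>s\<close>
    and \<open>t\<close> the integrand is thus a sum of indicators of events in
    \<open>w\<close>.\<close>
  have f: "f w s t = indicator {w. A w \<le> min s t \<and> max s t < B w} w
     + indicator {w. B w \<le> min s t \<and> max s t < A w} w" for w s t
    by (auto simp: f_def indicator_def)
  have [measurable]: "(\<lambda>(w,s,t). f w s t) \<in> borel_measurable (N \<Otimes>\<^sub>M lborel \<Otimes>\<^sub>M lborel)"
    unfolding f indicator_def by measurable
  have "(\<integral>\<^sup>+w. ennreal ((A w - B w)\<^sup>2) \<partial>N) = (\<integral>\<^sup>+w. \<integral>\<^sup>+s. \<integral>\<^sup>+t. f w s t \<partial>lborel \<partial>lborel \<partial>N)"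
    by (simp add: square_diff_eq_nn_integral f_def)
  also have "\<dots> = (\<integral>\<^sup>+w. \<integral>\<^sup>+z. f w (fst z) (snd z) \<partial>(lborel \<Otimes>\<^sub>M lborel) \<partial>N)"
  proof (intro nn_integral_cong)
    fix w
    show "(\<integral>\<^sup>+s. \<integral>\<^sup>+t. f w s t \<partial>lborel \<partial>lborel) = (\<integral>\<^sup>+z. f w (fst z) (snd z) \<partial>(lborel \<Otimes>\<^sub>M lborel))"
      using lborel.nn_integral_fst[of "\<lambda>z. f w (fst z) (snd z)" lborel]
      by (simp add: f_def indicator_def)
  qed
  also have "\<dots> = (\<integral>\<^sup>+z. \<integral>\<^sup>+w. f w (fst z) (snd z) \<partial>N \<partial>(lborel \<Otimes>\<^sub>M lborel))"
    by (rule L2.Fubini'[symmetric]) (simp add: f indicator_def)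
  also have "\<dots> = (\<integral>\<^sup>+s. \<integral>\<^sup>+t. \<integral>\<^sup>+w. f w s t \<partial>N \<partial>lborel \<partial>lborel)"
  proof -
    have "(\<lambda>z. \<integral>\<^sup>+w. f w (fst z) (snd z) \<partial>N) \<in> borel_measurable (lborel \<Otimes>\<^sub>M lborel)"
      by (rule N.borel_measurable_nn_integral) (simp add: f indicator_def)
    from lborel.nn_integral_fst[OF this] show ?thesis by simp
  qed
  also have "\<dots> = (\<integral>\<^sup>+s. \<integral>\<^sup>+t. cross_prob N A B s t \<partial>lborel \<partial>lborel)"
  proof (intro nn_integral_cong)
    fix s t :: real
    have "(\<integral>\<^sup>+w. f w s t \<partial>N)
      = (\<integral>\<^sup>+w. indicator {w\<in>space N. A w \<le> min s t \<and> max s t < B w} w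
     + indicator {w\<in>space N. B w \<le> min s t \<and> max s t < A w} w \<partial>N)"
      unfolding f by (intro nn_integral_cong) (auto simp: indicator_def)
    also have "\<dots> = cross_prob N A B s t"
      by (subst nn_integral_add) (auto simp: cross_prob_def)
    finally show "(\<integral>\<^sup>+w. f w s t \<partial>N) = cross_prob N A B s t" .
  qed
  finally show ?thesis .
qed

subsection \<open>Slices\<close>

lemma sets_W2_space: "\<sigma> \<in> W2_space \<Longrightarrow> sets \<sigma> = sets borel"
  by (simp add: W2_space_def)

lemma space_W2_space: "\<sigma> \<in> W2_space \<Longrightarrow> space \<sigma> = UNIV"
  using sets_eq_imp_space_eq[OF sets_W2_space] by auto

lemma prob_space_W2_space: "\<sigma> \<in> W2_space \<Longrightarrow> prob_space \<sigma>"
  by (simp add: W2_space_def)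

lemma W2_acD: "\<sigma> \<in> W2_ac \<Longrightarrow> \<sigma> \<in> W2_space"
  by (simp add: W2_ac_def)

lemma W2_space_in_subprob: "\<sigma> \<in> W2_space \<Longrightarrow> \<sigma> \<in> space (subprob_algebra borel)"
  by (auto simp: space_subprob_algebra W2_space_def intro: prob_space_imp_subprob_space)

lemma cdf_slice:
  fixes \<sigma> :: "'a::euclidean_space measure"
  assumes "sets \<sigma> = sets borel"
  shows "cdf (slice \<theta> \<sigma>) t = measure \<sigma> {x. x \<bullet> \<theta> \<le> t}"
proof -
  note assms[measurable_cong]
  show ?thesis
    using sets_eq_imp_space_eq[OF assms]
    by (simp add: cdf_def slice_def measure_distr vimage_def)
qed

lemma real_distribution_slice:
  fixes \<sigma> :: "'a::euclidean_space measure"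
  assumes "prob_space \<sigma>" "sets \<sigma> = sets borel"
  shows "real_distribution (slice \<theta> \<sigma>)"
proof -
  interpret prob_space \<sigma> by fact
  note assms(2)[measurable_cong]
  show ?thesis unfolding slice_def by simp
qed

lemma real_distribution_slice_W2: "\<sigma> \<in> W2_space \<Longrightarrow> real_distribution (slice \<theta> \<sigma>)"
  by (intro real_distribution_slice sets_W2_space prob_space_W2_space)

text \<open>A jump of the slice would be a hyperplane of positive mass. Absolute continuity enters
  the argument through this exclusion.\<close>

lemma isCont_cdf_slice:
  fixes \<sigma> :: "'a::euclidean_space measure"
  assumes \<sigma>: "\<sigma> \<in> W2_ac" and \<theta>: "\<theta> \<in> sphere 0 1"
  shows "isCont (cdf (slice \<theta> \<sigma>)) t"
proof -
  note W2_acD[OF \<sigma>, THEN sets_W2_space, measurable_cong]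
  interpret s: real_distribution "slice \<theta> \<sigma>"
    by (rule real_distribution_slice_W2[OF W2_acD[OF \<sigma>]])
  have "\<theta> \<noteq> 0" using \<theta> by auto
  then have "negligible {x. \<theta> \<bullet> x = t}"
    by (intro negligible_hyperplane) simp
  then have "{x. x \<bullet> \<theta> = t} \<in> null_sets lebesgue"
    by (simp add: negligible_iff_null_sets inner_commute)
  moreover have m: "{x. x \<bullet> \<theta> = t} \<in> sets borel" by measurable
  ultimately have "{x. x \<bullet> \<theta> = t} \<in> null_sets lborel"
    by (simp add: null_sets_completion_iff)
  then have "{x. x \<bullet> \<theta> = t} \<in> null_sets \<sigma>"
    using \<sigma> by (auto simp: W2_ac_def absolutely_continuous_def)
  moreover have "measure (slice \<theta> \<sigma>) {t} = measure \<sigma> {x. x \<bullet> \<theta> = t}"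
    using sets_eq_imp_space_eq[OF W2_acD[OF \<sigma>, THEN sets_W2_space]]
    by (simp add: slice_def measure_distr vimage_def)
  ultimately show ?thesis
    by (simp add: s.isCont_cdf measure_def null_sets_def)
qed

text \<open>\<open>transport \<mu> \<sigma> \<theta> x\<close> is \<open>T\<^sup>\<theta> (x \<bullet> \<theta>)\<close> in the notation of the paper.\<close>

definition transport :: "'a::euclidean_space measure \<Rightarrow> 'a measure \<Rightarrow> 'a \<Rightarrow> 'a \<Rightarrow> real" where
  "transport \<mu> \<sigma> \<theta> x = quantile (slice \<theta> \<mu>) (cdf (slice \<theta> \<sigma>) (x \<bullet> \<theta>))"

definition displ :: "'a::euclidean_space measure \<Rightarrow> 'a measure \<Rightarrow> 'a \<Rightarrow> 'a \<Rightarrow> real" where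
  "displ \<mu> \<sigma> \<theta> x = x \<bullet> \<theta> - transport \<mu> \<sigma> \<theta> x"

lemma slice_map_displ: "slice_map \<mu> \<sigma> \<theta> x = x - displ \<mu> \<sigma> \<theta> x *\<^sub>R \<theta>"
  by (simp add: slice_map_def displ_def transport_def algebra_simps)

lemma measure_cdf_slice_le:
  assumes \<sigma>: "\<sigma> \<in> W2_ac" and \<theta>: "\<theta> \<in> sphere 0 1" and y: "0 \<le> y" "y \<le> 1"
  shows "measure \<sigma> {x. cdf (slice \<theta> \<sigma>) (x \<bullet> \<theta>) \<le> y} = y"
proof -
  note W2_acD[OF \<sigma>, THEN sets_W2_space, measurable_cong]
  interpret s: real_distribution "slice \<theta> \<sigma>"
    by (rule real_distribution_slice_W2[OF W2_acD[OF \<sigma>]])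
  have "{a. cdf (slice \<theta> \<sigma>) a \<le> y} \<in> sets borel" by measurable
  then have "measure (slice \<theta> \<sigma>) {a. cdf (slice \<theta> \<sigma>) a \<le> y} = measure \<sigma> {x. cdf (slice \<theta> \<sigma>) (x \<bullet> \<theta>) \<le> y}"
    using sets_eq_imp_space_eq[OF W2_acD[OF \<sigma>, THEN sets_W2_space]]
    by (subst (1) slice_def) (simp add: measure_distr vimage_def)
  then show ?thesis
    using s.measure_cdf_le[OF isCont_cdf_slice[OF \<sigma> \<theta>] y] by simp
qed

text \<open>The exceptional points are those whose level is not strictly between 0 and 1. This does
  not involve \<open>s\<close>, so a single null set serves all thresholds.\<close>

lemma AE_transport_le_iff:
  assumes \<sigma>: "\<sigma> \<in> W2_ac" and \<theta>: "\<theta> \<in> sphere 0 1" and \<mu>: "\<mu> \<in> W2_space"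
  shows "AE x in \<sigma>. \<forall>s. transport \<mu> \<sigma> \<theta> x \<le> s \<longleftrightarrow> cdf (slice \<theta> \<sigma>) (x \<bullet> \<theta>) \<le> cdf (slice \<theta> \<mu>) s"
proof -
  note W2_acD[OF \<sigma>, THEN sets_W2_space, measurable_cong]
  interpret s: real_distribution "slice \<theta> \<sigma>"
    by (rule real_distribution_slice_W2[OF W2_acD[OF \<sigma>]])
  interpret m: real_distribution "slice \<theta> \<mu>"
    by (rule real_distribution_slice_W2[OF \<mu>])
  have "AE a in distr \<sigma> borel (\<lambda>x. x \<bullet> \<theta>). 0 < cdf (slice \<theta> \<sigma>) a \<and> cdf (slice \<theta> \<sigma>) a < 1"
    using s.AE_cdf_in_01[OF isCont_cdf_slice[OF \<sigma> \<theta>]] unfolding slice_def .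
  then have "AE x in \<sigma>. 0 < cdf (slice \<theta> \<sigma>) (x \<bullet> \<theta>) \<and> cdf (slice \<theta> \<sigma>) (x \<bullet> \<theta>) < 1"
    by (rule AE_distrD[rotated]) simp
  then show ?thesis
    by eventually_elim
      (auto simp: transport_def quantile_le_iff[OF m.real_distribution_axioms _ m.ex_cdf_ge])
qed

subsection \<open>Measurable dependence on the measure\<close>

text \<open>The measure is itself a variable, since the iterates are random measures; the
  half-spaces are the sections of one measurable set in the product.\<close>

lemma borel_measurable_cdf_slice:
  fixes S :: "'w \<Rightarrow> 'a::euclidean_space measure"
  assumes S: "S \<in> N \<rightarrow>\<^sub>M subprob_algebra borel"
    and [measurable]: "th \<in> borel_measurable N" "t \<in> borel_measurable N"
  shows "(\<lambda>w. cdf (slice (th w) (S w)) (t w)) \<in> borel_measurable N"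
proof -
  have "{z \<in> space (N \<Otimes>\<^sub>M borel). snd z \<bullet> th (fst z) \<le> t (fst z)} \<in> sets (N \<Otimes>\<^sub>M borel)"
    by measurable
  also have "{z \<in> space (N \<Otimes>\<^sub>M borel). snd z \<bullet> th (fst z) \<le> t (fst z)}
      = (SIGMA w:space N. {x. x \<bullet> th w \<le> t w})"
    by (auto simp: space_pair_measure)
  finally have "(\<lambda>w. measure (S w) {x. x \<bullet> th w \<le> t w}) \<in> borel_measurable N"
    by (rule measure_measurable_subprob_algebra2[OF _ S])
  moreover have "cdf (slice (th w) (S w)) (t w) = measure (S w) {x. x \<bullet> th w \<le> t w}"
    if "w \<in> space N" for w
    using measurable_space[OF S that] by (intro cdf_slice) (simp add: space_subprob_algebra)
  ultimately show ?thesis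
    by (simp cong: measurable_cong)
qed

lemma borel_measurable_quantile_slice:
  fixes \<mu> :: "'a::euclidean_space measure"
  assumes \<mu>: "\<mu> \<in> W2_space"
    and [measurable]: "th \<in> borel_measurable N" "y \<in> borel_measurable N"
  shows "(\<lambda>w. quantile (slice (th w) \<mu>) (y w)) \<in> borel_measurable N"
proof (rule borel_measurableI_le)
  fix s :: real
  let ?G = "\<lambda>w z. cdf (slice (th w) \<mu>) z"
  have rd: "real_distribution (slice (th w) \<mu>)" for w
    by (rule real_distribution_slice_W2[OF \<mu>])
  have [measurable]: "(\<lambda>w. ?G w z) \<in> borel_measurable N" for z
    using W2_space_in_subprob[OF \<mu>] by (intro borel_measurable_cdf_slice) auto
  \<comment> \<open>Where the minimum fails to exist, the predicate under \<open>LEAST\<close> is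
    constant, so the quantile is one fixed real number there and cannot spoil measurability.\<close>
  have c0: "quantile (slice (th w) \<mu>) (y w) = (LEAST z. True)" if "y w \<le> 0" for w
  proof -
    interpret real_distribution "slice (th w) \<mu>" by (rule rd)
    have "y w \<le> cdf (slice (th w) \<mu>) z" for z
      using cdf_nonneg[of z] that by linarith
    then show ?thesis by (simp add: quantile_def)
  qed
  \<comment> \<open>Monotonicity allows the test whether the level is reached to run over natural
    numbers only, which keeps the condition countable.\<close>
  have c1: "quantile (slice (th w) \<mu>) (y w) = (LEAST z. False)" if "\<forall>n::nat. ?G w (real n) < y w" for w
  proof -
    interpret real_distribution "slice (th w) \<mu>" by (rule rd)
    have "\<not> y w \<le> ?G w z" for z
    proof -
      obtain n :: nat where "z \<le> real n" using real_arch_simple by blast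
      then show ?thesis using that[rule_format, of n] cdf_nondecreasing[of z "real n"] by linarith
    qed
    then show ?thesis by (simp add: quantile_def)
  qed
  have "(quantile (slice (th w) \<mu>) (y w) \<le> s) \<longleftrightarrow>
      (y w \<le> 0 \<and> (LEAST z. True) \<le> s) \<or> (0 < y w \<and> (\<forall>n::nat. ?G w (real n) < y w) \<and> (LEAST z. False) \<le> s)
      \<or> (0 < y w \<and> (\<exists>n::nat. y w \<le> ?G w (real n)) \<and> y w \<le> ?G w s)" for w
    using c0[of w] c1[of w] quantile_le_iff[OF rd, of "y w" w s] by (fastforce simp: not_less not_le)
  then show "{w \<in> space N. quantile (slice (th w) \<mu>) (y w) \<le> s} \<in> sets N"
    by simp
qed

lemma borel_measurable_transport:
  fixes S :: "'w \<Rightarrow> 'a::euclidean_space measure"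
  assumes "\<mu> \<in> W2_space" "S \<in> N \<rightarrow>\<^sub>M subprob_algebra borel"
    and [measurable]: "th \<in> borel_measurable N" "x \<in> borel_measurable N"
  shows "(\<lambda>w. transport \<mu> (S w) (th w) (x w)) \<in> borel_measurable N"
  unfolding transport_def
  by (intro borel_measurable_quantile_slice borel_measurable_cdf_slice assms) measurable

lemma borel_measurable_transport_fixed:
  assumes "\<mu> \<in> W2_space" "\<sigma> \<in> W2_ac"
    and "th \<in> borel_measurable N" "x \<in> borel_measurable N"
  shows "(\<lambda>w. transport \<mu> \<sigma> (th w) (x w)) \<in> borel_measurable N"
  using W2_space_in_subprob[OF W2_acD[OF assms(2)]] by (intro borel_measurable_transport assms) auto

lemma borel_measurable_displ:
  fixes S :: "'w \<Rightarrow> 'a::euclidean_space measure"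
  assumes "\<mu> \<in> W2_space" "S \<in> N \<rightarrow>\<^sub>M subprob_algebra borel"
    and [measurable]: "th \<in> borel_measurable N" "x \<in> borel_measurable N"
  shows "(\<lambda>w. displ \<mu> (S w) (th w) (x w)) \<in> borel_measurable N"
  unfolding displ_def
  by (intro borel_measurable_diff borel_measurable_transport assms) measurable

subsection \<open>Optimality of the slice transport\<close>

text \<open>The event says that a uniform level stays below
  \<open>cdf (slice \<theta> \<mu>) s\<close>. Hence the law of the transported projection is the
  slice of \<mu>, independently of \<sigma>.\<close>

lemma measure_transport_le:
  assumes \<sigma>: "\<sigma> \<in> W2_ac" and \<theta>: "\<theta> \<in> sphere 0 1" and \<mu>: "\<mu> \<in> W2_space"
  shows "measure \<sigma> {x. transport \<mu> \<sigma> \<theta> x \<le> s} = cdf (slice \<theta> \<mu>) s"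
proof -
  note W2_acD[OF \<sigma>, THEN sets_W2_space, measurable_cong]
  interpret m: real_distribution "slice \<theta> \<mu>"
    by (rule real_distribution_slice_W2[OF \<mu>])
  interpret s: real_distribution "slice \<theta> \<sigma>"
    by (rule real_distribution_slice_W2[OF W2_acD[OF \<sigma>]])
  have [measurable]: "(\<lambda>x. transport \<mu> \<sigma> \<theta> x) \<in> borel_measurable borel"
    by (intro borel_measurable_transport_fixed \<mu> \<sigma>) auto
  have "measure \<sigma> {x. transport \<mu> \<sigma> \<theta> x \<le> s} = measure \<sigma> {x. cdf (slice \<theta> \<sigma>) (x \<bullet> \<theta>) \<le> cdf (slice \<theta> \<mu>) s}"
    using AE_transport_le_iff[OF \<sigma> \<theta> \<mu>] by (intro measure_eq_AE) auto
  then show ?thesis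
    using measure_cdf_slice_le[OF \<sigma> \<theta>] m.cdf_nonneg m.cdf_bounded_prob by simp
qed

text \<open>For the monotone map an upward crossing forces the level of the point into the interval
  from \<open>G M\<close> to \<open>F m\<close>, whose length is its probability because levels are
  uniform; downward crossings are similar. The bound involves the two marginals only, and
  \<open>transport_optimal\<close> shows that every coupling has to pay it.\<close>

lemma cross_prob_transport_le:
  assumes \<sigma>: "\<sigma> \<in> W2_ac" and \<theta>: "\<theta> \<in> sphere 0 1" and \<mu>: "\<mu> \<in> W2_space"
  shows "cross_prob \<sigma> (\<lambda>x. x \<bullet> \<theta>) (transport \<mu> \<sigma> \<theta>) s t
    \<le> ennreal (cdf (slice \<theta> \<sigma>) (min s t) - cdf (slice \<theta> \<mu>) (max s t))
      + ennreal (cdf (slice \<theta> \<mu>) (min s t) - cdf (slice \<theta> \<sigma>) (max s t))"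
proof -
  note sets = W2_acD[OF \<sigma>, THEN sets_W2_space]
  note sets[measurable_cong]
  have space: "space \<sigma> = UNIV" using sets_eq_imp_space_eq[OF sets] by simp
  interpret S: prob_space \<sigma> using W2_acD[OF \<sigma>] by (rule prob_space_W2_space)
  interpret m: real_distribution "slice \<theta> \<mu>"
    by (rule real_distribution_slice_W2[OF \<mu>])
  interpret s: real_distribution "slice \<theta> \<sigma>"
    by (rule real_distribution_slice_W2[OF W2_acD[OF \<sigma>]])
  define F G where "F = cdf (slice \<theta> \<sigma>)" and "G = cdf (slice \<theta> \<mu>)"
  have [measurable]: "F \<in> borel_measurable borel"
    unfolding F_def by simp
  have [measurable]: "(\<lambda>x. transport \<mu> \<sigma> \<theta> x) \<in> borel_measurable borel"
    by (intro borel_measurable_transport_fixed \<mu> \<sigma>) auto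
  have F: "measure \<sigma> {x. F (x \<bullet> \<theta>) \<le> c} = c" if "0 \<le> c" "c \<le> 1" for c
    unfolding F_def using measure_cdf_slice_le[OF \<sigma> \<theta> that] .
  have F01: "0 \<le> F z" "F z \<le> 1" "0 \<le> G z" "G z \<le> 1" for z
    using s.cdf_nonneg s.cdf_bounded_prob m.cdf_nonneg m.cdf_bounded_prob by (auto simp: F_def G_def)
  have Fmono: "F y \<le> F z" if "y \<le> z" for y z
    using that unfolding F_def by (rule s.cdf_nondecreasing)
  have Fz: "measure \<sigma> {x. x \<bullet> \<theta> \<le> z} = F z" for z
    unfolding F_def by (rule cdf_slice[OF sets, symmetric])
  note T = AE_transport_le_iff[OF \<sigma> \<theta> \<mu>]
  define m M where "m = min s t" and "M = max s t"
  have "emeasure \<sigma> {x \<in> space \<sigma>. x \<bullet> \<theta> \<le> m \<and> M < transport \<mu> \<sigma> \<theta> x} \<le> ennreal (F m - G M)"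
  proof (cases "F m \<le> G M")
    case True
    have "AE x in \<sigma>. \<not> (x \<bullet> \<theta> \<le> m \<and> M < transport \<mu> \<sigma> \<theta> x)"
      using T
    proof eventually_elim
      case (elim x)
      show ?case
        using elim[rule_format, of M] Fmono[of "x \<bullet> \<theta>" m] True unfolding F_def G_def by fastforce
    qed
    then have "emeasure \<sigma> {x \<in> space \<sigma>. x \<bullet> \<theta> \<le> m \<and> M < transport \<mu> \<sigma> \<theta> x} = 0"
      by (subst (asm) AE_iff_measurable[OF _ refl]) auto
    then show ?thesis by simp
  next
    case False
    have "emeasure \<sigma> {x \<in> space \<sigma>. x \<bullet> \<theta> \<le> m \<and> M < transport \<mu> \<sigma> \<theta> x}
        \<le> emeasure \<sigma> ({x. F (x \<bullet> \<theta>) \<le> F m} - {x. F (x \<bullet> \<theta>) \<le> G M})"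
      using T by (intro emeasure_mono_AE) (auto elim!: eventually_mono simp: F_def G_def not_le[symmetric] intro!: s.cdf_nondecreasing)
    also have "\<dots> = ennreal (measure \<sigma> {x. F (x \<bullet> \<theta>) \<le> F m} - measure \<sigma> {x. F (x \<bullet> \<theta>) \<le> G M})"
      using False by (subst S.emeasure_eq_measure, subst S.finite_measure_Diff) auto
    finally show ?thesis using F01 F by simp
  qed
  moreover have "emeasure \<sigma> {x \<in> space \<sigma>. transport \<mu> \<sigma> \<theta> x \<le> m \<and> M < x \<bullet> \<theta>} \<le> ennreal (G m - F M)"
  proof -
    \<comment> \<open>Taking the maximum with \<open>F M\<close> makes the removed half-space a
      subset, so that the measure of the difference is a difference of measures; it also covers the
      case \<open>G m < F M\<close>, where the result is 0.\<close>
    have "emeasure \<sigma> {x \<in> space \<sigma>. transport \<mu> \<sigma> \<theta> x \<le> m \<and> M < x \<bullet> \<theta>}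
        \<le> emeasure \<sigma> ({x. F (x \<bullet> \<theta>) \<le> max (G m) (F M)} - {x. x \<bullet> \<theta> \<le> M})"
      using T by (intro emeasure_mono_AE) (auto elim!: eventually_mono simp: F_def G_def le_max_iff_disj)
    also have "\<dots> = ennreal (measure \<sigma> {x. F (x \<bullet> \<theta>) \<le> max (G m) (F M)} - measure \<sigma> {x. x \<bullet> \<theta> \<le> M})"
      using Fmono by (subst S.emeasure_eq_measure, subst S.finite_measure_Diff) (auto simp: le_max_iff_disj)
    also have "\<dots> = ennreal (max (G m) (F M) - F M)"
      using F01 by (subst F) (auto simp: Fz max_def)
    also have "\<dots> \<le> ennreal (G m - F M)"
      by (auto simp: max_def ennreal_neg)
    finally show ?thesis .
  qed
  ultimately show ?thesis
    unfolding cross_prob_def F_def G_def m_def M_def by (rule add_mono)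
qed

text \<open>A point with \<open>A \<le> m\<close> either crosses above \<open>M\<close> or has
  \<open>B \<le> M\<close>, so the crossing probability of any coupling is at least the difference
  of the marginals, which bounds that of the monotone map. The competitor lives on an arbitrary
  space: it may be a product, or a pair of functions on the old measure that do not form a map on
  the new one.\<close>

lemma transport_optimal:
  assumes \<sigma>: "\<sigma> \<in> W2_ac" and \<theta>: "\<theta> \<in> sphere 0 1" and \<mu>: "\<mu> \<in> W2_space"
    and N: "prob_space N" and [measurable]: "A \<in> borel_measurable N" "B \<in> borel_measurable N"
    and A: "\<And>s. measure N {w \<in> space N. A w \<le> s} = cdf (slice \<theta> \<sigma>) s"
    and B: "\<And>s. measure N {w \<in> space N. B w \<le> s} = cdf (slice \<theta> \<mu>) s"
  shows "(\<integral>\<^sup>+x. ennreal ((displ \<mu> \<sigma> \<theta> x)\<^sup>2) \<partial>\<sigma>) \<le> (\<integral>\<^sup>+w. ennreal ((A w - B w)\<^sup>2) \<partial>N)"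
proof -
  interpret N: prob_space N by fact
  note W2_acD[OF \<sigma>, THEN sets_W2_space, measurable_cong]
  interpret S: prob_space \<sigma> using W2_acD[OF \<sigma>] by (rule prob_space_W2_space)
  have [measurable]: "(\<lambda>x. transport \<mu> \<sigma> \<theta> x) \<in> borel_measurable borel"
    by (intro borel_measurable_transport_fixed \<mu> \<sigma>) auto
  have diff: "ennreal (measure N {w \<in> space N. X w \<le> m} - measure N {w \<in> space N. Y w \<le> M})
      \<le> emeasure N {w \<in> space N. X w \<le> m \<and> M < Y w}"
    if [measurable]: "X \<in> borel_measurable N" "Y \<in> borel_measurable N" for X Y :: "_ \<Rightarrow> real" and m M
  proof -
    have "measure N {w \<in> space N. X w \<le> m} \<le> measure N ({w \<in> space N. X w \<le> m \<and> M < Y w} \<union> {w \<in> space N. Y w \<le> M})"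
      by (intro N.finite_measure_mono) auto
    also have "\<dots> \<le> measure N {w \<in> space N. X w \<le> m \<and> M < Y w} + measure N {w \<in> space N. Y w \<le> M}"
      by (intro measure_Un_le) auto
    finally show ?thesis
      by (simp add: N.emeasure_eq_measure)
  qed
  have "(\<integral>\<^sup>+x. ennreal ((displ \<mu> \<sigma> \<theta> x)\<^sup>2) \<partial>\<sigma>)
      = (\<integral>\<^sup>+s. \<integral>\<^sup>+t. cross_prob \<sigma> (\<lambda>x. x \<bullet> \<theta>) (transport \<mu> \<sigma> \<theta>) s t \<partial>lborel \<partial>lborel)"
    unfolding displ_def by (intro nn_integral_square_diff) (unfold_locales, measurable)
  also have "\<dots> \<le> (\<integral>\<^sup>+s. \<integral>\<^sup>+t. cross_prob N A B s t \<partial>lborel \<partial>lborel)"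
  proof (intro nn_integral_mono)
    fix s t :: real
    show "cross_prob \<sigma> (\<lambda>x. x \<bullet> \<theta>) (transport \<mu> \<sigma> \<theta>) s t \<le> cross_prob N A B s t"
      using cross_prob_transport_le[OF \<sigma> \<theta> \<mu>, of s t]
        add_mono[OF diff[of A B "min s t" "max s t"] diff[of B A "min s t" "max s t"]]
      unfolding A B cross_prob_def[of N] by simp
  qed
  also have "\<dots> = (\<integral>\<^sup>+w. ennreal ((A w - B w)\<^sup>2) \<partial>N)"
    by (intro nn_integral_square_diff[symmetric]) (unfold_locales, measurable)
  finally show ?thesis .
qed

subsection \<open>Stability of the slice transport under coupling\<close>

lemma couplings_sets: "\<pi> \<in> couplings \<sigma> \<eta> \<Longrightarrow> sets \<pi> = sets (borel \<Otimes>\<^sub>M borel)"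
  by (simp add: couplings_def)

lemma couplings_space: "\<pi> \<in> couplings \<sigma> \<eta> \<Longrightarrow> space \<pi> = UNIV"
  using sets_eq_imp_space_eq[OF couplings_sets] by (auto simp: space_pair_measure)

lemma couplings_fst: "\<pi> \<in> couplings \<sigma> \<eta> \<Longrightarrow> distr \<pi> borel fst = \<sigma>"
  by (simp add: couplings_def)

lemma couplings_snd: "\<pi> \<in> couplings \<sigma> \<eta> \<Longrightarrow> distr \<pi> borel snd = \<eta>"
  by (simp add: couplings_def)

lemma couplings_prob_space:
  assumes \<pi>: "\<pi> \<in> couplings \<sigma> \<eta>" and \<sigma>: "prob_space \<sigma>"
  shows "prob_space \<pi>"
proof -
  note couplings_sets[OF \<pi>, measurable_cong]
  show ?thesis
    using \<sigma> couplings_fst[OF \<pi>] by (intro prob_space_distrD[of fst \<pi> borel]) auto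
qed

lemma couplings_AE:
  assumes \<pi>: "\<pi> \<in> couplings \<sigma> \<eta>"
  shows "AE x in \<sigma>. Q x \<Longrightarrow> AE z in \<pi>. Q (fst z)"
    and "AE x in \<eta>. R x \<Longrightarrow> AE z in \<pi>. R (snd z)"
proof -
  note couplings_sets[OF \<pi>, measurable_cong]
  show "AE x in \<sigma>. Q x \<Longrightarrow> AE z in \<pi>. Q (fst z)"
    by (subst (asm) couplings_fst[OF \<pi>, symmetric], drule AE_distrD[rotated]) auto
  show "AE x in \<eta>. R x \<Longrightarrow> AE z in \<pi>. R (snd z)"
    by (subst (asm) couplings_snd[OF \<pi>, symmetric], drule AE_distrD[rotated]) auto
qed

lemma couplings_nn_integral:
  assumes \<pi>: "\<pi> \<in> couplings \<sigma> \<eta>" and [measurable]: "f \<in> borel_measurable borel"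
  shows "(\<integral>\<^sup>+z. f (fst z) \<partial>\<pi>) = (\<integral>\<^sup>+x. f x \<partial>\<sigma>)" "(\<integral>\<^sup>+z. f (snd z) \<partial>\<pi>) = (\<integral>\<^sup>+x. f x \<partial>\<eta>)"
proof -
  note couplings_sets[OF \<pi>, measurable_cong]
  show "(\<integral>\<^sup>+z. f (fst z) \<partial>\<pi>) = (\<integral>\<^sup>+x. f x \<partial>\<sigma>)"
    by (subst couplings_fst[OF \<pi>, symmetric], subst nn_integral_distr) auto
  show "(\<integral>\<^sup>+z. f (snd z) \<partial>\<pi>) = (\<integral>\<^sup>+x. f x \<partial>\<eta>)"
    by (subst couplings_snd[OF \<pi>, symmetric], subst nn_integral_distr) auto
qed

lemma couplings_measure:
  assumes \<pi>: "\<pi> \<in> couplings \<sigma> \<eta>" and [measurable]: "S \<in> sets borel"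
  shows "measure \<pi> {z. fst z \<in> S} = measure \<sigma> S" "measure \<pi> {z. snd z \<in> S} = measure \<eta> S"
proof -
  note couplings_sets[OF \<pi>, measurable_cong]
  show "measure \<pi> {z. fst z \<in> S} = measure \<sigma> S"
    by (subst couplings_fst[OF \<pi>, symmetric])
      (simp add: measure_distr vimage_def couplings_space[OF \<pi>])
  show "measure \<pi> {z. snd z \<in> S} = measure \<eta> S"
    by (subst couplings_snd[OF \<pi>, symmetric])
      (simp add: measure_distr vimage_def couplings_space[OF \<pi>])
qed

lemma sets_Collect_UNIV: "space M = UNIV \<Longrightarrow> Measurable.pred M P \<Longrightarrow> {x. P x} \<in> sets M"
  by (simp add: pred_def)

definition coupling_cost :: "('a::euclidean_space \<times> 'a) measure \<Rightarrow> ennreal" where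
  "coupling_cost \<pi> = (\<integral>\<^sup>+z. ennreal ((dist (fst z) (snd z))\<^sup>2) \<partial>\<pi>)"

section \<open>Levels of the two ends of a single coupling\<close>

context
  fixes \<sigma> \<eta> :: "'a::euclidean_space measure" and \<pi> :: "('a \<times> 'a) measure" and \<theta> :: 'a
  assumes \<sigma>: "\<sigma> \<in> W2_ac" and \<eta>: "\<eta> \<in> W2_ac" and \<pi>: "\<pi> \<in> couplings \<sigma> \<eta>"
    and \<theta>: "\<theta> \<in> sphere 0 1"
begin

interpretation \<pi>: prob_space \<pi>
  using couplings_prob_space[OF \<pi>] prob_space_W2_space[OF W2_acD[OF \<sigma>]] .

interpretation s: real_distribution "slice \<theta> \<sigma>"
  by (rule real_distribution_slice_W2[OF W2_acD[OF \<sigma>]])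

interpretation e: real_distribution "slice \<theta> \<eta>"
  by (rule real_distribution_slice_W2[OF W2_acD[OF \<eta>]])

declare couplings_sets[OF \<pi>, measurable_cong]

private lemma sp: "space \<pi> = UNIV"
  by (rule couplings_space[OF \<pi>])

private abbreviation "F \<equiv> cdf (slice \<theta> \<sigma>)"
private abbreviation "E \<equiv> cdf (slice \<theta> \<eta>)"

private lemma coupling_level:
  assumes c: "0 \<le> c" "c \<le> 1"
  shows "measure \<pi> {z. F (fst z \<bullet> \<theta>) \<le> c} = c" "measure \<pi> {z. E (snd z \<bullet> \<theta>) \<le> c} = c"
  using couplings_measure[OF \<pi>, of "{x. F (x \<bullet> \<theta>) \<le> c}"] couplings_measure[OF \<pi>, of "{x. E (x \<bullet> \<theta>) \<le> c}"]
  by (simp_all add: measure_cdf_slice_le[OF \<sigma> \<theta> c] measure_cdf_slice_le[OF \<eta> \<theta> c])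

text \<open>
  Both events below are the difference of two events of probability \<open>c\<close>, so that whichever of them
  forces the threshold \<open>\<beta>\<close> to lie between the two projections may be used in
  \<open>coupling_straddle_le\<close>.
\<close>

private lemma coupling_level_swap:
  assumes c: "0 \<le> c" "c \<le> 1"
  shows "measure \<pi> {z. E (snd z \<bullet> \<theta>) \<le> c \<and> c < F (fst z \<bullet> \<theta>)}
       = measure \<pi> {z. F (fst z \<bullet> \<theta>) \<le> c \<and> c < E (snd z \<bullet> \<theta>)}"
proof -
  let ?A = "{z. F (fst z \<bullet> \<theta>) \<le> c}" and ?B = "{z. E (snd z \<bullet> \<theta>) \<le> c}"
  have m: "?A \<in> sets \<pi>" "?B \<in> sets \<pi>"
    by (rule sets_Collect_UNIV[OF sp]; measurable)+
  have "measure \<pi> (?A - ?B) = measure \<pi> ?A - measure \<pi> (?A \<inter> ?B)"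
    "measure \<pi> (?B - ?A) = measure \<pi> ?B - measure \<pi> (?A \<inter> ?B)"
    using m by (auto simp: \<pi>.finite_measure_Diff' Int_commute)
  then show ?thesis
    using coupling_level[OF c] by (simp add: set_diff_eq not_le)
qed

text \<open>Up to null sets, the points of level at most \<open>c\<close> form half-spaces ending at
  \<alpha> and \<beta>. If the event is chosen according to the order of \<alpha> and \<beta>, then
  \<beta> separates the two projections, so the pair is more than \<open>r\<close> apart or its
  second end lies in the strip of half-width \<open>r\<close>. The strip is measured by \<eta>
  alone, which keeps it fixed along a sequence of sources.\<close>

lemma coupling_straddle_le:
  assumes c: "0 < c" "c < 1" and \<beta>: "E \<beta> = c"
  shows "measure \<pi> {z. F (fst z \<bullet> \<theta>) \<le> c \<and> c < E (snd z \<bullet> \<theta>)}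
    \<le> measure \<eta> {y. \<bar>y \<bullet> \<theta> - \<beta>\<bar> \<le> r} + measure \<pi> {z. r < dist (fst z) (snd z)}"
    (is "?q \<le> _")
proof -
  obtain \<alpha> where \<alpha>: "F \<alpha> = c"
    using s.ex_cdf_eq[OF isCont_cdf_slice[OF \<sigma> \<theta>] c] by blast
  have m: "{z. F (fst z \<bullet> \<theta>) \<le> c} \<in> sets \<pi>" "{z. E (snd z \<bullet> \<theta>) \<le> c} \<in> sets \<pi>"
    "{z. fst z \<bullet> \<theta> \<le> \<alpha>} \<in> sets \<pi>" "{z. snd z \<bullet> \<theta> \<le> \<beta>} \<in> sets \<pi>"
    "{z. \<bar>snd z \<bullet> \<theta> - \<beta>\<bar> \<le> r} \<in> sets \<pi>" "{z. r < dist (fst z) (snd z)} \<in> sets \<pi>"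
    by (rule sets_Collect_UNIV[OF sp]; measurable)+
  note [measurable] = m
  \<comment> \<open>Points beyond \<alpha> may still have level \<open>c\<close> where the
    distribution function is flat. They carry no mass, because the half-space up to \<alpha> already
    has mass \<open>c\<close>.\<close>
  have F_iff: "AE z in \<pi>. F (fst z \<bullet> \<theta>) \<le> c \<longrightarrow> fst z \<bullet> \<theta> \<le> \<alpha>"
  proof -
    have "measure \<pi> {z. fst z \<bullet> \<theta> \<le> \<alpha>} = c"
      using couplings_measure(1)[OF \<pi>, of "{x. x \<bullet> \<theta> \<le> \<alpha>}"] \<alpha>
      by (simp add: cdf_slice[OF sets_W2_space[OF W2_acD[OF \<sigma>]]])
    then have "measure \<pi> ({z. F (fst z \<bullet> \<theta>) \<le> c} - {z. fst z \<bullet> \<theta> \<le> \<alpha>}) = 0"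
      using m coupling_level(1)[of c] c s.cdf_nondecreasing[of _ \<alpha>] \<alpha>
      by (subst \<pi>.finite_measure_Diff) auto
    then have "({z. F (fst z \<bullet> \<theta>) \<le> c} - {z. fst z \<bullet> \<theta> \<le> \<alpha>}) \<in> null_sets \<pi>"
      using m by (auto simp: null_sets_def \<pi>.emeasure_eq_measure)
    then show ?thesis by (rule AE_I') auto
  qed
  have E_iff: "AE z in \<pi>. E (snd z \<bullet> \<theta>) \<le> c \<longrightarrow> snd z \<bullet> \<theta> \<le> \<beta>"
  proof -
    have "measure \<pi> {z. snd z \<bullet> \<theta> \<le> \<beta>} = c"
      using couplings_measure(2)[OF \<pi>, of "{x. x \<bullet> \<theta> \<le> \<beta>}"] \<beta>
      by (simp add: cdf_slice[OF sets_W2_space[OF W2_acD[OF \<eta>]]])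
    then have "measure \<pi> ({z. E (snd z \<bullet> \<theta>) \<le> c} - {z. snd z \<bullet> \<theta> \<le> \<beta>}) = 0"
      using m coupling_level(2)[of c] c e.cdf_nondecreasing[of _ \<beta>] \<beta>
      by (subst \<pi>.finite_measure_Diff) auto
    then have "({z. E (snd z \<bullet> \<theta>) \<le> c} - {z. snd z \<bullet> \<theta> \<le> \<beta>}) \<in> null_sets \<pi>"
      using m by (auto simp: null_sets_def \<pi>.emeasure_eq_measure)
    then show ?thesis by (rule AE_I') auto
  qed
  have dist: "\<bar>fst z \<bullet> \<theta> - snd z \<bullet> \<theta>\<bar> \<le> dist (fst z) (snd z)" for z :: "'a \<times> 'a"
    using Cauchy_Schwarz_ineq2[of "fst z - snd z" \<theta>] \<theta> by (simp add: inner_diff_left dist_norm)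
  let ?U = "{z. \<bar>snd z \<bullet> \<theta> - \<beta>\<bar> \<le> r} \<union> {z. r < dist (fst z) (snd z)}"
  have "?q \<le> measure \<pi> ?U"
  proof (cases "\<alpha> \<le> \<beta>")
    case True
    have "AE z in \<pi>. F (fst z \<bullet> \<theta>) \<le> c \<and> c < E (snd z \<bullet> \<theta>) \<longrightarrow> z \<in> ?U"
      using F_iff
    proof eventually_elim
      case (elim z)
      then show ?case
        using True dist[of z] e.cdf_nondecreasing[of "snd z \<bullet> \<theta>" \<beta>] \<beta>
        by (cases "snd z \<bullet> \<theta> \<le> \<beta>") auto
    qed
    then show ?thesis
      by (intro \<pi>.finite_measure_mono_AE) auto
  next
    case False
    \<comment> \<open>In this order of \<alpha> and \<beta> the original event need not separate the
      projections at \<beta>, but the swapped event of equal probability does.\<close>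
    have "AE z in \<pi>. E (snd z \<bullet> \<theta>) \<le> c \<and> c < F (fst z \<bullet> \<theta>) \<longrightarrow> z \<in> ?U"
      using E_iff
    proof eventually_elim
      case (elim z)
      then show ?case
        using False dist[of z] s.cdf_nondecreasing[of "fst z \<bullet> \<theta>" \<alpha>] \<alpha>
        by (cases "fst z \<bullet> \<theta> \<le> \<alpha>") auto
    qed
    then have "measure \<pi> {z. E (snd z \<bullet> \<theta>) \<le> c \<and> c < F (fst z \<bullet> \<theta>)} \<le> measure \<pi> ?U"
      by (intro \<pi>.finite_measure_mono_AE) auto
    then show ?thesis
      using coupling_level_swap[of c] c by simp
  qed
  also have "\<dots> \<le> measure \<pi> {z. \<bar>snd z \<bullet> \<theta> - \<beta>\<bar> \<le> r} + measure \<pi> {z. r < dist (fst z) (snd z)}"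
    using m by (intro measure_Un_le) auto
  also have "measure \<pi> {z. \<bar>snd z \<bullet> \<theta> - \<beta>\<bar> \<le> r} = measure \<eta> {y. \<bar>y \<bullet> \<theta> - \<beta>\<bar> \<le> r}"
    using couplings_measure(2)[OF \<pi>, of "{y. \<bar>y \<bullet> \<theta> - \<beta>\<bar> \<le> r}"] by simp
  finally show ?thesis .
qed

lemma coupling_straddle_trivial:
  assumes c: "c \<le> 0 \<or> 1 \<le> c"
  shows "measure \<pi> {z. F (fst z \<bullet> \<theta>) \<le> c \<and> c < E (snd z \<bullet> \<theta>)} = 0"
proof (cases "1 \<le> c")
  case True
  have "\<not> c < E x" for x
    using e.cdf_bounded_prob[of x] True by linarith
  then have "{z. F (fst z \<bullet> \<theta>) \<le> c \<and> c < E (snd z \<bullet> \<theta>)} = {}"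
    by auto
  then show ?thesis by (simp only: measure_empty)
next
  case False
  have "{z. F (fst z \<bullet> \<theta>) \<le> 0} \<in> sets \<pi>"
    by (rule sets_Collect_UNIV[OF sp]) measurable
  then have "measure \<pi> {z. F (fst z \<bullet> \<theta>) \<le> c \<and> c < E (snd z \<bullet> \<theta>)} \<le> measure \<pi> {z. F (fst z \<bullet> \<theta>) \<le> 0}"
    using c False by (intro \<pi>.finite_measure_mono) auto
  then show ?thesis
    using coupling_level(1)[of 0] by (simp add: measure_le_0_iff)
qed

context
  fixes \<mu> :: "'a measure"
  assumes \<mu>: "\<mu> \<in> W2_space"
begin

interpretation m: real_distribution "slice \<theta> \<mu>"
  by (rule real_distribution_slice_W2[OF \<mu>])

private abbreviation "G \<equiv> cdf (slice \<theta> \<mu>)"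
private abbreviation "T1 \<equiv> (\<lambda>z. transport \<mu> \<sigma> \<theta> (fst z))"
private abbreviation "T2 \<equiv> (\<lambda>z. transport \<mu> \<eta> \<theta> (snd z))"

private lemma T_measurable [measurable]:
  "T1 \<in> borel_measurable \<pi>" "T2 \<in> borel_measurable \<pi>"
  by (auto intro!: borel_measurable_transport_fixed \<mu> \<sigma> \<eta>)

private lemma T_AE:
  "AE z in \<pi>. \<forall>s. T1 z \<le> s \<longleftrightarrow> F (fst z \<bullet> \<theta>) \<le> G s"
  "AE z in \<pi>. \<forall>s. T2 z \<le> s \<longleftrightarrow> E (snd z \<bullet> \<theta>) \<le> G s"
  using couplings_AE(1)[OF \<pi> AE_transport_le_iff[OF \<sigma> \<theta> \<mu>]]
    couplings_AE(2)[OF \<pi> AE_transport_le_iff[OF \<eta> \<theta> \<mu>]] by auto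

text \<open>The single level \<open>G (min s t)\<close> suffices: a transport at most
  \<open>min s t\<close> has a level not above it, and one beyond \<open>max s t\<close> has a level
  above \<open>G (max s t)\<close>, hence above it. The factor 2 accounts for the two directions of
  crossing, which are equally likely by \<open>coupling_level_swap\<close>.\<close>

lemma cross_prob_coupling_le:
  "cross_prob \<pi> T1 T2 s t
    \<le> 2 * ennreal (measure \<pi> {z. F (fst z \<bullet> \<theta>) \<le> G (min s t) \<and> G (min s t) < E (snd z \<bullet> \<theta>)})"
proof -
  define c where "c = G (min s t)"
  have c: "0 \<le> c" "c \<le> 1" "c \<le> G (max s t)"
    using m.cdf_nonneg m.cdf_bounded_prob m.cdf_nondecreasing[of "min s t" "max s t"] by (auto simp: c_def)
  have m [measurable]: "{z. F (fst z \<bullet> \<theta>) \<le> c \<and> c < E (snd z \<bullet> \<theta>)} \<in> sets \<pi>"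
    "{z. E (snd z \<bullet> \<theta>) \<le> c \<and> c < F (fst z \<bullet> \<theta>)} \<in> sets \<pi>"
    by (rule sets_Collect_UNIV[OF sp]; measurable)+
  have "emeasure \<pi> {w \<in> space \<pi>. T1 w \<le> min s t \<and> max s t < T2 w}
      \<le> emeasure \<pi> {z. F (fst z \<bullet> \<theta>) \<le> c \<and> c < E (snd z \<bullet> \<theta>)}"
  proof (rule emeasure_mono_AE)
    show "AE z in \<pi>. z \<in> {w \<in> space \<pi>. T1 w \<le> min s t \<and> max s t < T2 w}
        \<longrightarrow> z \<in> {z. F (fst z \<bullet> \<theta>) \<le> c \<and> c < E (snd z \<bullet> \<theta>)}"
      using T_AE(1) T_AE(2)
    proof eventually_elim
      case (elim z)
      then show ?case
        using c elim(1)[rule_format, of "min s t"] elim(2)[rule_format, of "max s t"] by (auto simp: c_def not_le[symmetric])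
    qed
  qed simp
  moreover have "emeasure \<pi> {w \<in> space \<pi>. T2 w \<le> min s t \<and> max s t < T1 w}
      \<le> emeasure \<pi> {z. E (snd z \<bullet> \<theta>) \<le> c \<and> c < F (fst z \<bullet> \<theta>)}"
  proof (rule emeasure_mono_AE)
    show "AE z in \<pi>. z \<in> {w \<in> space \<pi>. T2 w \<le> min s t \<and> max s t < T1 w}
        \<longrightarrow> z \<in> {z. E (snd z \<bullet> \<theta>) \<le> c \<and> c < F (fst z \<bullet> \<theta>)}"
      using T_AE(1) T_AE(2)
    proof eventually_elim
      case (elim z)
      then show ?case
        using c elim(2)[rule_format, of "min s t"] elim(1)[rule_format, of "max s t"] by (auto simp: c_def not_le[symmetric])
    qed
  qed simp
  ultimately show ?thesis
    using coupling_level_swap[OF c(1,2)]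
    unfolding cross_prob_def c_def[symmetric] \<pi>.emeasure_eq_measure mult_2 by (intro add_mono) simp_all
qed

text \<open>Both transports have the law of the slice of \<mu>, so the coupling disappears from the
  bound. Replacing \<open>z \<bullet> \<theta>\<close> by \<open>norm z\<close> removes the
  direction too, and the pair of \<open>- norm z\<close> and \<open>norm z\<close> still has finite
  quadratic cost, being governed by the second moment of \<mu>.\<close>

lemma cross_prob_coupling_dominated:
  "cross_prob \<pi> T1 T2 s t \<le> 2 * cross_prob \<mu> (\<lambda>z. - norm z) norm s t"
proof -
  interpret M: prob_space \<mu> by (rule prob_space_W2_space[OF \<mu>])
  have spm: "space \<mu> = UNIV"
    by (rule space_W2_space[OF \<mu>])
  note sets_W2_space[OF \<mu>, measurable_cong]
  let ?n = "emeasure \<mu> {w \<in> space \<mu>. - norm w \<le> min s t \<and> max s t < norm w}"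
  have cs: "\<bar>z \<bullet> \<theta>\<bar> \<le> norm z" for z
    using Cauchy_Schwarz_ineq2[of z \<theta>] \<theta> by simp
  \<comment> \<open>One of the two constraints is kept, the one on the threshold farther from the
    origin, as the sign of the sum tells. It alone yields both conditions on the norm.\<close>
  have key: "emeasure \<pi> {w \<in> space \<pi>. A w \<le> min s t \<and> max s t < B w} \<le> ?n"
    if [measurable]: "A \<in> borel_measurable \<pi>" "B \<in> borel_measurable \<pi>"
      and A: "\<And>s. measure \<pi> {w. A w \<le> s} = G s" and B: "\<And>s. measure \<pi> {w. B w \<le> s} = G s" for A B
  proof (cases "min s t + max s t < 0")
    case True
    have "emeasure \<pi> {w \<in> space \<pi>. A w \<le> min s t \<and> max s t < B w} \<le> emeasure \<pi> {w \<in> space \<pi>. A w \<le> min s t}"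
      by (intro emeasure_mono) auto
    also have "\<dots> = emeasure \<mu> {z \<in> space \<mu>. z \<bullet> \<theta> \<le> min s t}"
      using A[of "min s t"] cdf_slice[OF sets_W2_space[OF \<mu>], of \<theta> "min s t"]
      by (simp add: \<pi>.emeasure_eq_measure M.emeasure_eq_measure sp spm)
    also have "\<dots> \<le> ?n"
    proof (intro emeasure_mono subsetI CollectI conjI)
      fix z assume "z \<in> {z \<in> space \<mu>. z \<bullet> \<theta> \<le> min s t}"
      with cs[of z] True show "z \<in> space \<mu>" "- norm z \<le> min s t" "max s t < norm z"
        by auto
    qed measurable
    finally show ?thesis .
  next
    case False
    have "emeasure \<pi> {w \<in> space \<pi>. A w \<le> min s t \<and> max s t < B w} \<le> emeasure \<pi> (space \<pi> - {w \<in> space \<pi>. B w \<le> max s t})"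
      by (intro emeasure_mono) auto
    also have "\<dots> = emeasure \<mu> (space \<mu> - {z \<in> space \<mu>. z \<bullet> \<theta> \<le> max s t})"
      using B[of "max s t"] cdf_slice[OF sets_W2_space[OF \<mu>], of \<theta> "max s t"]
      by (simp add: \<pi>.emeasure_eq_measure M.emeasure_eq_measure \<pi>.prob_compl M.prob_compl) (simp add: sp spm)
    also have "\<dots> \<le> ?n"
    proof (intro emeasure_mono subsetI CollectI conjI)
      fix z assume "z \<in> space \<mu> - {z \<in> space \<mu>. z \<bullet> \<theta> \<le> max s t}"
      with cs[of z] False show "z \<in> space \<mu>" "- norm z \<le> min s t" "max s t < norm z"
        by auto
    qed measurable
    finally show ?thesis .
  qed
  have [measurable]: "(\<lambda>x. transport \<mu> \<sigma> \<theta> x) \<in> borel_measurable borel" "(\<lambda>x. transport \<mu> \<eta> \<theta> x) \<in> borel_measurable borel"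
    by (auto intro!: borel_measurable_transport_fixed \<mu> \<sigma> \<eta>)
  have "measure \<pi> {w. T1 w \<le> s} = G s" "measure \<pi> {w. T2 w \<le> s} = G s" for s
    using couplings_measure(1)[OF \<pi>, of "{x. transport \<mu> \<sigma> \<theta> x \<le> s}"]
      couplings_measure(2)[OF \<pi>, of "{x. transport \<mu> \<eta> \<theta> x \<le> s}"]
    by (auto simp: measure_transport_le[OF \<sigma> \<theta> \<mu>] measure_transport_le[OF \<eta> \<theta> \<mu>])
  then have "cross_prob \<pi> T1 T2 s t \<le> ?n + ?n"
    unfolding cross_prob_def by (intro add_mono key) auto
  also have "\<dots> \<le> 2 * cross_prob \<mu> (\<lambda>z. - norm z) norm s t"
    unfolding cross_prob_def mult_2 by (intro add_mono) auto
  finally show ?thesis .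
qed

end

end

lemma emeasure_dist_gt_le_coupling_cost:
  fixes \<pi> :: "('a::euclidean_space \<times> 'a) measure"
  assumes \<pi>: "\<pi> \<in> couplings \<sigma> \<eta>" and r: "0 < r"
  shows "emeasure \<pi> {z. r < dist (fst z) (snd z)} \<le> ennreal (1 / r\<^sup>2) * coupling_cost \<pi>"
proof -
  have sp: "space \<pi> = UNIV" by (rule couplings_space[OF \<pi>])
  have *: "{z. Q z} \<in> sets \<pi>" if "Measurable.pred (borel \<Otimes>\<^sub>M borel) Q" for Q :: "'a \<times> 'a \<Rightarrow> bool"
    using that by (simp add: pred_def space_pair_measure couplings_sets[OF \<pi>])
  have [measurable]: "{z. r < dist (fst z) (snd z)} \<in> sets \<pi>" "{z. 1 \<le> ennreal (1 / r\<^sup>2) * ennreal ((dist (fst z) (snd z))\<^sup>2)} \<in> sets \<pi>"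
    by (rule *, measurable)+
  have "emeasure \<pi> {z. r < dist (fst z) (snd z)} \<le> emeasure \<pi> {z. 1 \<le> ennreal (1 / r\<^sup>2) * ennreal ((dist (fst z) (snd z))\<^sup>2)}"
  proof (intro emeasure_mono subsetI CollectI)
    fix z :: "'a \<times> 'a" assume "z \<in> {z. r < dist (fst z) (snd z)}"
    then have "r\<^sup>2 \<le> (dist (fst z) (snd z))\<^sup>2"
      using r by (intro power_mono) auto
    then have "1 \<le> 1 / r\<^sup>2 * (dist (fst z) (snd z))\<^sup>2"
      using r by (simp add: field_simps)
    then show "1 \<le> ennreal (1 / r\<^sup>2) * ennreal ((dist (fst z) (snd z))\<^sup>2)"
      by (simp add: ennreal_mult[symmetric])
  qed simp
  moreover have dm: "(\<lambda>z. (dist (fst z) (snd z))\<^sup>2) \<in> borel_measurable \<pi>"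
    by (subst measurable_cong_sets[OF couplings_sets[OF \<pi>] refl]) measurable
  moreover have "emeasure \<pi> {z. 1 \<le> ennreal (1 / r\<^sup>2) * ennreal ((dist (fst z) (snd z))\<^sup>2)} \<le> ennreal (1 / r\<^sup>2) * coupling_cost \<pi>"
    using nn_integral_Markov_inequality[of "\<lambda>z. ennreal ((dist (fst z) (snd z))\<^sup>2)" UNIV \<pi> "ennreal (1 / r\<^sup>2)"]
    using sets.top[of \<pi>] dm by (simp add: coupling_cost_def sp)
  ultimately show ?thesis by simp
qed

section \<open>Couplings whose cost tends to 0\<close>

context
  fixes \<tau> :: "nat \<Rightarrow> 'a::euclidean_space measure" and \<eta> :: "'a measure" and \<pi> :: "nat \<Rightarrow> ('a \<times> 'a) measure"
    and \<mu> :: "'a measure"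
  assumes \<tau>: "\<And>j. \<tau> j \<in> W2_ac" and \<eta>: "\<eta> \<in> W2_ac" and \<mu>: "\<mu> \<in> W2_space"
    and \<pi>: "\<And>j. \<pi> j \<in> couplings (\<tau> j) \<eta>"
    and cost: "(\<lambda>j. coupling_cost (\<pi> j)) \<longlonglongrightarrow> 0"
begin

interpretation \<pi>: prob_space "\<pi> j" for j
  using couplings_prob_space[OF \<pi>] prob_space_W2_space[OF W2_acD[OF \<tau>]] .

declare couplings_sets[OF \<pi>, measurable_cong]

lemma measure_dist_gt_tendsto_0:
  assumes r: "0 < r"
  shows "(\<lambda>j. measure (\<pi> j) {z. r < dist (fst z) (snd z)}) \<longlonglongrightarrow> 0"
proof -
  have "(\<lambda>j. emeasure (\<pi> j) {z. r < dist (fst z) (snd z)}) \<longlonglongrightarrow> 0"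
  proof (rule tendsto_sandwich[OF _ _ tendsto_const])
    show "(\<lambda>j. ennreal (1 / r\<^sup>2) * coupling_cost (\<pi> j)) \<longlonglongrightarrow> 0"
      using ennreal_tendsto_cmult[OF _ cost, of "ennreal (1 / r\<^sup>2)"] by simp
  qed (use emeasure_dist_gt_le_coupling_cost[OF \<pi> r] in auto)
  then show ?thesis
    by (subst (asm) \<pi>.emeasure_eq_measure) (simp add: ennreal_tendsto_0_iff)
qed

text \<open>The slice of \<eta> has no atom at \<beta>, so a thin strip around \<beta> has small
  mass. Its width is fixed first; the probability of a distance beyond that width then vanishes with
  the cost.\<close>

lemma coupling_straddle_tendsto_0:
  assumes \<theta>: "\<theta> \<in> sphere 0 1"
  shows "(\<lambda>j. measure (\<pi> j) {z. cdf (slice \<theta> (\<tau> j)) (fst z \<bullet> \<theta>) \<le> c \<and> c < cdf (slice \<theta> \<eta>) (snd z \<bullet> \<theta>)}) \<longlonglongrightarrow> 0"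
    (is "?q \<longlonglongrightarrow> 0")
proof (cases "0 < c \<and> c < 1")
  case False
  then have "?q = (\<lambda>j. 0)"
    using coupling_straddle_trivial[OF \<tau> \<eta> \<pi> \<theta>, of c] by (auto simp: fun_eq_iff)
  then show ?thesis by simp
next
  case True
  interpret e: real_distribution "slice \<theta> \<eta>"
    by (rule real_distribution_slice_W2[OF W2_acD[OF \<eta>]])
  interpret E: prob_space \<eta> by (rule prob_space_W2_space[OF W2_acD[OF \<eta>]])
  note W2_acD[OF \<eta>, THEN sets_W2_space, measurable_cong]
  have sp: "space \<eta> = UNIV"
    by (rule space_W2_space[OF W2_acD[OF \<eta>]])
  obtain \<beta> where \<beta>: "cdf (slice \<theta> \<eta>) \<beta> = c"
    using e.ex_cdf_eq[OF isCont_cdf_slice[OF \<eta> \<theta>]] True by blast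
  let ?B = "\<lambda>r. {y. \<bar>y \<bullet> \<theta> - \<beta>\<bar> \<le> r}"
  have "(\<lambda>n. measure \<eta> (?B (1 / real (Suc n)))) \<longlonglongrightarrow> measure \<eta> (\<Inter>n. ?B (1 / real (Suc n)))"
    by (intro E.finite_Lim_measure_decseq)
       (auto simp: decseq_def frac_le intro: order_trans[OF _ frac_le] intro!: sets_Collect_UNIV[OF sp])
  also have "(\<Inter>n. ?B (1 / real (Suc n))) = {y. y \<bullet> \<theta> = \<beta>}"
  proof (intro set_eqI iffI)
    fix y assume y: "y \<in> (\<Inter>n. ?B (1 / real (Suc n)))"
    have "\<bar>y \<bullet> \<theta> - \<beta>\<bar> \<le> 0"
      by (rule LIMSEQ_le_const[OF LIMSEQ_inverse_real_of_nat]) (use y in \<open>auto simp: inverse_eq_divide\<close>)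
    then show "y \<in> {y. y \<bullet> \<theta> = \<beta>}" by simp
  qed auto
  also have "measure \<eta> {y. y \<bullet> \<theta> = \<beta>} = measure (slice \<theta> \<eta>) {\<beta>}"
    by (simp add: slice_def measure_distr vimage_def sp)
  also have "\<dots> = 0"
    using isCont_cdf_slice[OF \<eta> \<theta>] by (simp add: e.isCont_cdf)
  finally have B: "(\<lambda>n. measure \<eta> (?B (1 / real (Suc n)))) \<longlonglongrightarrow> 0" .
  show ?thesis
  proof (rule order_tendstoI)
    fix a :: real assume "0 < a"
    then have "0 < a / 2" by simp
    from order_tendstoD(2)[OF B this] obtain n where n: "measure \<eta> (?B (1 / real (Suc n))) < a / 2"
      by (auto simp: eventually_sequentially)
    have "eventually (\<lambda>j. measure (\<pi> j) {z. 1 / real (Suc n) < dist (fst z) (snd z)} < a / 2) sequentially"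
      using \<open>0 < a / 2\<close> by (intro order_tendstoD(2)[OF measure_dist_gt_tendsto_0]) auto
    then show "eventually (\<lambda>j. ?q j < a) sequentially"
    proof eventually_elim
      case (elim j)
      then show ?case
        using n coupling_straddle_le[OF \<tau> \<eta> \<pi> \<theta> _ _ \<beta>, of j "1 / real (Suc n)"] True by linarith
    qed
  next
    fix a :: real assume "a < 0"
    then show "eventually (\<lambda>j. a < ?q j) sequentially"
      by (intro always_eventually allI less_le_trans[OF _ measure_nonneg])
  qed
qed

lemma borel_measurable_cross_prob_coupling:
  "(\<lambda>w. cross_prob (\<pi> j) (\<lambda>z. transport \<mu> (\<tau> j) (fst w) (fst z)) (\<lambda>z. transport \<mu> \<eta> (fst w) (snd z))
      (fst (snd w)) (snd (snd w))) \<in> borel_measurable (borel \<Otimes>\<^sub>M (borel \<Otimes>\<^sub>M borel))"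
proof -
  let ?N = "(borel \<Otimes>\<^sub>M (borel \<Otimes>\<^sub>M borel)) :: ('a \<times> real \<times> real) measure"
  let ?R = "(borel \<Otimes>\<^sub>M borel) :: ('a \<times> 'a) measure"
  have sp: "space (\<pi> j) = UNIV" by (rule couplings_space[OF \<pi>])
  have \<pi>s: "\<pi> j \<in> space (subprob_algebra ?R)"
    using couplings_sets[OF \<pi>] \<pi>.prob_space_axioms
    by (auto simp: space_subprob_algebra intro: prob_space_imp_subprob_space)
  have [measurable]: "(\<lambda>x. transport \<mu> (\<tau> j) (fst (fst x)) (fst (snd x))) \<in> borel_measurable (?N \<Otimes>\<^sub>M ?R)"
    "(\<lambda>x. transport \<mu> \<eta> (fst (fst x)) (snd (snd x))) \<in> borel_measurable (?N \<Otimes>\<^sub>M ?R)"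
    by (auto intro!: borel_measurable_transport_fixed \<mu> \<tau> \<eta>)
  have *: "(\<lambda>w. emeasure (\<pi> j) {z \<in> space (\<pi> j). Q w z}) \<in> borel_measurable ?N"
    if "Measurable.pred (?N \<Otimes>\<^sub>M ?R) (\<lambda>x. Q (fst x) (snd x))" for Q
  proof (rule emeasure_measurable_subprob_algebra2)
    have "(SIGMA x:space ?N. {z \<in> space (\<pi> j). Q x z}) = {x \<in> space (?N \<Otimes>\<^sub>M ?R). Q (fst x) (snd x)}"
      by (auto simp: space_pair_measure sp)
    then show "(SIGMA x:space ?N. {z \<in> space (\<pi> j). Q x z}) \<in> sets (?N \<Otimes>\<^sub>M ?R)"
      using that by simp
  qed (use \<pi>s in simp)
  show ?thesis
    unfolding cross_prob_def by (intro borel_measurable_add * ) measurable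
qed

text \<open>Dominated convergence for the crossing probabilities, jointly in the direction and the
  two thresholds. The straddling bound gives the pointwise limit, and the dominating function is the
  same for every source.\<close>

lemma transport_stability:
  "(\<lambda>j. \<integral>\<^sup>+\<theta>. \<integral>\<^sup>+z. ennreal ((transport \<mu> (\<tau> j) \<theta> (fst z) - transport \<mu> \<eta> \<theta> (snd z))\<^sup>2) \<partial>\<pi> j \<partial>uniform_sphere)
     \<longlonglongrightarrow> 0"
proof -
  interpret U: prob_space "uniform_sphere :: 'a measure" by (rule prob_space_uniform_sphere)
  interpret M: prob_space \<mu> by (rule prob_space_W2_space[OF \<mu>])
  have [measurable_cong]: "sets (uniform_sphere :: 'a measure) = sets borel"
    by (simp add: uniform_sphere_def)
  note [measurable_cong] = sets_W2_space[OF \<mu>]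
  have LL: "sigma_finite_measure (lborel \<Otimes>\<^sub>M lborel :: (real \<times> real) measure)"
    by (rule sigma_finite_pair_measure[OF sigma_finite_lborel sigma_finite_lborel])
  let ?X = "\<lambda>j w. cross_prob (\<pi> j) (\<lambda>z. transport \<mu> (\<tau> j) (fst w) (fst z)) (\<lambda>z. transport \<mu> \<eta> (fst w) (snd z))
      (fst (snd w)) (snd (snd w))"
  let ?C = "\<lambda>w. cross_prob \<mu> (\<lambda>z. - norm z) norm (fst w) (snd w)"
  let ?W = "\<lambda>w. 2 * cross_prob \<mu> (\<lambda>z. - norm z) norm (fst w) (snd w)"
  let ?M = "uniform_sphere \<Otimes>\<^sub>M (lborel \<Otimes>\<^sub>M lborel) :: ('a \<times> real \<times> real) measure"
  have X [measurable]: "?X j \<in> borel_measurable ?M" for j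
  proof -
    have "sets ?M = sets (borel \<Otimes>\<^sub>M (borel \<Otimes>\<^sub>M borel))"
      by (intro sets_pair_measure_cong) (simp_all add: uniform_sphere_def)
    then show ?thesis
      by (rule measurable_cong_sets[OF _ refl, THEN equalityD2, THEN subsetD])
        (rule borel_measurable_cross_prob_coupling)
  qed
  have [measurable]: "sphere 0 1 \<in> sets (borel :: 'a measure)"
    by (simp add: borel_closed)
  have IX: "(\<lambda>w. indicator (sphere 0 1) (fst w) * ?X j w) \<in> borel_measurable ?M" for j
    by (intro borel_measurable_times_ennreal X measurable_compose[OF measurable_fst borel_measurable_indicator])
      (simp add: uniform_sphere_def)
  have spm: "space \<mu> = UNIV"
    by (rule space_W2_space[OF \<mu>])
  have C: "?C \<in> borel_measurable (borel \<Otimes>\<^sub>M borel)"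
  proof -
    have *: "(\<lambda>w. emeasure \<mu> {z \<in> space \<mu>. Q w z}) \<in> borel_measurable (borel \<Otimes>\<^sub>M borel)"
      if "Measurable.pred ((borel \<Otimes>\<^sub>M borel) \<Otimes>\<^sub>M borel) (\<lambda>x. Q (fst x) (snd x))" for Q :: "real \<times> real \<Rightarrow> 'a \<Rightarrow> bool"
    proof (rule emeasure_measurable_subprob_algebra2)
      have "(SIGMA x:space (borel \<Otimes>\<^sub>M borel). {z \<in> space \<mu>. Q x z}) = {x \<in> space ((borel \<Otimes>\<^sub>M borel) \<Otimes>\<^sub>M borel). Q (fst x) (snd x)}"
        by (auto simp: space_pair_measure spm)
      then show "(SIGMA x:space (borel \<Otimes>\<^sub>M borel). {z \<in> space \<mu>. Q x z}) \<in> sets ((borel \<Otimes>\<^sub>M borel) \<Otimes>\<^sub>M borel)"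
        using that by simp
    qed (use W2_space_in_subprob[OF \<mu>] in simp)
    show ?thesis
      unfolding cross_prob_def by (intro borel_measurable_add *) measurable
  qed
  have Cl [measurable]: "?C \<in> borel_measurable (lborel \<Otimes>\<^sub>M lborel)"
    using C by (simp add: measurable_cong_sets[OF sets_pair_measure_cong[OF sets_lborel sets_lborel] refl])
  have Wl: "?W \<in> borel_measurable (lborel \<Otimes>\<^sub>M lborel)"
    by measurable
  have Ws [measurable]: "(\<lambda>w. ?W (snd w)) \<in> borel_measurable ?M"
    by (rule measurable_compose[OF measurable_snd Wl])
  \<comment> \<open>The bounds hold for unit directions, whereas the measure lives on the whole
    space. The indicator enforces them at every point without changing the integral.\<close>
  have "(\<lambda>j. \<integral>\<^sup>+w. indicator (sphere 0 1) (fst w) * ?X j w \<partial>?M) \<longlonglongrightarrow> (\<integral>\<^sup>+w. 0 \<partial>?M)"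
  proof (rule nn_integral_dominated_convergence[where w="\<lambda>w. ?W (snd w)"])
    show "AE w in ?M. indicator (sphere 0 1) (fst w) * ?X j w \<le> ?W (snd w)" for j
      using cross_prob_coupling_dominated[OF \<tau> \<eta> \<pi> _ \<mu>] by (intro AE_I2) (auto simp: indicator_def)
    show "AE w in ?M. (\<lambda>j. indicator (sphere 0 1) (fst w) * ?X j w) \<longlonglongrightarrow> 0"
    proof (intro AE_I2)
      fix w :: "'a \<times> real \<times> real"
      show "(\<lambda>j. indicator (sphere 0 1) (fst w) * ?X j w) \<longlonglongrightarrow> 0"
      proof (cases "fst w \<in> sphere 0 1")
        case True
        let ?c = "cdf (slice (fst w) \<mu>) (min (fst (snd w)) (snd (snd w)))"
        let ?q = "\<lambda>j. measure (\<pi> j) {z. cdf (slice (fst w) (\<tau> j)) (fst z \<bullet> (fst w)) \<le> ?c \<and> ?c < cdf (slice (fst w) \<eta>) (snd z \<bullet> (fst w))}"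
        have "(\<lambda>j. 2 * ennreal (?q j)) \<longlonglongrightarrow> 2 * ennreal 0"
          using coupling_straddle_tendsto_0[OF True, of ?c] by (intro ennreal_tendsto_cmult tendsto_ennrealI) auto
        then have "(\<lambda>j. ?X j w) \<longlonglongrightarrow> 0"
          by (intro tendsto_sandwich[where f="\<lambda>_. 0" and g="\<lambda>j. ?X j w" and h="\<lambda>j. 2 * ennreal (?q j)"])
            (use cross_prob_coupling_le[OF \<tau> \<eta> \<pi> True \<mu>] in auto)
        then show ?thesis using True by simp
      qed simp
    qed
    \<comment> \<open>By \<open>nn_integral_square_diff\<close> read backwards, the dominating
      function integrates to twice the mean of \<open>(2 * norm z)\<^sup>2\<close>, that is, to 8
      times the second moment of \<mu>.\<close>
    have "(\<integral>\<^sup>+w. ?W (snd w) \<partial>?M) = (\<integral>\<^sup>+w. ?W w \<partial>(lborel \<Otimes>\<^sub>M lborel))"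
      using sigma_finite_measure.nn_integral_fst[OF LL, of "\<lambda>w. ?W (snd w)" "uniform_sphere :: 'a measure"] Ws by (simp add: U.emeasure_space_1)
    also have "\<dots> = 2 * (\<integral>\<^sup>+s. \<integral>\<^sup>+t. cross_prob \<mu> (\<lambda>z. - norm z) norm s t \<partial>lborel \<partial>lborel)"
      using lborel.nn_integral_fst[OF Cl] by (subst nn_integral_cmult) simp_all
    also have "\<dots> = 2 * (\<integral>\<^sup>+z. ennreal ((- norm z - norm z)\<^sup>2) \<partial>\<mu>)"
      by (subst nn_integral_square_diff) (auto intro: M.sigma_finite_measure_axioms)
    also have "\<dots> = 8 * (\<integral>\<^sup>+z. ennreal ((norm z)\<^sup>2) \<partial>\<mu>)"
      by (simp add: power_mult_distrib ennreal_mult nn_integral_cmult mult.assoc[symmetric] del: ennreal_power)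
    also have "\<dots> < \<infinity>"
      using \<mu> by (auto simp: W2_space_def integrable_iff_bounded ennreal_mult_less_top)
    finally show "(\<integral>\<^sup>+w. ?W (snd w) \<partial>?M) < \<infinity>" .
  qed (use IX in simp_all)
  moreover have "(\<integral>\<^sup>+\<theta>. \<integral>\<^sup>+z. ennreal ((transport \<mu> (\<tau> j) \<theta> (fst z) - transport \<mu> \<eta> \<theta> (snd z))\<^sup>2) \<partial>\<pi> j \<partial>uniform_sphere)
    = (\<integral>\<^sup>+w. indicator (sphere 0 1) (fst w) * ?X j w \<partial>?M)" for j
  proof -
    have "AE \<theta> in uniform_sphere. (\<integral>\<^sup>+z. ennreal ((transport \<mu> (\<tau> j) \<theta> (fst z) - transport \<mu> \<eta> \<theta> (snd z))\<^sup>2) \<partial>\<pi> j)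
      = (\<integral>\<^sup>+p. indicator (sphere 0 1) \<theta> * ?X j (\<theta>, p) \<partial>(lborel \<Otimes>\<^sub>M lborel))"
      using AE_uniform_sphere
    proof eventually_elim
      case (elim \<theta>)
      have "fst \<in> borel_measurable (\<pi> j)" "snd \<in> borel_measurable (\<pi> j)"
        by (simp_all add: measurable_cong_sets[OF couplings_sets[OF \<pi>] refl])
      then have [measurable]: "(\<lambda>z. transport \<mu> (\<tau> j) \<theta> (fst z)) \<in> borel_measurable (\<pi> j)"
        "(\<lambda>z. transport \<mu> \<eta> \<theta> (snd z)) \<in> borel_measurable (\<pi> j)"
        by (auto intro!: borel_measurable_transport_fixed \<mu> \<tau> \<eta>)
      have "(\<lambda>p. ?X j (\<theta>, p)) \<in> borel_measurable (lborel \<Otimes>\<^sub>M lborel)"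
        by (rule measurable_compose[OF measurable_Pair1' X]) (simp add: uniform_sphere_def)
      from lborel.nn_integral_fst[OF this]
      have "(\<integral>\<^sup>+p. ?X j (\<theta>, p) \<partial>(lborel \<Otimes>\<^sub>M lborel))
        = (\<integral>\<^sup>+s. \<integral>\<^sup>+t. cross_prob (\<pi> j) (\<lambda>z. transport \<mu> (\<tau> j) \<theta> (fst z)) (\<lambda>z. transport \<mu> \<eta> \<theta> (snd z)) s t \<partial>lborel \<partial>lborel)"
        by simp
      also have "\<dots> = (\<integral>\<^sup>+z. ennreal ((transport \<mu> (\<tau> j) \<theta> (fst z) - transport \<mu> \<eta> \<theta> (snd z))\<^sup>2) \<partial>\<pi> j)"
        by (intro nn_integral_square_diff[symmetric]) (unfold_locales, measurable)
      finally show ?case using elim by simp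
    qed
    then have "(\<integral>\<^sup>+\<theta>. \<integral>\<^sup>+z. ennreal ((transport \<mu> (\<tau> j) \<theta> (fst z) - transport \<mu> \<eta> \<theta> (snd z))\<^sup>2) \<partial>\<pi> j \<partial>uniform_sphere)
      = (\<integral>\<^sup>+\<theta>. \<integral>\<^sup>+p. indicator (sphere 0 1) \<theta> * ?X j (\<theta>, p) \<partial>(lborel \<Otimes>\<^sub>M lborel) \<partial>uniform_sphere)"
      by (rule nn_integral_cong_AE)
    also have "\<dots> = (\<integral>\<^sup>+w. indicator (sphere 0 1) (fst w) * ?X j w \<partial>?M)"
      using sigma_finite_measure.nn_integral_fst[OF LL, of "\<lambda>w. indicator (sphere 0 1) (fst w) * ?X j w" "uniform_sphere :: 'a measure"] IX by simp
    finally show ?thesis .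
  qed
  ultimately show ?thesis by simp
qed

end

subsection \<open>The sliced energy and its gradient\<close>

lemma sets_uniform_sphere [measurable_cong, simp]: "sets uniform_sphere = sets borel"
  by (simp add: uniform_sphere_def)

lemma space_uniform_sphere [simp]: "space uniform_sphere = UNIV"
  by (simp add: uniform_sphere_def)

text \<open>For measures in \<open>W2_ac\<close> this is twice the functional H whose formal
  derivative is \<open>H_deriv\<close>. It is written as the cost of the monotone map, so that no
  infimum over couplings appears, and with values in \<open>ennreal\<close>, so that averages over
  directions and over chance need no integrability conditions.\<close>

definition slice_energy :: "'a::euclidean_space measure \<Rightarrow> 'a measure \<Rightarrow> ennreal" where
  "slice_energy \<mu> \<sigma> = (\<integral>\<^sup>+\<theta>. \<integral>\<^sup>+x. ennreal ((displ \<mu> \<sigma> \<theta> x)\<^sup>2) \<partial>\<sigma> \<partial>uniform_sphere)"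

definition grad_energy :: "'a::euclidean_space measure \<Rightarrow> 'a measure \<Rightarrow> ennreal" where
  "grad_energy \<mu> \<sigma> = (\<integral>\<^sup>+x. ennreal ((norm (H_deriv \<mu> \<sigma> x))\<^sup>2) \<partial>\<sigma>)"

lemma H_deriv_displ: "H_deriv \<mu> \<sigma> x = (\<integral>\<theta>. displ \<mu> \<sigma> \<theta> x *\<^sub>R \<theta> \<partial>uniform_sphere)"
  by (simp add: H_deriv_def slice_map_displ)

lemma borel_measurable_displ_fixed:
  assumes "\<mu> \<in> W2_space" "\<sigma> \<in> W2_space"
    and [measurable]: "th \<in> borel_measurable N" "x \<in> borel_measurable N"
  shows "(\<lambda>w. displ \<mu> \<sigma> (th w) (x w)) \<in> borel_measurable N"
  using W2_space_in_subprob[OF assms(2)] by (intro borel_measurable_displ assms) auto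

lemma borel_measurable_H_deriv:
  fixes S :: "'w \<Rightarrow> 'a::euclidean_space measure"
  assumes \<mu>: "\<mu> \<in> W2_space" and S: "S \<in> N \<rightarrow>\<^sub>M subprob_algebra borel"
    and [measurable]: "x \<in> borel_measurable N"
  shows "(\<lambda>w. H_deriv \<mu> (S w) (x w)) \<in> borel_measurable N"
proof -
  interpret U: prob_space "uniform_sphere :: 'a measure" by (rule prob_space_uniform_sphere)
  have [measurable]: "(\<lambda>z. displ \<mu> (S (fst z)) (snd z) (x (fst z))) \<in> borel_measurable (N \<Otimes>\<^sub>M uniform_sphere)"
    by (intro borel_measurable_displ \<mu> measurable_compose[OF measurable_fst S]) measurable
  show ?thesis
    unfolding H_deriv_displ by (intro U.borel_measurable_lebesgue_integral) (simp add: split_beta')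
qed

lemma borel_measurable_slice_energy:
  fixes \<mu> :: "'a::euclidean_space measure"
  assumes \<mu>: "\<mu> \<in> W2_space"
  shows "slice_energy \<mu> \<in> borel_measurable (subprob_algebra borel)"
proof -
  interpret U: prob_space "uniform_sphere :: 'a measure" by (rule prob_space_uniform_sphere)
  let ?S = "subprob_algebra borel :: 'a measure measure"
  have "(\<lambda>z. \<integral>\<^sup>+x. ennreal ((displ \<mu> (fst z) (snd z) x)\<^sup>2) \<partial>fst z) \<in> borel_measurable (?S \<Otimes>\<^sub>M uniform_sphere)"
  proof (rule nn_integral_measurable_subprob_algebra2)
    have "(\<lambda>z. displ \<mu> (fst (fst z)) (snd (fst z)) (snd z)) \<in> borel_measurable ((?S \<Otimes>\<^sub>M uniform_sphere) \<Otimes>\<^sub>M borel)"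
      by (intro borel_measurable_displ \<mu>) measurable
    then show "(\<lambda>(z, x). ennreal ((displ \<mu> (fst z) (snd z) x)\<^sup>2)) \<in> borel_measurable ((?S \<Otimes>\<^sub>M uniform_sphere) \<Otimes>\<^sub>M borel)"
      by (simp add: split_beta')
  qed measurable
  then show ?thesis
    unfolding slice_energy_def[abs_def] by (intro U.borel_measurable_nn_integral) (simp add: split_beta')
qed

lemma borel_measurable_grad_energy:
  fixes \<mu> :: "'a::euclidean_space measure"
  assumes \<mu>: "\<mu> \<in> W2_space"
  shows "grad_energy \<mu> \<in> borel_measurable (subprob_algebra borel)"
  unfolding grad_energy_def[abs_def]
proof (rule nn_integral_measurable_subprob_algebra2)
  let ?S = "subprob_algebra borel :: 'a measure measure"
  have "(\<lambda>z. H_deriv \<mu> (fst z) (snd z)) \<in> borel_measurable (?S \<Otimes>\<^sub>M borel)"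
    by (intro borel_measurable_H_deriv \<mu>) measurable
  then show "(\<lambda>(\<sigma>, x). ennreal ((norm (H_deriv \<mu> \<sigma> x))\<^sup>2)) \<in> borel_measurable (?S \<Otimes>\<^sub>M borel)"
    by (simp add: split_beta')
qed measurable

section \<open>Integrals over the sphere\<close>

lemma integrable_scaleR_uniform_sphere:
  fixes f :: "'a::euclidean_space \<Rightarrow> real"
  assumes "integrable uniform_sphere f"
  shows "integrable uniform_sphere (\<lambda>\<theta>. f \<theta> *\<^sub>R \<theta>)"
proof (rule Bochner_Integration.integrable_bound[OF assms])
  show "AE \<theta> in uniform_sphere. norm (f \<theta> *\<^sub>R \<theta>) \<le> norm (f \<theta>)"
    using AE_uniform_sphere by eventually_elim simp
  have [measurable]: "f \<in> borel_measurable uniform_sphere"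
    using assms by (rule borel_measurable_integrable)
  show "(\<lambda>\<theta>. f \<theta> *\<^sub>R \<theta>) \<in> borel_measurable uniform_sphere"
    by measurable
qed

lemma integrable_inner_uniform_sphere:
  fixes f :: "'a::euclidean_space \<Rightarrow> real"
  assumes "integrable uniform_sphere f"
  shows "integrable uniform_sphere (\<lambda>\<theta>. f \<theta> * (\<theta> \<bullet> v))"
    and "(\<integral>\<theta>. f \<theta> * (\<theta> \<bullet> v) \<partial>uniform_sphere) = (\<integral>\<theta>. f \<theta> *\<^sub>R \<theta> \<partial>uniform_sphere) \<bullet> v"
  using integrable_inner_left[of v, OF integrable_scaleR_uniform_sphere[OF assms]]
    integral_inner_left[of v, OF integrable_scaleR_uniform_sphere[OF assms]]
  by (simp_all only: inner_scaleR_left)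

lemma inner_square_le_norm_square:
  assumes "\<theta> \<in> sphere 0 1"
  shows "(v \<bullet> \<theta>)\<^sup>2 \<le> (norm (v::'a::euclidean_space))\<^sup>2"
proof -
  have "\<bar>v \<bullet> \<theta>\<bar> \<le> norm v"
    using Cauchy_Schwarz_ineq2[of v \<theta>] assms by simp
  from power_mono[OF this abs_ge_zero, of 2] show ?thesis
    by (simp only: power2_abs)
qed

lemma integrable_uniform_sphere_inner_square:
  "integrable uniform_sphere (\<lambda>\<theta>. (\<theta> \<bullet> v)\<^sup>2)"
  "(\<integral>\<theta>. (\<theta> \<bullet> v)\<^sup>2 \<partial>uniform_sphere) \<le> (norm (v::'a::euclidean_space))\<^sup>2"
proof -
  interpret U: prob_space "uniform_sphere :: 'a measure" by (rule prob_space_uniform_sphere)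
  have le: "AE \<theta> in uniform_sphere. (\<theta> \<bullet> v)\<^sup>2 \<le> (norm v)\<^sup>2"
    using AE_uniform_sphere
  proof eventually_elim
    case (elim \<theta>)
    show ?case
      unfolding inner_commute[of \<theta> v] by (rule inner_square_le_norm_square[OF elim])
  qed
  show int: "integrable uniform_sphere (\<lambda>\<theta>. (\<theta> \<bullet> v)\<^sup>2)"
  proof (rule U.integrable_const_bound)
    show "AE \<theta> in uniform_sphere. norm ((\<theta> \<bullet> v)\<^sup>2) \<le> (norm v)\<^sup>2"
      using le unfolding real_norm_def abs_power2 .
    show "(\<lambda>\<theta>. (\<theta> \<bullet> v)\<^sup>2) \<in> borel_measurable uniform_sphere"
      by measurable
  qed
  show "(\<integral>\<theta>. (\<theta> \<bullet> v)\<^sup>2 \<partial>uniform_sphere) \<le> (norm v)\<^sup>2"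
    by (rule U.integral_le_const[OF int le])
qed

lemma square_integrable_uniform_sphere:
  fixes f :: "'a::euclidean_space \<Rightarrow> real"
  assumes [measurable]: "f \<in> borel_measurable borel"
    and "(\<integral>\<^sup>+\<theta>. ennreal ((f \<theta>)\<^sup>2) \<partial>uniform_sphere) < \<infinity>"
  shows "integrable uniform_sphere f" "integrable uniform_sphere (\<lambda>\<theta>. (f \<theta>)\<^sup>2)"
proof -
  interpret U: prob_space "uniform_sphere :: 'a measure" by (rule prob_space_uniform_sphere)
  show "integrable uniform_sphere (\<lambda>\<theta>. (f \<theta>)\<^sup>2)"
  proof (rule integrableI_bounded)
    show "(\<integral>\<^sup>+\<theta>. ennreal (norm ((f \<theta>)\<^sup>2)) \<partial>uniform_sphere) < \<infinity>"
      using assms(2) unfolding real_norm_def abs_power2 .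
  qed measurable
  then show "integrable uniform_sphere f"
    by (rule U.square_integrable_imp_integrable[rotated]) measurable
qed

text \<open>Testing the vector integral against its own value \<open>v\<close> gives
  \<open>2 * (norm v)\<^sup>2\<close> as the integral of
  \<open>2 * (f \<theta> * (\<theta> \<bullet> v))\<close>. By the arithmetic-geometric mean
  inequality this is at most the integral of \<open>(f \<theta>)\<^sup>2\<close> plus
  \<open>(norm v)\<^sup>2\<close>.\<close>

lemma norm_integral_uniform_sphere_le:
  fixes f :: "'a::euclidean_space \<Rightarrow> real"
  assumes [measurable]: "f \<in> borel_measurable borel"
  shows "ennreal ((norm (\<integral>\<theta>. f \<theta> *\<^sub>R \<theta> \<partial>uniform_sphere))\<^sup>2) \<le> (\<integral>\<^sup>+\<theta>. ennreal ((f \<theta>)\<^sup>2) \<partial>uniform_sphere)"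
proof (cases "(\<integral>\<^sup>+\<theta>. ennreal ((f \<theta>)\<^sup>2) \<partial>uniform_sphere) < \<infinity>")
  case True
  note int = square_integrable_uniform_sphere[OF assms True]
  let ?v = "\<integral>\<theta>. f \<theta> *\<^sub>R \<theta> \<partial>uniform_sphere"
  have "2 * (norm ?v)\<^sup>2 = (\<integral>\<theta>. 2 * (f \<theta> * (\<theta> \<bullet> ?v)) \<partial>uniform_sphere)"
    by (subst integral_mult_right_zero, subst integrable_inner_uniform_sphere(2)[OF int(1)])
      (simp only: power2_norm_eq_inner)
  also have "\<dots> \<le> (\<integral>\<theta>. (f \<theta>)\<^sup>2 + (\<theta> \<bullet> ?v)\<^sup>2 \<partial>uniform_sphere)"
  proof (intro integral_mono)
    fix \<theta>
    show "2 * (f \<theta> * (\<theta> \<bullet> ?v)) \<le> (f \<theta>)\<^sup>2 + (\<theta> \<bullet> ?v)\<^sup>2"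
      using sum_squares_bound[of "f \<theta>" "\<theta> \<bullet> ?v"] by (simp only: mult.assoc)
  next
    show "integrable uniform_sphere (\<lambda>\<theta>. 2 * (f \<theta> * (\<theta> \<bullet> ?v)))"
      by (intro integrable_mult_right integrable_inner_uniform_sphere int)
    show "integrable uniform_sphere (\<lambda>\<theta>. (f \<theta>)\<^sup>2 + (\<theta> \<bullet> ?v)\<^sup>2)"
      by (intro Bochner_Integration.integrable_add int integrable_uniform_sphere_inner_square)
  qed
  also have "\<dots> \<le> (\<integral>\<theta>. (f \<theta>)\<^sup>2 \<partial>uniform_sphere) + (norm ?v)\<^sup>2"
    by (subst Bochner_Integration.integral_add[OF int(2) integrable_uniform_sphere_inner_square(1)])
      (rule add_left_mono[OF integrable_uniform_sphere_inner_square(2)])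
  finally have "(norm ?v)\<^sup>2 \<le> (\<integral>\<theta>. (f \<theta>)\<^sup>2 \<partial>uniform_sphere)" by linarith
  then show ?thesis
    by (subst nn_integral_eq_integral[OF int(2)]) (simp_all only: ennreal_leI zero_le_power2 eventually_True)
next
  case False
  then show ?thesis by (simp only: infinity_ennreal_def not_less top_unique top_greatest)
qed

lemma square_add_le: "((a::real) + b)\<^sup>2 \<le> 2 * a\<^sup>2 + 2 * b\<^sup>2"
  using sum_squares_bound[of a b] by (simp add: power2_sum)

lemma ennreal_double_add:
  "0 \<le> x \<Longrightarrow> 0 \<le> y \<Longrightarrow> 2 * ennreal x + 2 * ennreal y = ennreal (2 * x + 2 * y)"
  by (simp only: ennreal_plus ennreal_mult ennreal_numeral zero_le_numeral mult_nonneg_nonneg)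

lemma norm_add_square_le: "(norm ((a::'a::real_inner) + b))\<^sup>2 \<le> 2 * (norm a)\<^sup>2 + 2 * (norm b)\<^sup>2"
  using square_add_le[of "norm a" "norm b"] norm_triangle_ineq[of a b]
  using power_mono[OF norm_triangle_ineq[of a b] norm_ge_zero, of 2] by linarith

lemma slice_energy_swap:
  assumes \<mu>: "\<mu> \<in> W2_space" and \<sigma>: "\<sigma> \<in> W2_space"
  shows "slice_energy \<mu> \<sigma> = (\<integral>\<^sup>+x. \<integral>\<^sup>+\<theta>. ennreal ((displ \<mu> \<sigma> \<theta> x)\<^sup>2) \<partial>uniform_sphere \<partial>\<sigma>)"
proof -
  interpret U: prob_space "uniform_sphere :: 'a measure" by (rule prob_space_uniform_sphere)
  interpret S: prob_space \<sigma> by (rule prob_space_W2_space[OF \<sigma>])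
  interpret pair_sigma_finite \<sigma> "uniform_sphere :: 'a measure" ..
  note [measurable_cong] = sets_W2_space[OF \<sigma>]
  have pc: "sets (\<sigma> \<Otimes>\<^sub>M uniform_sphere) = sets (borel \<Otimes>\<^sub>M borel)"
    by (intro sets_pair_measure_cong sets_W2_space[OF \<sigma>] sets_uniform_sphere)
  have [measurable]: "(\<lambda>z. displ \<mu> \<sigma> (snd z) (fst z)) \<in> borel_measurable (\<sigma> \<Otimes>\<^sub>M uniform_sphere)"
    by (subst measurable_cong_sets[OF pc refl]) (intro borel_measurable_displ_fixed[OF \<mu> \<sigma>]; measurable)
  show ?thesis
    unfolding slice_energy_def by (rule Fubini') (simp add: split_beta')
qed

text \<open>The independent coupling is an admissible competitor in every direction, and its cost is
  at most twice the sum of the second moments, uniformly in the direction.\<close>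

lemma slice_energy_finite:
  fixes \<mu> :: "'a::euclidean_space measure"
  assumes \<mu>: "\<mu> \<in> W2_space" and \<sigma>: "\<sigma> \<in> W2_ac"
  shows "slice_energy \<mu> \<sigma> < \<infinity>"
proof -
  note \<sigma>' = W2_acD[OF \<sigma>]
  interpret U: prob_space "uniform_sphere :: 'a measure" by (rule prob_space_uniform_sphere)
  interpret S: prob_space \<sigma> by (rule prob_space_W2_space[OF \<sigma>'])
  interpret M: prob_space \<mu> by (rule prob_space_W2_space[OF \<mu>])
  interpret SM: pair_prob_space \<sigma> \<mu> ..
  note [measurable_cong] = sets_W2_space[OF \<sigma>'] sets_W2_space[OF \<mu>]
  have pc: "sets (\<sigma> \<Otimes>\<^sub>M \<mu>) = sets (borel \<Otimes>\<^sub>M borel)"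
    by (intro sets_pair_measure_cong sets_W2_space \<sigma>' \<mu>)
  have pm [measurable]: "fst \<in> borel_measurable (\<sigma> \<Otimes>\<^sub>M \<mu>)" "snd \<in> borel_measurable (\<sigma> \<Otimes>\<^sub>M \<mu>)"
    by (subst measurable_cong_sets[OF pc refl], measurable)+
  let ?C = "2 * (\<integral>\<^sup>+x. ennreal ((norm x)\<^sup>2) \<partial>\<sigma>) + 2 * (\<integral>\<^sup>+x. ennreal ((norm x)\<^sup>2) \<partial>\<mu>)"
  have sp: "space \<sigma> = UNIV" "space \<mu> = UNIV"
    using sets_eq_imp_space_eq[OF sets_W2_space[OF \<sigma>']] sets_eq_imp_space_eq[OF sets_W2_space[OF \<mu>]] by auto
  have one: "emeasure \<sigma> UNIV = 1" "emeasure \<mu> UNIV = 1"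
    using S.emeasure_space_1 M.emeasure_space_1 sp by auto
  have "AE \<theta> in uniform_sphere. (\<integral>\<^sup>+x. ennreal ((displ \<mu> \<sigma> \<theta> x)\<^sup>2) \<partial>\<sigma>) \<le> ?C"
    using AE_uniform_sphere
  proof eventually_elim
    case (elim \<theta>)
    have "(\<integral>\<^sup>+x. ennreal ((displ \<mu> \<sigma> \<theta> x)\<^sup>2) \<partial>\<sigma>) \<le> (\<integral>\<^sup>+w. ennreal ((fst w \<bullet> \<theta> - snd w \<bullet> \<theta>)\<^sup>2) \<partial>(\<sigma> \<Otimes>\<^sub>M \<mu>))"
    proof (rule transport_optimal[OF \<sigma> elim \<mu>])
      fix s
      have "{w \<in> space (\<sigma> \<Otimes>\<^sub>M \<mu>). fst w \<bullet> \<theta> \<le> s} = {x \<in> space \<sigma>. x \<bullet> \<theta> \<le> s} \<times> space \<mu>"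
        "{w \<in> space (\<sigma> \<Otimes>\<^sub>M \<mu>). snd w \<bullet> \<theta> \<le> s} = space \<sigma> \<times> {x \<in> space \<mu>. x \<bullet> \<theta> \<le> s}"
        by (auto simp: space_pair_measure)
      moreover have "{x \<in> space \<sigma>. x \<bullet> \<theta> \<le> s} \<in> sets \<sigma>" "{x \<in> space \<mu>. x \<bullet> \<theta> \<le> s} \<in> sets \<mu>"
        by measurable
      ultimately show "measure (\<sigma> \<Otimes>\<^sub>M \<mu>) {w \<in> space (\<sigma> \<Otimes>\<^sub>M \<mu>). fst w \<bullet> \<theta> \<le> s} = cdf (slice \<theta> \<sigma>) s"
        "measure (\<sigma> \<Otimes>\<^sub>M \<mu>) {w \<in> space (\<sigma> \<Otimes>\<^sub>M \<mu>). snd w \<bullet> \<theta> \<le> s} = cdf (slice \<theta> \<mu>) s"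
        by (simp_all add: measure_def M.emeasure_pair_measure_Times one
            cdf_slice[OF sets_W2_space] \<sigma>' \<mu> sp)
    qed (unfold_locales, measurable)
    also have "\<dots> \<le> (\<integral>\<^sup>+w. 2 * ennreal ((norm (fst w))\<^sup>2) + 2 * ennreal ((norm (snd w))\<^sup>2) \<partial>(\<sigma> \<Otimes>\<^sub>M \<mu>))"
    proof (intro nn_integral_mono)
      fix w :: "'a \<times> 'a"
      have "(fst w \<bullet> \<theta> - snd w \<bullet> \<theta>)\<^sup>2 \<le> 2 * (fst w \<bullet> \<theta>)\<^sup>2 + 2 * (snd w \<bullet> \<theta>)\<^sup>2"
        using square_add_le[of "fst w \<bullet> \<theta>" "- (snd w \<bullet> \<theta>)"] by simp
      also have "\<dots> \<le> 2 * (norm (fst w))\<^sup>2 + 2 * (norm (snd w))\<^sup>2"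
        using inner_square_le_norm_square[OF elim, of "fst w"] inner_square_le_norm_square[OF elim, of "snd w"] by linarith
      finally have "(fst w \<bullet> \<theta> - snd w \<bullet> \<theta>)\<^sup>2 \<le> 2 * (norm (fst w))\<^sup>2 + 2 * (norm (snd w))\<^sup>2" .
      then show "ennreal ((fst w \<bullet> \<theta> - snd w \<bullet> \<theta>)\<^sup>2) \<le> 2 * ennreal ((norm (fst w))\<^sup>2) + 2 * ennreal ((norm (snd w))\<^sup>2)"
        by (subst ennreal_double_add) (simp_all only: ennreal_leI zero_le_power2)
    qed
    also have "\<dots> = ?C"
      using M.nn_integral_fst[of "\<lambda>w. 2 * ennreal ((norm (fst w))\<^sup>2) + 2 * ennreal ((norm (snd w))\<^sup>2)" \<sigma>, symmetric]
      by (simp add: nn_integral_add nn_integral_cmult M.emeasure_space_1 S.emeasure_space_1)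
    finally show ?case .
  qed
  then have "slice_energy \<mu> \<sigma> \<le> (\<integral>\<^sup>+(\<theta>::'a). ?C \<partial>uniform_sphere)"
    unfolding slice_energy_def by (rule nn_integral_mono_AE)
  also have "\<dots> = ?C" by (simp add: U.emeasure_space_1[simplified])
  also have "\<dots> < \<infinity>"
    using \<mu> \<sigma>' by (auto simp: W2_space_def integrable_iff_bounded ennreal_mult_less_top)
  finally show ?thesis .
qed

text \<open>The pair of two equal projections is a competitor of cost 0.\<close>

lemma slice_energy_self:
  assumes \<mu>: "\<mu> \<in> W2_ac"
  shows "slice_energy \<mu> \<mu> = 0"
proof -
  note \<mu>' = W2_acD[OF \<mu>]
  note [measurable_cong] = sets_W2_space[OF \<mu>']
  have sp: "space \<mu> = UNIV"
    by (rule space_W2_space[OF \<mu>'])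
  have "AE \<theta> in uniform_sphere. (\<integral>\<^sup>+x. ennreal ((displ \<mu> \<mu> \<theta> x)\<^sup>2) \<partial>\<mu>) \<le> 0"
    using AE_uniform_sphere
  proof eventually_elim
    case (elim \<theta>)
    have "(\<integral>\<^sup>+x. ennreal ((displ \<mu> \<mu> \<theta> x)\<^sup>2) \<partial>\<mu>) \<le> (\<integral>\<^sup>+x. ennreal ((x \<bullet> \<theta> - x \<bullet> \<theta>)\<^sup>2) \<partial>\<mu>)"
      by (rule transport_optimal[OF \<mu> elim \<mu>' prob_space_W2_space[OF \<mu>']])
        (simp_all add: cdf_slice[OF sets_W2_space[OF \<mu>']] sp)
    then show ?case by simp
  qed
  then have "slice_energy \<mu> \<mu> \<le> (\<integral>\<^sup>+(\<theta>::'a). 0 \<partial>uniform_sphere)"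
    unfolding slice_energy_def by (rule nn_integral_mono_AE)
  then show ?thesis by simp
qed

lemma grad_energy_le:
  assumes \<mu>: "\<mu> \<in> W2_space" and \<sigma>: "\<sigma> \<in> W2_space"
  shows "grad_energy \<mu> \<sigma> \<le> slice_energy \<mu> \<sigma>"
  unfolding grad_energy_def slice_energy_swap[OF \<mu> \<sigma>] H_deriv_displ
  by (intro nn_integral_mono norm_integral_uniform_sphere_le borel_measurable_displ_fixed \<mu> \<sigma>) measurable

lemma grad_energy_eq_0D:
  assumes \<mu>: "\<mu> \<in> W2_space" and \<sigma>: "\<sigma> \<in> W2_space" and 0: "grad_energy \<mu> \<sigma> = 0"
  shows "AE x in \<sigma>. H_deriv \<mu> \<sigma> x = 0"
proof -
  note [measurable_cong] = sets_W2_space[OF \<sigma>]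
  have [measurable]: "(\<lambda>x. H_deriv \<mu> \<sigma> x) \<in> borel_measurable \<sigma>"
    using W2_space_in_subprob[OF \<sigma>] by (intro borel_measurable_H_deriv \<mu>) auto
  show ?thesis
    using 0 unfolding grad_energy_def by (subst (asm) nn_integral_0_iff_AE) auto
qed

subsection \<open>Comparison of energies along a coupling\<close>

text \<open>Squared L2 distance between the two displacement fields, each evaluated at its own end
  of the coupling. It controls the change of the energy and of the gradient alike.\<close>

definition coupling_defect ::
    "'a::euclidean_space measure \<Rightarrow> 'a measure \<Rightarrow> 'a measure \<Rightarrow> ('a \<times> 'a) measure \<Rightarrow> ennreal" where
  "coupling_defect \<mu> \<sigma> \<eta> \<pi> =
     (\<integral>\<^sup>+\<theta>. \<integral>\<^sup>+z. ennreal ((displ \<mu> \<sigma> \<theta> (fst z) - displ \<mu> \<eta> \<theta> (snd z))\<^sup>2) \<partial>\<pi> \<partial>uniform_sphere)"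

lemma ennreal_square_split:
  assumes "(a::real)\<^sup>2 \<le> 2 * b\<^sup>2 + 2 * c\<^sup>2"
  shows "ennreal (a\<^sup>2) \<le> 2 * ennreal (b\<^sup>2) + 2 * ennreal (c\<^sup>2)"
  using assms by (subst ennreal_double_add) (simp_all only: ennreal_leI zero_le_power2)

context
  fixes \<mu> \<sigma> \<eta> :: "'a::euclidean_space measure" and \<pi> :: "('a \<times> 'a) measure"
  assumes \<mu>: "\<mu> \<in> W2_space" and \<sigma>: "\<sigma> \<in> W2_ac" and \<eta>: "\<eta> \<in> W2_ac" and \<pi>: "\<pi> \<in> couplings \<sigma> \<eta>"
begin

interpretation U: prob_space "uniform_sphere :: 'a measure" by (rule prob_space_uniform_sphere)

interpretation \<pi>: prob_space \<pi>
  using couplings_prob_space[OF \<pi>] prob_space_W2_space[OF W2_acD[OF \<sigma>]] .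

interpretation P: pair_sigma_finite \<pi> "uniform_sphere :: 'a measure" ..

private lemma fs [measurable]: "fst \<in> borel_measurable \<pi>" "snd \<in> borel_measurable \<pi>"
  by (simp_all add: measurable_cong_sets[OF couplings_sets[OF \<pi>] refl])

private lemma mD [measurable]:
  "(\<lambda>x. displ \<mu> \<sigma> \<theta> x) \<in> borel_measurable borel"
  "(\<lambda>x. displ \<mu> \<eta> \<theta> x) \<in> borel_measurable borel"
  "(\<lambda>\<theta>. displ \<mu> \<sigma> \<theta> x) \<in> borel_measurable borel"
  "(\<lambda>\<theta>. displ \<mu> \<eta> \<theta> x) \<in> borel_measurable borel"
  by (intro borel_measurable_displ_fixed \<mu> W2_acD \<sigma> \<eta>; measurable)+

private lemma mDp [measurable]:
  "(\<lambda>w. displ \<mu> \<sigma> (snd w) (fst (fst w))) \<in> borel_measurable (\<pi> \<Otimes>\<^sub>M uniform_sphere)"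
  "(\<lambda>w. displ \<mu> \<eta> (snd w) (snd (fst w))) \<in> borel_measurable (\<pi> \<Otimes>\<^sub>M uniform_sphere)"
proof -
  have s: "snd \<in> borel_measurable (\<pi> \<Otimes>\<^sub>M (uniform_sphere :: 'a measure))"
    by (rule measurable_compose[OF measurable_snd measurable_ident_sets[OF sets_uniform_sphere]])
  show "(\<lambda>w. displ \<mu> \<sigma> (snd w) (fst (fst w))) \<in> borel_measurable (\<pi> \<Otimes>\<^sub>M uniform_sphere)"
    by (intro borel_measurable_displ_fixed \<mu> W2_acD \<sigma> s measurable_compose[OF measurable_fst fs(1)])
  show "(\<lambda>w. displ \<mu> \<eta> (snd w) (snd (fst w))) \<in> borel_measurable (\<pi> \<Otimes>\<^sub>M uniform_sphere)"
    by (intro borel_measurable_displ_fixed \<mu> W2_acD \<eta> s measurable_compose[OF measurable_fst fs(2)])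
qed

private lemma energy_coupling:
  "slice_energy \<mu> \<sigma> = (\<integral>\<^sup>+z. \<integral>\<^sup>+\<theta>. ennreal ((displ \<mu> \<sigma> \<theta> (fst z))\<^sup>2) \<partial>uniform_sphere \<partial>\<pi>)"
  "slice_energy \<mu> \<eta> = (\<integral>\<^sup>+z. \<integral>\<^sup>+\<theta>. ennreal ((displ \<mu> \<eta> \<theta> (snd z))\<^sup>2) \<partial>uniform_sphere \<partial>\<pi>)"
proof -
  have "slice_energy \<mu> \<sigma> = (\<integral>\<^sup>+\<theta>. \<integral>\<^sup>+z. ennreal ((displ \<mu> \<sigma> \<theta> (fst z))\<^sup>2) \<partial>\<pi> \<partial>uniform_sphere)"
    unfolding slice_energy_def
    by (intro nn_integral_cong couplings_nn_integral(1)[OF \<pi>, symmetric]) measurable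
  also have "\<dots> = (\<integral>\<^sup>+z. \<integral>\<^sup>+\<theta>. ennreal ((displ \<mu> \<sigma> \<theta> (fst z))\<^sup>2) \<partial>uniform_sphere \<partial>\<pi>)"
    by (rule P.Fubini') (simp add: split_beta')
  finally show "slice_energy \<mu> \<sigma> = \<dots>" .
  have "slice_energy \<mu> \<eta> = (\<integral>\<^sup>+\<theta>. \<integral>\<^sup>+z. ennreal ((displ \<mu> \<eta> \<theta> (snd z))\<^sup>2) \<partial>\<pi> \<partial>uniform_sphere)"
    unfolding slice_energy_def
    by (intro nn_integral_cong couplings_nn_integral(2)[OF \<pi>, symmetric]) measurable
  also have "\<dots> = (\<integral>\<^sup>+z. \<integral>\<^sup>+\<theta>. ennreal ((displ \<mu> \<eta> \<theta> (snd z))\<^sup>2) \<partial>uniform_sphere \<partial>\<pi>)"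
    by (rule P.Fubini') (simp add: split_beta')
  finally show "slice_energy \<mu> \<eta> = \<dots>" .
qed

private lemma defect_swap:
  "coupling_defect \<mu> \<sigma> \<eta> \<pi> =
    (\<integral>\<^sup>+z. \<integral>\<^sup>+\<theta>. ennreal ((displ \<mu> \<sigma> \<theta> (fst z) - displ \<mu> \<eta> \<theta> (snd z))\<^sup>2) \<partial>uniform_sphere \<partial>\<pi>)"
  unfolding coupling_defect_def by (rule P.Fubini') (simp add: split_beta')

private lemma inner_measurable [measurable]:
  "(\<lambda>z. \<integral>\<^sup>+\<theta>. ennreal ((displ \<mu> \<sigma> \<theta> (fst z))\<^sup>2) \<partial>uniform_sphere) \<in> borel_measurable \<pi>"
  "(\<lambda>z. \<integral>\<^sup>+\<theta>. ennreal ((displ \<mu> \<eta> \<theta> (snd z))\<^sup>2) \<partial>uniform_sphere) \<in> borel_measurable \<pi>"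
  "(\<lambda>z. \<integral>\<^sup>+\<theta>. ennreal ((displ \<mu> \<sigma> \<theta> (fst z) - displ \<mu> \<eta> \<theta> (snd z))\<^sup>2) \<partial>uniform_sphere) \<in> borel_measurable \<pi>"
  by (intro U.borel_measurable_nn_integral; simp add: split_beta')+

text \<open>Only \<open>square_add_le\<close> is behind this. The factors 2 give up continuity of
  the energy, but boundedness and convergence to 0, for which it is used, survive them.\<close>

lemma slice_energy_le_defect:
  "slice_energy \<mu> \<sigma> \<le> 2 * coupling_defect \<mu> \<sigma> \<eta> \<pi> + 2 * slice_energy \<mu> \<eta>"
  "slice_energy \<mu> \<eta> \<le> 2 * coupling_defect \<mu> \<sigma> \<eta> \<pi> + 2 * slice_energy \<mu> \<sigma>"
proof -
  have 1: "(\<integral>\<^sup>+\<theta>. ennreal ((displ \<mu> \<sigma> \<theta> (fst z))\<^sup>2) \<partial>uniform_sphere) \<le>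
      2 * (\<integral>\<^sup>+\<theta>. ennreal ((displ \<mu> \<sigma> \<theta> (fst z) - displ \<mu> \<eta> \<theta> (snd z))\<^sup>2) \<partial>uniform_sphere)
      + 2 * (\<integral>\<^sup>+\<theta>. ennreal ((displ \<mu> \<eta> \<theta> (snd z))\<^sup>2) \<partial>uniform_sphere)" for z
    by (subst (1 2) nn_integral_cmult[symmetric], measurable, subst nn_integral_add[symmetric], measurable,
        intro nn_integral_mono ennreal_square_split order_trans[OF _ square_add_le]) simp
  have 2: "(\<integral>\<^sup>+\<theta>. ennreal ((displ \<mu> \<eta> \<theta> (snd z))\<^sup>2) \<partial>uniform_sphere) \<le>
      2 * (\<integral>\<^sup>+\<theta>. ennreal ((displ \<mu> \<sigma> \<theta> (fst z) - displ \<mu> \<eta> \<theta> (snd z))\<^sup>2) \<partial>uniform_sphere)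
      + 2 * (\<integral>\<^sup>+\<theta>. ennreal ((displ \<mu> \<sigma> \<theta> (fst z))\<^sup>2) \<partial>uniform_sphere)" for z
    by (subst (1 2) nn_integral_cmult[symmetric], measurable, subst nn_integral_add[symmetric], measurable,
        subst power2_commute, intro nn_integral_mono ennreal_square_split order_trans[OF _ square_add_le]) simp
  show "slice_energy \<mu> \<sigma> \<le> 2 * coupling_defect \<mu> \<sigma> \<eta> \<pi> + 2 * slice_energy \<mu> \<eta>"
    unfolding energy_coupling defect_swap
    by (subst (1 2) nn_integral_cmult[symmetric], measurable, subst nn_integral_add[symmetric], measurable,
        intro nn_integral_mono 1)
  show "slice_energy \<mu> \<eta> \<le> 2 * coupling_defect \<mu> \<sigma> \<eta> \<pi> + 2 * slice_energy \<mu> \<sigma>"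
    unfolding energy_coupling defect_swap
    by (subst (1 2) nn_integral_cmult[symmetric], measurable, subst nn_integral_add[symmetric], measurable,
        intro nn_integral_mono 2)
qed

lemma grad_energy_le_defect:
  "grad_energy \<mu> \<eta> \<le> 2 * grad_energy \<mu> \<sigma> + 2 * coupling_defect \<mu> \<sigma> \<eta> \<pi>"
proof -
  have [measurable]: "(\<lambda>x. H_deriv \<mu> \<sigma> x) \<in> borel_measurable borel" "(\<lambda>x. H_deriv \<mu> \<eta> x) \<in> borel_measurable borel"
    using W2_space_in_subprob[OF W2_acD[OF \<sigma>]] W2_space_in_subprob[OF W2_acD[OF \<eta>]]
    by (auto intro!: borel_measurable_H_deriv \<mu>)
  \<comment> \<open>Finite energies make both displacements integrable in the direction for almost
    every pair. Elsewhere a Bochner integral could take its default value, and the two gradients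
    could not be subtracted under one integral.\<close>
  have "(\<integral>\<^sup>+z. \<integral>\<^sup>+\<theta>. ennreal ((displ \<mu> \<sigma> \<theta> (fst z))\<^sup>2) \<partial>uniform_sphere \<partial>\<pi>) \<noteq> \<infinity>"
    "(\<integral>\<^sup>+z. \<integral>\<^sup>+\<theta>. ennreal ((displ \<mu> \<eta> \<theta> (snd z))\<^sup>2) \<partial>uniform_sphere \<partial>\<pi>) \<noteq> \<infinity>"
    using slice_energy_finite[OF \<mu> \<sigma>] slice_energy_finite[OF \<mu> \<eta>] unfolding energy_coupling by simp_all
  note fin = nn_integral_PInf_AE[OF inner_measurable(1) this(1)] nn_integral_PInf_AE[OF inner_measurable(2) this(2)]
  have "AE z in \<pi>. ennreal ((norm (H_deriv \<mu> \<eta> (snd z)))\<^sup>2) \<le> 2 * ennreal ((norm (H_deriv \<mu> \<sigma> (fst z)))\<^sup>2)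
      + 2 * (\<integral>\<^sup>+\<theta>. ennreal ((displ \<mu> \<sigma> \<theta> (fst z) - displ \<mu> \<eta> \<theta> (snd z))\<^sup>2) \<partial>uniform_sphere)"
    using fin
  proof eventually_elim
    case (elim z)
    let ?f = "\<lambda>\<theta>. displ \<mu> \<sigma> \<theta> (fst z)" and ?g = "\<lambda>\<theta>. displ \<mu> \<eta> \<theta> (snd z)"
    have int: "integrable uniform_sphere ?f" "integrable uniform_sphere ?g"
      using elim by (auto intro!: square_integrable_uniform_sphere(1) simp: less_top)
    have diff: "H_deriv \<mu> \<sigma> (fst z) - H_deriv \<mu> \<eta> (snd z) = (\<integral>\<theta>. (?f \<theta> - ?g \<theta>) *\<^sub>R \<theta> \<partial>uniform_sphere)"
      unfolding H_deriv_displ scaleR_left_diff_distrib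
      by (rule Bochner_Integration.integral_diff[symmetric]) (intro integrable_scaleR_uniform_sphere int)+
    have "(norm (H_deriv \<mu> \<eta> (snd z)))\<^sup>2 \<le> 2 * (norm (H_deriv \<mu> \<sigma> (fst z)))\<^sup>2
        + 2 * (norm (H_deriv \<mu> \<sigma> (fst z) - H_deriv \<mu> \<eta> (snd z)))\<^sup>2"
      using norm_add_square_le[of "H_deriv \<mu> \<sigma> (fst z)" "H_deriv \<mu> \<eta> (snd z) - H_deriv \<mu> \<sigma> (fst z)"]
      by (simp add: norm_minus_commute)
    then have "ennreal ((norm (H_deriv \<mu> \<eta> (snd z)))\<^sup>2) \<le> 2 * ennreal ((norm (H_deriv \<mu> \<sigma> (fst z)))\<^sup>2)
        + 2 * ennreal ((norm (H_deriv \<mu> \<sigma> (fst z) - H_deriv \<mu> \<eta> (snd z)))\<^sup>2)"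
      by (rule ennreal_square_split)
    also have "\<dots> \<le> 2 * ennreal ((norm (H_deriv \<mu> \<sigma> (fst z)))\<^sup>2) + 2 * (\<integral>\<^sup>+\<theta>. ennreal ((?f \<theta> - ?g \<theta>)\<^sup>2) \<partial>uniform_sphere)"
      unfolding diff by (intro add_left_mono mult_left_mono norm_integral_uniform_sphere_le borel_measurable_diff mD) simp
    finally show ?case .
  qed
  then have "(\<integral>\<^sup>+z. ennreal ((norm (H_deriv \<mu> \<eta> (snd z)))\<^sup>2) \<partial>\<pi>)
    \<le> (\<integral>\<^sup>+z. 2 * ennreal ((norm (H_deriv \<mu> \<sigma> (fst z)))\<^sup>2)
      + 2 * (\<integral>\<^sup>+\<theta>. ennreal ((displ \<mu> \<sigma> \<theta> (fst z) - displ \<mu> \<eta> \<theta> (snd z))\<^sup>2) \<partial>uniform_sphere) \<partial>\<pi>)"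
    by (rule nn_integral_mono_AE)
  also have "\<dots> = 2 * (\<integral>\<^sup>+z. ennreal ((norm (H_deriv \<mu> \<sigma> (fst z)))\<^sup>2) \<partial>\<pi>) + 2 * coupling_defect \<mu> \<sigma> \<eta> \<pi>"
    unfolding defect_swap by (simp add: nn_integral_add nn_integral_cmult)
  finally show ?thesis
    unfolding grad_energy_def
    using couplings_nn_integral(1)[OF \<pi>, of "\<lambda>x. ennreal ((norm (H_deriv \<mu> \<sigma> x))\<^sup>2)"]
      couplings_nn_integral(2)[OF \<pi>, of "\<lambda>x. ennreal ((norm (H_deriv \<mu> \<eta> x))\<^sup>2)"] by simp
qed

text \<open>Two displacements differ by the shift of the points and by the shift of the transports;
  along a unit direction the former is at most the distance of the points.\<close>

lemma coupling_defect_le: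
  "coupling_defect \<mu> \<sigma> \<eta> \<pi> \<le> 2 * coupling_cost \<pi> +
    2 * (\<integral>\<^sup>+\<theta>. \<integral>\<^sup>+z. ennreal ((transport \<mu> \<sigma> \<theta> (fst z) - transport \<mu> \<eta> \<theta> (snd z))\<^sup>2) \<partial>\<pi> \<partial>uniform_sphere)"
proof -
  have [measurable]: "(\<lambda>z. transport \<mu> \<sigma> \<theta> (fst z)) \<in> borel_measurable \<pi>" "(\<lambda>z. transport \<mu> \<eta> \<theta> (snd z)) \<in> borel_measurable \<pi>" for \<theta>
    using fs by (auto intro!: borel_measurable_transport_fixed \<mu> \<sigma> \<eta>)
  have "AE \<theta> in uniform_sphere. (\<integral>\<^sup>+z. ennreal ((displ \<mu> \<sigma> \<theta> (fst z) - displ \<mu> \<eta> \<theta> (snd z))\<^sup>2) \<partial>\<pi>)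
      \<le> 2 * coupling_cost \<pi> + 2 * (\<integral>\<^sup>+z. ennreal ((transport \<mu> \<sigma> \<theta> (fst z) - transport \<mu> \<eta> \<theta> (snd z))\<^sup>2) \<partial>\<pi>)"
    using AE_uniform_sphere
  proof eventually_elim
    case (elim \<theta>)
    have "(\<integral>\<^sup>+z. ennreal ((displ \<mu> \<sigma> \<theta> (fst z) - displ \<mu> \<eta> \<theta> (snd z))\<^sup>2) \<partial>\<pi>)
      \<le> (\<integral>\<^sup>+z. 2 * ennreal ((dist (fst z) (snd z))\<^sup>2) + 2 * ennreal ((transport \<mu> \<sigma> \<theta> (fst z) - transport \<mu> \<eta> \<theta> (snd z))\<^sup>2) \<partial>\<pi>)"
    proof (intro nn_integral_mono ennreal_square_split)
      fix z :: "'a \<times> 'a"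
      have "(displ \<mu> \<sigma> \<theta> (fst z) - displ \<mu> \<eta> \<theta> (snd z))\<^sup>2
          = ((fst z - snd z) \<bullet> \<theta> + (transport \<mu> \<eta> \<theta> (snd z) - transport \<mu> \<sigma> \<theta> (fst z)))\<^sup>2"
        by (simp add: displ_def inner_diff_left algebra_simps)
      also have "\<dots> \<le> 2 * ((fst z - snd z) \<bullet> \<theta>)\<^sup>2 + 2 * (transport \<mu> \<eta> \<theta> (snd z) - transport \<mu> \<sigma> \<theta> (fst z))\<^sup>2"
        by (rule square_add_le)
      also have "\<dots> \<le> 2 * (dist (fst z) (snd z))\<^sup>2 + 2 * (transport \<mu> \<sigma> \<theta> (fst z) - transport \<mu> \<eta> \<theta> (snd z))\<^sup>2"
        using inner_square_le_norm_square[OF elim, of "fst z - snd z"]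
        by (simp add: dist_norm power2_commute[of "transport \<mu> \<eta> \<theta> (snd z)"])
      finally show "(displ \<mu> \<sigma> \<theta> (fst z) - displ \<mu> \<eta> \<theta> (snd z))\<^sup>2
        \<le> 2 * (dist (fst z) (snd z))\<^sup>2 + 2 * (transport \<mu> \<sigma> \<theta> (fst z) - transport \<mu> \<eta> \<theta> (snd z))\<^sup>2" .
    qed
    also have "\<dots> = 2 * coupling_cost \<pi> + 2 * (\<integral>\<^sup>+z. ennreal ((transport \<mu> \<sigma> \<theta> (fst z) - transport \<mu> \<eta> \<theta> (snd z))\<^sup>2) \<partial>\<pi>)"
      unfolding coupling_cost_def by (simp add: nn_integral_add nn_integral_cmult)
    finally show ?case .
  qed
  then have "coupling_defect \<mu> \<sigma> \<eta> \<pi> \<le> (\<integral>\<^sup>+\<theta>. 2 * coupling_cost \<pi> + 2 * (\<integral>\<^sup>+z. ennreal ((transport \<mu> \<sigma> \<theta> (fst z) - transport \<mu> \<eta> \<theta> (snd z))\<^sup>2) \<partial>\<pi>) \<partial>uniform_sphere)"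
    unfolding coupling_defect_def by (rule nn_integral_mono_AE)
  also have "\<dots> = 2 * coupling_cost \<pi> +
    2 * (\<integral>\<^sup>+\<theta>. \<integral>\<^sup>+z. ennreal ((transport \<mu> \<sigma> \<theta> (fst z) - transport \<mu> \<eta> \<theta> (snd z))\<^sup>2) \<partial>\<pi> \<partial>uniform_sphere)"
  proof -
    have f: "fst \<in> borel_measurable ((uniform_sphere :: 'a measure) \<Otimes>\<^sub>M \<pi>)"
      by (rule measurable_compose[OF measurable_fst measurable_ident_sets[OF sets_uniform_sphere]])
    have [measurable]: "(\<lambda>w. transport \<mu> \<sigma> (fst w) (fst (snd w))) \<in> borel_measurable (uniform_sphere \<Otimes>\<^sub>M \<pi>)"
      "(\<lambda>w. transport \<mu> \<eta> (fst w) (snd (snd w))) \<in> borel_measurable (uniform_sphere \<Otimes>\<^sub>M \<pi>)"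
      using f measurable_compose[OF measurable_snd fs(1)] measurable_compose[OF measurable_snd fs(2)]
    by (auto intro!: borel_measurable_transport_fixed \<mu> \<sigma> \<eta>)
    have "(\<lambda>\<theta>. \<integral>\<^sup>+z. ennreal ((transport \<mu> \<sigma> \<theta> (fst z) - transport \<mu> \<eta> \<theta> (snd z))\<^sup>2) \<partial>\<pi>) \<in> borel_measurable uniform_sphere"
      by (intro \<pi>.borel_measurable_nn_integral) (simp add: split_beta')
    then show ?thesis
      using U.emeasure_space_1 by (simp add: nn_integral_add nn_integral_cmult)
  qed
  finally show ?thesis .
qed

end

lemma coupling_defect_tendsto_0:
  assumes "\<And>j. \<tau> j \<in> W2_ac" "\<eta> \<in> W2_ac" "\<mu> \<in> W2_space" "\<And>j. \<pi> j \<in> couplings (\<tau> j) \<eta>"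
    "(\<lambda>j. coupling_cost (\<pi> j)) \<longlonglongrightarrow> 0"
  shows "(\<lambda>j. coupling_defect \<mu> (\<tau> j) \<eta> (\<pi> j)) \<longlonglongrightarrow> 0"
proof -
  let ?T = "\<lambda>j. \<integral>\<^sup>+\<theta>. \<integral>\<^sup>+z. ennreal ((transport \<mu> (\<tau> j) \<theta> (fst z) - transport \<mu> \<eta> \<theta> (snd z))\<^sup>2) \<partial>\<pi> j \<partial>uniform_sphere"
  have "(\<lambda>j. 2 * coupling_cost (\<pi> j) + 2 * ?T j) \<longlonglongrightarrow> 2 * 0 + 2 * 0"
    using transport_stability[OF assms] assms(5) by (intro tendsto_add ennreal_tendsto_cmult) auto
  then show ?thesis
    by (intro tendsto_sandwich[where f="\<lambda>_. 0" and g="\<lambda>j. coupling_defect \<mu> (\<tau> j) \<eta> (\<pi> j)"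
          and h="\<lambda>j. 2 * coupling_cost (\<pi> j) + 2 * ?T j"])
      (use coupling_defect_le[OF assms(3) assms(1) assms(2) assms(4)] in auto)
qed

subsection \<open>Expected decrease in one step\<close>

text \<open>
  Expanding the square and averaging over both directions turns the mixed term into
  \<open>- 2\<gamma> norm v\<^sup>2\<close>.
\<close>

lemma nn_integral_step_le:
  fixes f :: "'a::euclidean_space \<Rightarrow> real"
  assumes [measurable]: "f \<in> borel_measurable borel"
    and fin: "(\<integral>\<^sup>+\<theta>. ennreal ((f \<theta>)\<^sup>2) \<partial>uniform_sphere) < \<infinity>" and \<gamma>: "0 \<le> \<gamma>"
  shows "(\<integral>\<^sup>+\<phi>. \<integral>\<^sup>+\<theta>. ennreal ((f \<theta> - \<gamma> * f \<phi> * (\<theta> \<bullet> \<phi>))\<^sup>2) \<partial>uniform_sphere \<partial>uniform_sphere)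
      + ennreal (2 * \<gamma>) * ennreal ((norm (\<integral>\<theta>. f \<theta> *\<^sub>R \<theta> \<partial>uniform_sphere))\<^sup>2)
    \<le> ennreal (1 + \<gamma>\<^sup>2) * (\<integral>\<^sup>+\<theta>. ennreal ((f \<theta>)\<^sup>2) \<partial>uniform_sphere)"
proof -
  interpret U: prob_space "uniform_sphere :: 'a measure" by (rule prob_space_uniform_sphere)
  note int = square_integrable_uniform_sphere[OF assms(1,2)]
  define v where "v = (\<integral>\<theta>. f \<theta> *\<^sub>R \<theta> \<partial>uniform_sphere)"
  define I where "I = (\<integral>\<theta>. (f \<theta>)\<^sup>2 \<partial>uniform_sphere)"
  \<comment> \<open>This is the inner integral with the mean of
    \<open>(\<theta> \<bullet> \<phi>)\<^sup>2\<close> replaced by its upper bound 1, so that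
    \<open>B\<close> averages to an expression in \<open>I\<close> and \<open>v\<close> only. The
    replacement produces the factor \<open>1 + \<gamma>\<^sup>2\<close>.\<close>
  define B where "B \<phi> = I - 2 * \<gamma> * (f \<phi> * (\<phi> \<bullet> v)) + \<gamma>\<^sup>2 * (f \<phi>)\<^sup>2" for \<phi>
  note inner = integrable_inner_uniform_sphere[OF int(1)]
  have le: "AE \<phi> in uniform_sphere. 0 \<le> B \<phi> \<and>
      (\<integral>\<^sup>+\<theta>. ennreal ((f \<theta> - \<gamma> * f \<phi> * (\<theta> \<bullet> \<phi>))\<^sup>2) \<partial>uniform_sphere) \<le> ennreal (B \<phi>)"
    using AE_uniform_sphere
  proof eventually_elim
    case (elim \<phi>)
    have sq: "(f \<theta> - \<gamma> * f \<phi> * (\<theta> \<bullet> \<phi>))\<^sup>2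
        = (f \<theta>)\<^sup>2 - 2 * \<gamma> * f \<phi> * (f \<theta> * (\<theta> \<bullet> \<phi>)) + \<gamma>\<^sup>2 * (f \<phi>)\<^sup>2 * (\<theta> \<bullet> \<phi>)\<^sup>2" for \<theta>
      by (simp add: power2_eq_square algebra_simps)
    have i1: "integrable uniform_sphere (\<lambda>\<theta>. 2 * \<gamma> * f \<phi> * (f \<theta> * (\<theta> \<bullet> \<phi>)))"
      by (intro integrable_mult_right inner)
    have i2: "integrable uniform_sphere (\<lambda>\<theta>. \<gamma>\<^sup>2 * (f \<phi>)\<^sup>2 * (\<theta> \<bullet> \<phi>)\<^sup>2)"
      by (intro integrable_mult_right integrable_uniform_sphere_inner_square)
    note i3 = Bochner_Integration.integrable_add[OF Bochner_Integration.integrable_diff[OF int(2) i1] i2]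
    have "(\<integral>\<theta>. (f \<theta> - \<gamma> * f \<phi> * (\<theta> \<bullet> \<phi>))\<^sup>2 \<partial>uniform_sphere)
      = I - 2 * \<gamma> * f \<phi> * (v \<bullet> \<phi>) + \<gamma>\<^sup>2 * (f \<phi>)\<^sup>2 * (\<integral>\<theta>. (\<theta> \<bullet> \<phi>)\<^sup>2 \<partial>uniform_sphere)"
      by (simp only: sq Bochner_Integration.integral_add[OF Bochner_Integration.integrable_diff[OF int(2) i1] i2]
          Bochner_Integration.integral_diff[OF int(2) i1] integral_mult_right_zero inner(2) I_def v_def)
    also have "\<dots> \<le> I - 2 * \<gamma> * f \<phi> * (v \<bullet> \<phi>) + \<gamma>\<^sup>2 * (f \<phi>)\<^sup>2 * 1"
    proof (intro add_left_mono mult_left_mono)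
      show "(\<integral>\<theta>. (\<theta> \<bullet> \<phi>)\<^sup>2 \<partial>uniform_sphere) \<le> 1"
        using integrable_uniform_sphere_inner_square(2)[of \<phi>] elim by simp
    qed simp
    also have "\<dots> = B \<phi>"
      by (simp add: B_def inner_commute[of v])
    finally have le: "(\<integral>\<theta>. (f \<theta> - \<gamma> * f \<phi> * (\<theta> \<bullet> \<phi>))\<^sup>2 \<partial>uniform_sphere) \<le> B \<phi>" .
    have "0 \<le> (\<integral>\<theta>. (f \<theta> - \<gamma> * f \<phi> * (\<theta> \<bullet> \<phi>))\<^sup>2 \<partial>uniform_sphere)"
      by (rule Bochner_Integration.integral_nonneg) (rule zero_le_power2)
    with le have "0 \<le> B \<phi>" by linarith
    moreover have "(\<integral>\<^sup>+\<theta>. ennreal ((f \<theta> - \<gamma> * f \<phi> * (\<theta> \<bullet> \<phi>))\<^sup>2) \<partial>uniform_sphere) \<le> ennreal (B \<phi>)"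
      using le i3[folded sq] by (subst nn_integral_eq_integral) (simp_all only: zero_le_power2 ennreal_leI eventually_True)
    ultimately show ?case ..
  qed
  have b1: "integrable uniform_sphere (\<lambda>\<phi>. 2 * \<gamma> * (f \<phi> * (\<phi> \<bullet> v)))"
    by (intro integrable_mult_right inner)
  have b2: "integrable uniform_sphere (\<lambda>\<phi>. \<gamma>\<^sup>2 * (f \<phi>)\<^sup>2)"
    by (intro integrable_mult_right int)
  have b0: "integrable uniform_sphere (\<lambda>\<phi>::'a. I)" by simp
  note b3 = Bochner_Integration.integrable_diff[OF b0 b1]
  have Bint: "integrable uniform_sphere B"
    unfolding B_def[abs_def] by (rule Bochner_Integration.integrable_add[OF b3 b2])
  have "(\<integral>\<phi>. B \<phi> \<partial>uniform_sphere) = I - 2 * \<gamma> * (v \<bullet> v) + \<gamma>\<^sup>2 * I"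
    unfolding B_def Bochner_Integration.integral_add[OF b3 b2] Bochner_Integration.integral_diff[OF b0 b1]
    by (simp only: integral_mult_right_zero inner(2) v_def[symmetric] I_def[symmetric] lebesgue_integral_const U.prob_space scaleR_one)
  then have BI: "(\<integral>\<phi>. B \<phi> \<partial>uniform_sphere) + 2 * \<gamma> * (norm v)\<^sup>2 = (1 + \<gamma>\<^sup>2) * I"
    unfolding power2_norm_eq_inner by (simp add: algebra_simps)
  have "(\<integral>\<^sup>+\<phi>. \<integral>\<^sup>+\<theta>. ennreal ((f \<theta> - \<gamma> * f \<phi> * (\<theta> \<bullet> \<phi>))\<^sup>2) \<partial>uniform_sphere \<partial>uniform_sphere)
      \<le> (\<integral>\<^sup>+\<phi>. ennreal (B \<phi>) \<partial>uniform_sphere)"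
    using le by (intro nn_integral_mono_AE) (auto elim: eventually_mono)
  also have "\<dots> = ennreal (\<integral>\<phi>. B \<phi> \<partial>uniform_sphere)"
    using le by (intro nn_integral_eq_integral Bint) (auto elim: eventually_mono)
  finally have "(\<integral>\<^sup>+\<phi>. \<integral>\<^sup>+\<theta>. ennreal ((f \<theta> - \<gamma> * f \<phi> * (\<theta> \<bullet> \<phi>))\<^sup>2) \<partial>uniform_sphere \<partial>uniform_sphere)
      + ennreal (2 * \<gamma>) * ennreal ((norm v)\<^sup>2) \<le> ennreal (\<integral>\<phi>. B \<phi> \<partial>uniform_sphere) + ennreal (2 * \<gamma>) * ennreal ((norm v)\<^sup>2)"
    by (rule add_right_mono)
  also have "\<dots> = ennreal ((\<integral>\<phi>. B \<phi> \<partial>uniform_sphere) + 2 * \<gamma> * (norm v)\<^sup>2)"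
  proof -
    have "0 \<le> (\<integral>\<phi>. B \<phi> \<partial>uniform_sphere)"
      using le by (intro integral_nonneg_AE) (auto elim: eventually_mono)
    then show ?thesis
      using \<gamma> by (simp add: ennreal_mult)
  qed
  also have "\<dots> = ennreal (1 + \<gamma>\<^sup>2) * ennreal I"
    unfolding BI by (rule ennreal_mult) (auto simp: I_def)
  also have "ennreal I = (\<integral>\<^sup>+\<theta>. ennreal ((f \<theta>)\<^sup>2) \<partial>uniform_sphere)"
    unfolding I_def by (rule nn_integral_eq_integral[symmetric, OF int(2)]) simp
  finally show ?thesis unfolding v_def .
qed

definition slice_step ::
    "'a::euclidean_space measure \<Rightarrow> real \<Rightarrow> 'a measure \<Rightarrow> 'a \<Rightarrow> 'a measure" where
  "slice_step \<mu> \<gamma> \<sigma> \<phi> = distr \<sigma> borel (\<lambda>x. (1 - \<gamma>) *\<^sub>R x + \<gamma> *\<^sub>R slice_map \<mu> \<sigma> \<phi> x)"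

lemma slice_step_displ: "slice_step \<mu> \<gamma> \<sigma> \<phi> = distr \<sigma> borel (\<lambda>x. x - (\<gamma> * displ \<mu> \<sigma> \<phi> x) *\<^sub>R \<phi>)"
  unfolding slice_step_def slice_map_displ by (simp add: algebra_simps)

lemma slice_iter_step:
  "slice_iter \<mu> \<sigma>\<^sub>0 \<gamma> \<theta> (Suc k) = slice_step \<mu> (\<gamma> k) (slice_iter \<mu> \<sigma>\<^sub>0 \<gamma> \<theta> k) (\<theta> k)"
  by (simp add: slice_step_def)

lemma slice_step_measurable:
  fixes \<mu> :: "'a::euclidean_space measure"
  assumes \<mu>: "\<mu> \<in> W2_space"
  shows "(\<lambda>w. slice_step \<mu> \<gamma> (fst w) (snd w)) \<in> subprob_algebra borel \<Otimes>\<^sub>M borel \<rightarrow>\<^sub>M subprob_algebra borel"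
  unfolding slice_step_displ
proof (rule measurable_distr2)
  have "(\<lambda>z. displ \<mu> (fst (fst z)) (snd (fst z)) (snd z)) \<in> borel_measurable ((subprob_algebra borel \<Otimes>\<^sub>M borel) \<Otimes>\<^sub>M borel)"
    by (intro borel_measurable_displ \<mu>) measurable
  then show "(\<lambda>(w, x). x - (\<gamma> * displ \<mu> (fst w) (snd w) x) *\<^sub>R snd w)
      \<in> borel_measurable ((subprob_algebra borel \<Otimes>\<^sub>M borel) \<Otimes>\<^sub>M borel)"
    unfolding split_beta' by measurable
qed measurable

text \<open>With the point \<open>x\<close> fixed first, the claim becomes
  \<open>nn_integral_step_le\<close> for the displacement as a function of the direction; finite
  energy makes that function square integrable for almost every \<open>x\<close>. The new measure is
  required to be in \<open>W2_ac\<close> because optimality is applied to it.\<close>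

lemma slice_step_energy_le:
  fixes \<mu> :: "'a::euclidean_space measure"
  assumes \<mu>: "\<mu> \<in> W2_space" and \<sigma>: "\<sigma> \<in> W2_ac" and \<gamma>: "0 \<le> \<gamma>"
    and step: "\<And>\<phi>. \<phi> \<in> sphere 0 1 \<Longrightarrow> slice_step \<mu> \<gamma> \<sigma> \<phi> \<in> W2_ac"
  shows "(\<integral>\<^sup>+\<phi>. slice_energy \<mu> (slice_step \<mu> \<gamma> \<sigma> \<phi>) \<partial>uniform_sphere) + ennreal (2 * \<gamma>) * grad_energy \<mu> \<sigma>
    \<le> ennreal (1 + \<gamma>\<^sup>2) * slice_energy \<mu> \<sigma>"
proof -
  note \<sigma>' = W2_acD[OF \<sigma>]
  interpret U: prob_space "uniform_sphere :: 'a measure" by (rule prob_space_uniform_sphere)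
  interpret S: prob_space \<sigma> by (rule prob_space_W2_space[OF \<sigma>'])
  interpret P: pair_sigma_finite \<sigma> "uniform_sphere :: 'a measure" ..
  note [measurable_cong] = sets_W2_space[OF \<sigma>']
  have sp: "space \<sigma> = UNIV"
    by (rule space_W2_space[OF \<sigma>'])
  define D where "D = displ \<mu> \<sigma>"
  have idm: "(\<lambda>w. w) \<in> borel_measurable \<sigma>" "(\<lambda>w. w) \<in> borel_measurable (uniform_sphere :: 'a measure)"
    by (simp_all add: measurable_ident_sets sets_W2_space[OF \<sigma>'])
  have f2: "fst \<in> borel_measurable (\<sigma> \<Otimes>\<^sub>M (uniform_sphere :: 'a measure))" "snd \<in> borel_measurable (\<sigma> \<Otimes>\<^sub>M (uniform_sphere :: 'a measure))"
    by (rule measurable_compose[OF measurable_fst idm(1)], rule measurable_compose[OF measurable_snd idm(2)])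
  have f3: "(\<lambda>w. fst (fst w)) \<in> borel_measurable ((\<sigma> \<Otimes>\<^sub>M (uniform_sphere :: 'a measure)) \<Otimes>\<^sub>M (uniform_sphere :: 'a measure))"
    "(\<lambda>w. snd (fst w)) \<in> borel_measurable ((\<sigma> \<Otimes>\<^sub>M (uniform_sphere :: 'a measure)) \<Otimes>\<^sub>M (uniform_sphere :: 'a measure))"
    "snd \<in> borel_measurable ((\<sigma> \<Otimes>\<^sub>M (uniform_sphere :: 'a measure)) \<Otimes>\<^sub>M (uniform_sphere :: 'a measure))"
    by (rule measurable_compose[OF measurable_fst f2(1)], rule measurable_compose[OF measurable_fst f2(2)],
        rule measurable_compose[OF measurable_snd idm(2)])
  note Dm = borel_measurable_displ_fixed[OF \<mu> \<sigma>', folded D_def]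
  have [measurable]: "(\<lambda>x. D \<theta> x) \<in> borel_measurable borel" "(\<lambda>\<theta>. D \<theta> x) \<in> borel_measurable borel" for \<theta> x
    by (intro Dm; measurable)+
  let ?Q = "\<lambda>\<phi> \<theta> x. ennreal ((D \<theta> x - \<gamma> * D \<phi> x * (\<theta> \<bullet> \<phi>))\<^sup>2)"
  have Q2: "(\<lambda>w. ?Q \<phi> (snd w) (fst w)) \<in> borel_measurable (\<sigma> \<Otimes>\<^sub>M uniform_sphere)" for \<phi>
    by (intro measurable_compose[OF _ measurable_ennreal] borel_measurable_power borel_measurable_diff borel_measurable_times
        borel_measurable_inner borel_measurable_const Dm f2)
  have Q3: "(\<lambda>w. ?Q (snd (fst w)) (snd w) (fst (fst w))) \<in> borel_measurable ((\<sigma> \<Otimes>\<^sub>M uniform_sphere) \<Otimes>\<^sub>M uniform_sphere)"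
    by (intro measurable_compose[OF _ measurable_ennreal] borel_measurable_power borel_measurable_diff borel_measurable_times
        borel_measurable_inner borel_measurable_const Dm f3)
  have Q3': "(\<lambda>w. \<integral>\<^sup>+\<theta>. ?Q (snd w) \<theta> (fst w) \<partial>uniform_sphere) \<in> borel_measurable (\<sigma> \<Otimes>\<^sub>M uniform_sphere)"
    using Q3 by (intro U.borel_measurable_nn_integral) (simp add: split_beta')
  have Q3'': "(\<lambda>x. \<integral>\<^sup>+\<phi>. \<integral>\<^sup>+\<theta>. ?Q \<phi> \<theta> x \<partial>uniform_sphere \<partial>uniform_sphere) \<in> borel_measurable \<sigma>"
    using Q3' by (intro U.borel_measurable_nn_integral) (simp add: split_beta')
  \<comment> \<open>The competitor lives on the old measure: the point moves, while its target stays
    the old transported value. The projection on \<theta> moves by \<gamma> times the displacement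
    along \<phi> times \<open>\<theta> \<bullet> \<phi>\<close>, which gives the residual in
    \<open>?Q\<close>.\<close>
  have opt: "(\<integral>\<^sup>+y. ennreal ((displ \<mu> (slice_step \<mu> \<gamma> \<sigma> \<phi>) \<theta> y)\<^sup>2) \<partial>slice_step \<mu> \<gamma> \<sigma> \<phi>) \<le> (\<integral>\<^sup>+x. ?Q \<phi> \<theta> x \<partial>\<sigma>)"
    if \<phi>: "\<phi> \<in> sphere 0 1" and \<theta>: "\<theta> \<in> sphere 0 1" for \<phi> \<theta>
  proof -
    have [measurable]: "(\<lambda>x. transport \<mu> \<sigma> \<theta> x) \<in> borel_measurable borel"
      by (intro borel_measurable_transport_fixed \<mu> \<sigma>) auto
    let ?A = "\<lambda>x. (x - (\<gamma> * D \<phi> x) *\<^sub>R \<phi>) \<bullet> \<theta>"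
    have "(\<integral>\<^sup>+y. ennreal ((displ \<mu> (slice_step \<mu> \<gamma> \<sigma> \<phi>) \<theta> y)\<^sup>2) \<partial>slice_step \<mu> \<gamma> \<sigma> \<phi>)
        \<le> (\<integral>\<^sup>+x. ennreal ((?A x - transport \<mu> \<sigma> \<theta> x)\<^sup>2) \<partial>\<sigma>)"
    proof (rule transport_optimal[OF step[OF \<phi>] \<theta> \<mu> S.prob_space_axioms])
      fix s
      have "cdf (slice \<theta> (slice_step \<mu> \<gamma> \<sigma> \<phi>)) s = measure (slice_step \<mu> \<gamma> \<sigma> \<phi>) {x. x \<bullet> \<theta> \<le> s}"
        by (rule cdf_slice[OF sets_W2_space[OF W2_acD[OF step[OF \<phi>]]]])
      also have "\<dots> = measure \<sigma> {x \<in> space \<sigma>. ?A x \<le> s}"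
        unfolding slice_step_displ D_def[symmetric]
        by (subst measure_distr) (auto simp: sp intro!: arg_cong[where f="measure \<sigma>"])
      finally show "measure \<sigma> {x \<in> space \<sigma>. ?A x \<le> s} = cdf (slice \<theta> (slice_step \<mu> \<gamma> \<sigma> \<phi>)) s" ..
      show "measure \<sigma> {x \<in> space \<sigma>. transport \<mu> \<sigma> \<theta> x \<le> s} = cdf (slice \<theta> \<mu>) s"
        using measure_transport_le[OF \<sigma> \<theta> \<mu>] by (simp add: sp)
    qed measurable
    also have "\<dots> = (\<integral>\<^sup>+x. ?Q \<phi> \<theta> x \<partial>\<sigma>)"
      by (intro nn_integral_cong arg_cong[where f=ennreal] arg_cong[where f="\<lambda>x. x\<^sup>2"])
        (simp add: D_def displ_def inner_diff_left inner_commute algebra_simps)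
    finally show ?thesis .
  qed
  have "(\<integral>\<^sup>+\<phi>. slice_energy \<mu> (slice_step \<mu> \<gamma> \<sigma> \<phi>) \<partial>uniform_sphere)
      \<le> (\<integral>\<^sup>+\<phi>. \<integral>\<^sup>+\<theta>. \<integral>\<^sup>+x. ?Q \<phi> \<theta> x \<partial>\<sigma> \<partial>uniform_sphere \<partial>uniform_sphere)"
  proof (rule nn_integral_mono_AE)
    show "AE \<phi> in uniform_sphere. slice_energy \<mu> (slice_step \<mu> \<gamma> \<sigma> \<phi>)
        \<le> (\<integral>\<^sup>+\<theta>. \<integral>\<^sup>+x. ?Q \<phi> \<theta> x \<partial>\<sigma> \<partial>uniform_sphere)"
      using AE_uniform_sphere
    proof eventually_elim
      case (elim \<phi>)
      show ?case
        unfolding slice_energy_def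
        by (intro nn_integral_mono_AE eventually_mono[OF AE_uniform_sphere] opt elim)
    qed
  qed
  also have "\<dots> = (\<integral>\<^sup>+\<phi>. \<integral>\<^sup>+x. \<integral>\<^sup>+\<theta>. ?Q \<phi> \<theta> x \<partial>uniform_sphere \<partial>\<sigma> \<partial>uniform_sphere)"
    using Q2 by (intro nn_integral_cong P.Fubini') (simp add: split_beta')
  also have "\<dots> = (\<integral>\<^sup>+x. \<integral>\<^sup>+\<phi>. \<integral>\<^sup>+\<theta>. ?Q \<phi> \<theta> x \<partial>uniform_sphere \<partial>uniform_sphere \<partial>\<sigma>)"
    using Q3' by (intro P.Fubini') (simp add: split_beta')
  finally have "(\<integral>\<^sup>+\<phi>. slice_energy \<mu> (slice_step \<mu> \<gamma> \<sigma> \<phi>) \<partial>uniform_sphere) + ennreal (2 * \<gamma>) * grad_energy \<mu> \<sigma>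
    \<le> (\<integral>\<^sup>+x. \<integral>\<^sup>+\<phi>. \<integral>\<^sup>+\<theta>. ?Q \<phi> \<theta> x \<partial>uniform_sphere \<partial>uniform_sphere \<partial>\<sigma>) + ennreal (2 * \<gamma>) * grad_energy \<mu> \<sigma>"
    by (rule add_right_mono)
  also have "\<dots> = (\<integral>\<^sup>+x. (\<integral>\<^sup>+\<phi>. \<integral>\<^sup>+\<theta>. ?Q \<phi> \<theta> x \<partial>uniform_sphere \<partial>uniform_sphere)
      + ennreal (2 * \<gamma>) * ennreal ((norm (H_deriv \<mu> \<sigma> x))\<^sup>2) \<partial>\<sigma>)"
  proof -
    have [measurable]: "(\<lambda>x. H_deriv \<mu> \<sigma> x) \<in> borel_measurable \<sigma>"
      using W2_space_in_subprob[OF \<sigma>'] idm(1) by (intro borel_measurable_H_deriv \<mu>) auto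
    show ?thesis
      unfolding grad_energy_def by (subst nn_integral_cmult[symmetric], simp, subst nn_integral_add) (use Q3'' in simp_all)
  qed
  also have "\<dots> \<le> (\<integral>\<^sup>+x. ennreal (1 + \<gamma>\<^sup>2) * (\<integral>\<^sup>+\<theta>. ennreal ((D \<theta> x)\<^sup>2) \<partial>uniform_sphere) \<partial>\<sigma>)"
  proof (rule nn_integral_mono_AE)
    have m: "(\<lambda>x. \<integral>\<^sup>+\<theta>. ennreal ((D \<theta> x)\<^sup>2) \<partial>uniform_sphere) \<in> borel_measurable \<sigma>"
    proof (rule U.borel_measurable_nn_integral)
      show "(\<lambda>(x, \<theta>). ennreal ((D \<theta> x)\<^sup>2)) \<in> borel_measurable (\<sigma> \<Otimes>\<^sub>M uniform_sphere)"
        unfolding split_beta' by (intro measurable_compose[OF _ measurable_ennreal] borel_measurable_power Dm f2)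
    qed
    have "(\<integral>\<^sup>+x. \<integral>\<^sup>+\<theta>. ennreal ((D \<theta> x)\<^sup>2) \<partial>uniform_sphere \<partial>\<sigma>) \<noteq> \<infinity>"
      using slice_energy_finite[OF \<mu> \<sigma>] unfolding slice_energy_swap[OF \<mu> \<sigma>'] D_def by simp
    from nn_integral_PInf_AE[OF m this]
    show "AE x in \<sigma>. (\<integral>\<^sup>+\<phi>. \<integral>\<^sup>+\<theta>. ?Q \<phi> \<theta> x \<partial>uniform_sphere \<partial>uniform_sphere)
      + ennreal (2 * \<gamma>) * ennreal ((norm (H_deriv \<mu> \<sigma> x))\<^sup>2)
      \<le> ennreal (1 + \<gamma>\<^sup>2) * (\<integral>\<^sup>+\<theta>. ennreal ((D \<theta> x)\<^sup>2) \<partial>uniform_sphere)"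
    proof eventually_elim
      case (elim x)
      then show ?case
        unfolding H_deriv_displ D_def[symmetric] by (intro nn_integral_step_le \<gamma>) (auto simp: less_top)
    qed
  qed
  also have "\<dots> = ennreal (1 + \<gamma>\<^sup>2) * slice_energy \<mu> \<sigma>"
  proof -
    have "(\<lambda>x. \<integral>\<^sup>+\<theta>. ennreal ((D \<theta> x)\<^sup>2) \<partial>uniform_sphere) \<in> borel_measurable \<sigma>"
    proof (rule U.borel_measurable_nn_integral)
      show "(\<lambda>(x, \<theta>). ennreal ((D \<theta> x)\<^sup>2)) \<in> borel_measurable (\<sigma> \<Otimes>\<^sub>M uniform_sphere)"
        unfolding split_beta' by (intro measurable_compose[OF _ measurable_ennreal] borel_measurable_power Dm f2)
    qed
    then show ?thesis
      unfolding slice_energy_swap[OF \<mu> \<sigma>'] D_def by (rule nn_integral_cmult)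
  qed
  finally show ?thesis .
qed

subsection \<open>Nonnegative almost supermartingales\<close>

text \<open>
  Phase 0: \<open>y\<close> has not yet been \<open>\<le> e\<close>; phase 1: it has, and has been \<open>< l\<close> since; phase 2: it has
  later been \<open>\<ge> l\<close>.
\<close>

primrec phase :: "'a::linorder \<Rightarrow> 'a \<Rightarrow> (nat \<Rightarrow> 'a) \<Rightarrow> nat \<Rightarrow> nat" where
  "phase e l y 0 = (if y 0 \<le> e then 1 else 0)"
| "phase e l y (Suc k) =
     (if phase e l y k = 0 then (if y (Suc k) \<le> e then 1 else 0)
      else if phase e l y k = 1 then (if y (Suc k) < l then 1 else 2) else 2)"

lemma phase_le_2: "phase e l y k \<le> 2"
  by (cases k) auto

lemma phase_2_Suc: "phase e l y k = 2 \<Longrightarrow> phase e l y (Suc k) = 2"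
  by simp

lemma phase_not_0:
  assumes "y k \<le> e" shows "phase e l y (k + n) \<noteq> 0"
proof (induction n)
  case 0
  then show ?case using assms by (cases k) auto
qed auto

text \<open>Once the small value has been seen, phase 0 is over for good; if phase 2 never occurs,
  phase 1 lasts forever, and it records \<open>y n < l\<close> at each later time.\<close>

lemma phase_eventually_less:
  assumes k: "y k \<le> e" and no2: "\<And>n. phase e l y n \<noteq> 2"
  shows "eventually (\<lambda>n. y n < l) sequentially"
proof -
  have "y n < l" if "Suc k \<le> n" for n
  proof -
    define m where "m = n - Suc k"
    have m: "n = Suc (k + m)"
      using that by (simp add: m_def)
    have "phase e l y (k + m) = 1"
      using phase_not_0[where y=y and k=k and e=e and l=l and n=m, OF k] no2[of "k + m"] phase_le_2[of e l y "k + m"] by linarith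
    then have "phase e l y (Suc (k + m)) = (if y (Suc (k + m)) < l then 1 else 2)"
      unfolding phase.simps by (simp only: one_neq_zero if_False if_True refl)
    then show ?thesis
      using no2[of "Suc (k + m)"] unfolding m by (cases "y (Suc (k + m)) < l") (simp_all only: if_True if_False simp_thms)
  qed
  then show ?thesis
    by (auto simp: eventually_sequentially)
qed

text \<open>
  The process equal to \<open>e\<close>, \<open>Y\<close>, \<open>l\<close> in the phases 0, 1, 2 starts below \<open>e\<close> and has decreasing mean.
\<close>

lemma supermartingale_phase_bound:
  fixes Y :: "nat \<Rightarrow> 'w \<Rightarrow> ennreal" and F :: "nat \<Rightarrow> 'w measure"
  assumes P: "prob_space P" and sub: "\<And>k. subalgebra P (F k)" and mono: "\<And>k. sets (F k) \<subseteq> sets (F (Suc k))"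
    and Y: "\<And>k. Y k \<in> borel_measurable (F k)"
    and super: "\<And>k A. A \<in> sets (F k) \<Longrightarrow>
       (\<integral>\<^sup>+\<omega>. Y (Suc k) \<omega> * indicator A \<omega> \<partial>P) \<le> (\<integral>\<^sup>+\<omega>. Y k \<omega> * indicator A \<omega> \<partial>P)"
  shows "{\<omega> \<in> space P. phase e l (\<lambda>k. Y k \<omega>) k = n} \<in> sets (F k)"
    and "l * emeasure P {\<omega> \<in> space P. phase e l (\<lambda>k. Y k \<omega>) k = 2} \<le> e"
proof -
  interpret prob_space P by fact
  have sp: "space (F k) = space P" for k using sub by (auto simp: subalgebra_def)
  let ?S = "\<lambda>k n. {\<omega> \<in> space P. phase e l (\<lambda>k. Y k \<omega>) k = n}"
  have M: "(\<lambda>\<omega>. phase e l (\<lambda>k. Y k \<omega>) k) \<in> F k \<rightarrow>\<^sub>M count_space UNIV" for k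
  proof (induction k)
    case 0
    have [measurable]: "Y 0 \<in> borel_measurable (F 0)" by (rule Y)
    show ?case
      unfolding phase.simps by (intro measurable_If) measurable
  next
    case (Suc k)
    have Yk: "Y (Suc k) \<in> borel_measurable (F (Suc k))" by (rule Y)
    have "subalgebra (F (Suc k)) (F k)"
      using sp mono[of k] by (simp add: subalgebra_def)
    from measurable_from_subalg[OF this Suc]
    have ph: "(\<lambda>\<omega>. phase e l (\<lambda>k. Y k \<omega>) k) \<in> F (Suc k) \<rightarrow>\<^sub>M count_space UNIV" .
    have "{\<omega> \<in> space (F (Suc k)). phase e l (\<lambda>k. Y k \<omega>) k = m} \<in> sets (F (Suc k))" for m
      using measurable_sets[OF ph, of "{m}"] by (simp add: vimage_def Int_def conj_commute)
    moreover have "{\<omega> \<in> space (F (Suc k)). Y (Suc k) \<omega> \<le> e} \<in> sets (F (Suc k))"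
      "{\<omega> \<in> space (F (Suc k)). Y (Suc k) \<omega> < l} \<in> sets (F (Suc k))"
      using Yk by measurable
    ultimately show ?case
      unfolding phase.simps by (intro measurable_If measurable_const) simp_all
  qed
  have S: "?S k n \<in> sets (F k)" for k n
    using measurable_sets[OF M[of k], of "{n}"] by (simp add: vimage_def Int_def conj_commute sp)
  then show "?S k n \<in> sets (F k)" .
  have [measurable]: "Y k \<in> borel_measurable P" for k
    using Y sub by (rule measurable_from_subalg[rotated])
  have [measurable]: "?S k n \<in> sets P" for k n
    using S[of k n] sub[of k] by (auto simp: subalgebra_def)
  define Z where "Z k \<omega> = e * indicator (?S k 0) \<omega> + Y k \<omega> * indicator (?S k 1) \<omega> + l * indicator (?S k 2) \<omega>" for k \<omega>
  have Z_int: "(\<integral>\<^sup>+\<omega>. e * indicator (?S k 0) \<omega> + X \<omega> * indicator (?S k 1) \<omega> + l * indicator (?S k 2) \<omega> \<partial>P)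
     = e * emeasure P (?S k 0) + (\<integral>\<^sup>+\<omega>. X \<omega> * indicator (?S k 1) \<omega> \<partial>P) + l * emeasure P (?S k 2)"
    if [measurable]: "X \<in> borel_measurable P" for X k
    by (simp add: nn_integral_add nn_integral_cmult)
  have Z_le: "(\<integral>\<^sup>+\<omega>. Z k \<omega> \<partial>P) \<le> e" for k
  proof (induction k)
    case 0
    have "(\<integral>\<^sup>+\<omega>. Z 0 \<omega> \<partial>P) \<le> (\<integral>\<^sup>+\<omega>. e \<partial>P)"
      by (intro nn_integral_mono) (auto simp: Z_def indicator_def)
    then show ?case by (simp add: emeasure_space_1)
  next
    case (Suc k)
    \<comment> \<open>A change of phase never raises the process: from 0 to 1 the constant
      \<open>e\<close> gives way to a value at most \<open>e\<close>, and from 1 to 2 a value at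
      least \<open>l\<close> gives way to \<open>l\<close>. Only in phase 1 does the process follow
      \<open>Y\<close>.\<close>
    have "(\<integral>\<^sup>+\<omega>. Z (Suc k) \<omega> \<partial>P)
        \<le> (\<integral>\<^sup>+\<omega>. e * indicator (?S k 0) \<omega> + Y (Suc k) \<omega> * indicator (?S k 1) \<omega> + l * indicator (?S k 2) \<omega> \<partial>P)"
    proof (intro nn_integral_mono)
      fix \<omega> assume \<omega>: "\<omega> \<in> space P"
      let ?p = "phase e l (\<lambda>k. Y k \<omega>)"
      consider "?p k = 0" | "?p k = 1" | "?p k = 2"
        using phase_le_2[of e l "\<lambda>k. Y k \<omega>" k] by linarith
      then show "Z (Suc k) \<omega>
          \<le> e * indicator (?S k 0) \<omega> + Y (Suc k) \<omega> * indicator (?S k 1) \<omega> + l * indicator (?S k 2) \<omega>"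
      proof cases
        case 1
        then have "?p (Suc k) = (if Y (Suc k) \<omega> \<le> e then 1 else 0)" by simp
        then show ?thesis
          using 1 \<omega> by (cases "Y (Suc k) \<omega> \<le> e") (simp_all add: Z_def indicator_def del: phase.simps)
      next
        case 2
        then have "?p (Suc k) = (if Y (Suc k) \<omega> < l then 1 else 2)" by simp
        then show ?thesis
          using 2 \<omega> by (cases "Y (Suc k) \<omega> < l") (simp_all add: Z_def indicator_def not_less del: phase.simps)
      next
        case 3
        then have "?p (Suc k) = 2" by simp
        then show ?thesis
          using 3 \<omega> by (simp add: Z_def indicator_def del: phase.simps)
      qed
    qed
    also have "\<dots> = e * emeasure P (?S k 0) + (\<integral>\<^sup>+\<omega>. Y (Suc k) \<omega> * indicator (?S k 1) \<omega> \<partial>P) + l * emeasure P (?S k 2)"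
      by (rule Z_int) measurable
    \<comment> \<open>Being in phase 1 at time \<open>k\<close> is an event of \<open>F k\<close>,
      so the supermartingale inequality may be applied on it.\<close>
    also have "\<dots> \<le> e * emeasure P (?S k 0) + (\<integral>\<^sup>+\<omega>. Y k \<omega> * indicator (?S k 1) \<omega> \<partial>P) + l * emeasure P (?S k 2)"
      by (intro add_right_mono add_left_mono super S)
    also have "\<dots> = (\<integral>\<^sup>+\<omega>. Z k \<omega> \<partial>P)"
      unfolding Z_def by (rule Z_int[symmetric]) measurable
    also have "\<dots> \<le> e" by (rule Suc)
    finally show ?case .
  qed
  have "l * emeasure P (?S k 2) = (\<integral>\<^sup>+\<omega>. l * indicator (?S k 2) \<omega> \<partial>P)"
    by (rule nn_integral_cmult_indicator[symmetric]) measurable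
  also have "\<dots> \<le> (\<integral>\<^sup>+\<omega>. Z k \<omega> \<partial>P)"
    by (intro nn_integral_mono) (auto simp: Z_def)
  also have "\<dots> \<le> e" by (rule Z_le)
  finally show "l * emeasure P (?S k 2) \<le> e" .
qed

text \<open>After a value at most \<open>l * e\<close>, a nonnegative supermartingale reaches
  \<open>l\<close> again with probability at most \<open>e\<close>. Arbitrarily small values occur
  almost surely, so a failure to stay below \<open>l\<close> entails such a return for every
  \<open>e\<close> and has probability 0. The property is phrased with integrals over events of the
  past, which makes sense for infinite values as well.\<close>

lemma nonneg_supermartingale_tendsto_0:
  fixes Y :: "nat \<Rightarrow> 'w \<Rightarrow> ennreal" and F :: "nat \<Rightarrow> 'w measure"
  assumes P: "prob_space P" and sub: "\<And>k. subalgebra P (F k)" and mono: "\<And>k. sets (F k) \<subseteq> sets (F (Suc k))"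
    and Y: "\<And>k. Y k \<in> borel_measurable (F k)"
    and super: "\<And>k A. A \<in> sets (F k) \<Longrightarrow>
       (\<integral>\<^sup>+\<omega>. Y (Suc k) \<omega> * indicator A \<omega> \<partial>P) \<le> (\<integral>\<^sup>+\<omega>. Y k \<omega> * indicator A \<omega> \<partial>P)"
    and small: "AE \<omega> in P. \<forall>e>0. \<exists>k. Y k \<omega> \<le> ennreal e"
  shows "AE \<omega> in P. (\<lambda>k. Y k \<omega>) \<longlonglongrightarrow> 0"
proof -
  interpret prob_space P by fact
  have [measurable]: "Y k \<in> borel_measurable P" for k
    using Y sub by (rule measurable_from_subalg[rotated])
  have ev: "AE \<omega> in P. eventually (\<lambda>k. Y k \<omega> < ennreal l) sequentially" if l: "0 < l" for l
  proof -
    let ?S = "\<lambda>e k. {\<omega> \<in> space P. phase (ennreal e) (ennreal l) (\<lambda>k. Y k \<omega>) k = 2}"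
    let ?B = "{\<omega> \<in> space P. \<not> eventually (\<lambda>k. Y k \<omega> < ennreal l) sequentially}"
    have B [measurable]: "?B \<in> sets P"
      unfolding eventually_sequentially by measurable
    have "emeasure P ?B \<le> ennreal e" if e: "0 < e" for e
    proof -
      note bound = supermartingale_phase_bound[where F=F and Y=Y, OF P sub mono Y super]
      have S [measurable]: "?S (l * e) k \<in> sets P" for k
        using bound(1) sub unfolding subalgebra_def by blast
      have le: "emeasure P (?S (l * e) k) \<le> ennreal e" for k
      proof -
        \<comment> \<open>The lower threshold was set to \<open>l * e\<close> so that cancelling
          \<open>l\<close> in the phase bound leaves exactly \<open>e\<close>.\<close>
        have "ennreal l * emeasure P (?S (l * e) k) \<le> ennreal (l * e)"
          by (rule bound(2))
        also have "\<dots> = ennreal l * ennreal e"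
          using l e by (simp add: ennreal_mult)
        finally show ?thesis
          using l by (subst (asm) ennreal_mult_le_mult_iff) auto
      qed
      have "AE \<omega> in P. \<omega> \<in> ?B \<longrightarrow> \<omega> \<in> (\<Union>k. ?S (l * e) k)"
        using small AE_space
      proof eventually_elim
        case (elim \<omega>)
        obtain k where k: "Y k \<omega> \<le> ennreal (l * e)"
          using elim(1)[rule_format, OF mult_pos_pos[OF l e]] ..
        show ?case
        proof (rule impI, rule ccontr)
          assume B: "\<omega> \<in> ?B" and n2: "\<omega> \<notin> (\<Union>k. ?S (l * e) k)"
          have "phase (ennreal (l * e)) (ennreal l) (\<lambda>k. Y k \<omega>) n \<noteq> 2" for n
          proof
            assume "phase (ennreal (l * e)) (ennreal l) (\<lambda>k. Y k \<omega>) n = 2"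
            with elim(2) have "\<omega> \<in> ?S (l * e) n" by (intro CollectI conjI)
            then have "\<omega> \<in> (\<Union>k. ?S (l * e) k)" by (rule UN_I[OF UNIV_I])
            with n2 show False by (rule notE)
          qed
          from phase_eventually_less[where y="\<lambda>k. Y k \<omega>" and k=k, OF k this] B show False by (simp only: mem_Collect_eq simp_thms)
        qed
      qed
      then have "emeasure P ?B \<le> emeasure P (\<Union>k. ?S (l * e) k)"
      proof (rule emeasure_mono_AE)
        show "(\<Union>k. ?S (l * e) k) \<in> sets P"
          by (rule sets.countable_UN) (unfold image_subset_iff, intro ballI S)
      qed
      also have "\<dots> = (SUP k. emeasure P (?S (l * e) k))"
      proof (rule SUP_emeasure_incseq[symmetric])
        show "incseq (?S (l * e))"
          by (rule incseq_SucI, rule Collect_mono, intro impI conjI, erule conjunct1, rule phase_2_Suc, erule conjunct2)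
        show "range (?S (l * e)) \<subseteq> sets P" unfolding image_subset_iff by (intro ballI S)
      qed
      also have "\<dots> \<le> ennreal e"
        by (rule SUP_least) (rule le)
      finally show ?thesis .
    qed
    then have "emeasure P ?B \<le> 0"
      by - (rule ennreal_le_epsilon, simp only: add_0)
    then have "?B \<in> null_sets P"
      using B by (simp add: null_sets_def)
    then show ?thesis
      by (rule AE_I') auto
  qed
  have "AE \<omega> in P. \<forall>n. eventually (\<lambda>k. Y k \<omega> < ennreal (1 / Suc n)) sequentially"
    unfolding AE_all_countable by (intro allI ev) simp
  then show ?thesis
  proof eventually_elim
    case (elim \<omega>)
    show ?case
    proof (rule order_tendstoI)
      fix a :: ennreal assume "0 < a"
      obtain r where r: "0 < r" "ennreal r < a"
      proof (cases a)
        case (real x)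
        with \<open>0 < a\<close> show ?thesis
          by (intro that[of "x / 2"]) (auto simp: ennreal_less_iff)
      next
        case top
        then show ?thesis
          by (intro that[of 1]) (auto simp: ennreal_one_less_top)
      qed
      then obtain n where "1 / Suc n < r"
        using reals_Archimedean[of r] by (auto simp: inverse_eq_divide)
      then have n: "ennreal (1 / Suc n) < a"
        using le_less_trans[OF ennreal_leI[OF less_imp_le] r(2)] by blast
      show "eventually (\<lambda>k. Y k \<omega> < a) sequentially"
        using elim[rule_format, of n] by eventually_elim (use n in auto)
    qed simp
  qed
qed

text \<open>Were all terms from \<open>N\<close> on at least \<delta>, the tail of the divergent sum
  would be at most \<open>1 / \<delta>\<close> times the finite weighted sum. The freedom in
  \<open>N\<close> lets the small term be found after any given time.\<close>

lemma suminf_weighted_eq_infinity_imp_small: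
  fixes \<gamma> :: "nat \<Rightarrow> real" and j :: "nat \<Rightarrow> ennreal"
  assumes \<gamma>: "\<And>k. 0 \<le> \<gamma> k" and inf: "(\<Sum>k. ennreal (\<gamma> k)) = \<infinity>"
    and fin: "(\<Sum>k. ennreal (\<gamma> k) * j k) < \<infinity>" and \<delta>: "0 < \<delta>"
  shows "\<exists>k\<ge>N. j k < ennreal \<delta>"
proof (rule ccontr)
  assume "\<not> ?thesis"
  then have j: "ennreal \<delta> \<le> j k" if "N \<le> k" for k
    using that by (meson not_less)
  let ?a = "\<lambda>k. if k < N then ennreal (\<gamma> k) else 0"
  let ?b = "\<lambda>k. ennreal (1 / \<delta>) * (ennreal (\<gamma> k) * j k)"
  have "ennreal (\<gamma> k) \<le> ?a k + ?b k" for k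
  proof (cases "k < N")
    case False
    have "ennreal (\<gamma> k) = ennreal (1 / \<delta>) * (ennreal (\<gamma> k) * ennreal \<delta>)"
      using \<delta> \<gamma>[of k] by (simp add: ennreal_mult[symmetric])
    also have "\<dots> \<le> ?b k"
      using False j[of k] by (intro mult_left_mono) auto
    finally show ?thesis using False by simp
  qed simp
  then have "(\<Sum>k. ennreal (\<gamma> k)) \<le> (\<Sum>k. ?a k + ?b k)"
    by (intro suminf_le summableI)
  also have "\<dots> = (\<Sum>k. ?a k) + (\<Sum>k. ?b k)"
    by (intro suminf_add[symmetric] summableI)
  also have "(\<Sum>k. ?a k) = (\<Sum>k<N. ennreal (\<gamma> k))"
    by (subst suminf_finite[of "{..<N}"]) auto
  also have "(\<Sum>k. ?b k) = ennreal (1 / \<delta>) * (\<Sum>k. ennreal (\<gamma> k) * j k)"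
    by (rule ennreal_suminf_cmult)
  also have "(\<Sum>k<N. ennreal (\<gamma> k)) + ennreal (1 / \<delta>) * (\<Sum>k. ennreal (\<gamma> k) * j k) < \<infinity>"
    using fin by (simp add: ennreal_mult_less_top ennreal_add_less_top sum_ennreal \<gamma>)
  finally show False using inf by simp
qed

text \<open>The almost-supermartingale argument of Robbins and Siegmund. The step inequality is used
  twice: summed in the mean it makes the weighted sum of \<open>j\<close> finite, hence
  \<open>j\<close> small at late times; with \<open>j\<close> dropped it makes \<open>h\<close> plus
  the remaining error a supermartingale. \<open>small\<close> links the two and omits index 0, about
  which it would not be available for the initial measure.\<close>

lemma descent_tendsto_0:
  fixes h j :: "nat \<Rightarrow> 'w \<Rightarrow> ennreal" and F :: "nat \<Rightarrow> 'w measure" and \<gamma> :: "nat \<Rightarrow> real"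
  assumes P: "prob_space P" and sub: "\<And>k. subalgebra P (F k)" and mono: "\<And>k. sets (F k) \<subseteq> sets (F (Suc k))"
    and h: "\<And>k. h k \<in> borel_measurable (F k)" and j: "\<And>k. j k \<in> borel_measurable (F k)"
    and \<gamma>: "\<And>k. 0 \<le> \<gamma> k" "(\<Sum>k. ennreal (\<gamma> k)) = \<infinity>" "(\<Sum>k. ennreal ((\<gamma> k)\<^sup>2)) < \<infinity>"
    and C: "0 \<le> C"
    and step: "\<And>k A. A \<in> sets (F k) \<Longrightarrow>
       (\<integral>\<^sup>+\<omega>. h (Suc k) \<omega> * indicator A \<omega> \<partial>P) + ennreal (\<gamma> k) * (\<integral>\<^sup>+\<omega>. j k \<omega> * indicator A \<omega> \<partial>P)
       \<le> (\<integral>\<^sup>+\<omega>. (h k \<omega> + ennreal ((\<gamma> k)\<^sup>2 * C)) * indicator A \<omega> \<partial>P)"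
    and h0: "(\<integral>\<^sup>+\<omega>. h 0 \<omega> \<partial>P) < \<infinity>"
    and small: "AE \<omega> in P. \<forall>e>0. \<exists>d>0. \<forall>k\<ge>1. j k \<omega> < ennreal d \<longrightarrow> h k \<omega> \<le> ennreal e"
  shows "AE \<omega> in P. (\<lambda>k. h k \<omega>) \<longlonglongrightarrow> 0"
proof -
  interpret prob_space P by fact
  have hP [measurable]: "h k \<in> borel_measurable P" and jP [measurable]: "j k \<in> borel_measurable P" for k
    using h j sub by (auto intro: measurable_from_subalg)
  have sm: "summable (\<lambda>k. (\<gamma> k)\<^sup>2)"
    using \<gamma>(3) by (intro summable_suminf_not_top) auto
  \<comment> \<open>All error still to come from time \<open>k\<close> on. Adding it to
    \<open>h\<close> absorbs the error of each step, since passing to the next time releases exactly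
    the error of that step.\<close>
  define t where "t k = C * (\<Sum>i. (\<gamma> (i + k))\<^sup>2)" for k
  have t0: "0 \<le> t k" for k
    unfolding t_def using sm C by (intro mult_nonneg_nonneg suminf_nonneg) (auto intro: summable_ignore_initial_segment[OF sm])
  have t_Suc: "t k = (\<gamma> k)\<^sup>2 * C + t (Suc k)" for k
  proof -
    have "(\<Sum>i. (\<gamma> (i + k))\<^sup>2) = (\<gamma> k)\<^sup>2 + (\<Sum>i. (\<gamma> (i + Suc k))\<^sup>2)"
      using suminf_split_head[OF summable_ignore_initial_segment[OF sm, of k]] by simp
    then show ?thesis
      unfolding t_def by (simp only: distrib_left mult.commute)
  qed
  have t_lim: "t \<longlonglongrightarrow> 0"
    unfolding t_def[abs_def] using tendsto_mult_left[OF suminf_exist_split2[OF sm], of C] by simp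
  have sumj: "AE \<omega> in P. (\<Sum>k. ennreal (\<gamma> k) * j k \<omega>) \<noteq> \<infinity>"
  proof (rule nn_integral_PInf_AE)
    \<comment> \<open>The step inequality on the whole space, summed up to \<open>n\<close> with the
      remaining error carried along; the right-hand side does not depend on
      \<open>n\<close>.\<close>
    have ind: "(\<integral>\<^sup>+\<omega>. h n \<omega> \<partial>P) + (\<Sum>k<n. ennreal (\<gamma> k) * (\<integral>\<^sup>+\<omega>. j k \<omega> \<partial>P)) + ennreal (t n) \<le> (\<integral>\<^sup>+\<omega>. h 0 \<omega> \<partial>P) + ennreal (t 0)" for n
    proof (induction n)
      case (Suc n)
      have spF: "space P \<in> sets (F n)"
        using sub[of n] sets.top[of "F n"] by (simp add: subalgebra_def)
      have ind: "(\<integral>\<^sup>+\<omega>. f \<omega> * indicator (space P) \<omega> \<partial>P) = (\<integral>\<^sup>+\<omega>. f \<omega> \<partial>P)" for f :: "'w \<Rightarrow> ennreal"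
        by (intro nn_integral_cong) simp
      have s: "(\<integral>\<^sup>+\<omega>. h (Suc n) \<omega> \<partial>P) + ennreal (\<gamma> n) * (\<integral>\<^sup>+\<omega>. j n \<omega> \<partial>P) \<le> (\<integral>\<^sup>+\<omega>. h n \<omega> \<partial>P) + ennreal ((\<gamma> n)\<^sup>2 * C)"
        using step[OF spF] unfolding ind by (subst (asm) nn_integral_add) (simp_all add: emeasure_space_1)
      have "(\<integral>\<^sup>+\<omega>. h (Suc n) \<omega> \<partial>P) + (\<Sum>k<Suc n. ennreal (\<gamma> k) * (\<integral>\<^sup>+\<omega>. j k \<omega> \<partial>P)) + ennreal (t (Suc n))
        = ((\<integral>\<^sup>+\<omega>. h (Suc n) \<omega> \<partial>P) + ennreal (\<gamma> n) * (\<integral>\<^sup>+\<omega>. j n \<omega> \<partial>P)) + ((\<Sum>k<n. ennreal (\<gamma> k) * (\<integral>\<^sup>+\<omega>. j k \<omega> \<partial>P)) + ennreal (t (Suc n)))"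
        by (simp add: ac_simps)
      also have "\<dots> \<le> ((\<integral>\<^sup>+\<omega>. h n \<omega> \<partial>P) + ennreal ((\<gamma> n)\<^sup>2 * C)) + ((\<Sum>k<n. ennreal (\<gamma> k) * (\<integral>\<^sup>+\<omega>. j k \<omega> \<partial>P)) + ennreal (t (Suc n)))"
        by (intro add_right_mono s)
      also have "\<dots> = (\<integral>\<^sup>+\<omega>. h n \<omega> \<partial>P) + (\<Sum>k<n. ennreal (\<gamma> k) * (\<integral>\<^sup>+\<omega>. j k \<omega> \<partial>P)) + (ennreal ((\<gamma> n)\<^sup>2 * C) + ennreal (t (Suc n)))"
        by (simp add: ac_simps)
      also have "ennreal ((\<gamma> n)\<^sup>2 * C) + ennreal (t (Suc n)) = ennreal (t n)"
        unfolding t_Suc[of n] using C t0 by (intro ennreal_plus[symmetric]) auto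
      finally show ?case using Suc by (rule order_trans)
    qed simp
    have "(\<integral>\<^sup>+\<omega>. (\<Sum>k. ennreal (\<gamma> k) * j k \<omega>) \<partial>P) = (\<Sum>k. ennreal (\<gamma> k) * (\<integral>\<^sup>+\<omega>. j k \<omega> \<partial>P))"
      by (simp add: nn_integral_suminf nn_integral_cmult)
    also have "\<dots> \<le> (\<integral>\<^sup>+\<omega>. h 0 \<omega> \<partial>P) + ennreal (t 0)"
    proof (rule suminf_le_const[OF summableI])
      fix n
      have "(\<Sum>k<n. ennreal (\<gamma> k) * (\<integral>\<^sup>+\<omega>. j k \<omega> \<partial>P)) \<le>
        (\<integral>\<^sup>+\<omega>. h n \<omega> \<partial>P) + (\<Sum>k<n. ennreal (\<gamma> k) * (\<integral>\<^sup>+\<omega>. j k \<omega> \<partial>P)) + ennreal (t n)"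
        by (simp add: add_increasing add_increasing2)
      then show "(\<Sum>k<n. ennreal (\<gamma> k) * (\<integral>\<^sup>+\<omega>. j k \<omega> \<partial>P)) \<le> (\<integral>\<^sup>+\<omega>. h 0 \<omega> \<partial>P) + ennreal (t 0)"
        using ind by (rule order_trans)
    qed
    also have "\<dots> < \<infinity>" using h0 by (simp add: ennreal_add_less_top)
    finally show "(\<integral>\<^sup>+\<omega>. (\<Sum>k. ennreal (\<gamma> k) * j k \<omega>) \<partial>P) \<noteq> \<infinity>" by simp
  qed measurable
  define Y where "Y k \<omega> = h k \<omega> + ennreal (t k)" for k \<omega>
  have "AE \<omega> in P. (\<lambda>k. Y k \<omega>) \<longlonglongrightarrow> 0"
  proof (rule nonneg_supermartingale_tendsto_0[where F=F, OF P sub mono])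
    show "Y k \<in> borel_measurable (F k)" for k
      unfolding Y_def[abs_def] by (intro borel_measurable_add h borel_measurable_const)
    show "(\<integral>\<^sup>+\<omega>. Y (Suc k) \<omega> * indicator A \<omega> \<partial>P) \<le> (\<integral>\<^sup>+\<omega>. Y k \<omega> * indicator A \<omega> \<partial>P)"
      if A: "A \<in> sets (F k)" for k A
    proof -
      have [measurable]: "A \<in> sets P" using A sub[of k] by (auto simp: subalgebra_def)
      have "(\<integral>\<^sup>+\<omega>. Y (Suc k) \<omega> * indicator A \<omega> \<partial>P)
          = (\<integral>\<^sup>+\<omega>. h (Suc k) \<omega> * indicator A \<omega> \<partial>P) + (\<integral>\<^sup>+\<omega>. ennreal (t (Suc k)) * indicator A \<omega> \<partial>P)"
        unfolding Y_def distrib_right by (rule nn_integral_add) measurable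
      also have "\<dots> \<le> (\<integral>\<^sup>+\<omega>. (h k \<omega> + ennreal ((\<gamma> k)\<^sup>2 * C)) * indicator A \<omega> \<partial>P) + (\<integral>\<^sup>+\<omega>. ennreal (t (Suc k)) * indicator A \<omega> \<partial>P)"
      proof (intro add_right_mono)
        have "(\<integral>\<^sup>+\<omega>. h (Suc k) \<omega> * indicator A \<omega> \<partial>P)
            \<le> (\<integral>\<^sup>+\<omega>. h (Suc k) \<omega> * indicator A \<omega> \<partial>P) + ennreal (\<gamma> k) * (\<integral>\<^sup>+\<omega>. j k \<omega> * indicator A \<omega> \<partial>P)"
          by (simp add: add_increasing2)
        then show "(\<integral>\<^sup>+\<omega>. h (Suc k) \<omega> * indicator A \<omega> \<partial>P) \<le> (\<integral>\<^sup>+\<omega>. (h k \<omega> + ennreal ((\<gamma> k)\<^sup>2 * C)) * indicator A \<omega> \<partial>P)"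
          using step[OF A] by (rule order_trans)
      qed
      also have "\<dots> = (\<integral>\<^sup>+\<omega>. (h k \<omega> + ennreal ((\<gamma> k)\<^sup>2 * C)) * indicator A \<omega> + ennreal (t (Suc k)) * indicator A \<omega> \<partial>P)"
        by (rule nn_integral_add[symmetric]) measurable
      also have "\<dots> = (\<integral>\<^sup>+\<omega>. Y k \<omega> * indicator A \<omega> \<partial>P)"
      proof (intro nn_integral_cong)
        fix \<omega>
        have "ennreal (t k) = ennreal ((\<gamma> k)\<^sup>2 * C) + ennreal (t (Suc k))"
          unfolding t_Suc[of k] using C t0 by (intro ennreal_plus) auto
        then show "(h k \<omega> + ennreal ((\<gamma> k)\<^sup>2 * C)) * indicator A \<omega> + ennreal (t (Suc k)) * indicator A \<omega> = Y k \<omega> * indicator A \<omega>"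
          unfolding Y_def by (simp only: distrib_right add.assoc)
      qed
      finally show ?thesis .
    qed
    show "AE \<omega> in P. \<forall>e>0. \<exists>k. Y k \<omega> \<le> ennreal e"
      using small sumj
    proof eventually_elim
      case (elim \<omega>)
      show ?case
      proof (intro allI impI)
        fix e :: real assume e: "0 < e"
        then have e2: "0 < e / 2" by simp
        obtain d where d: "0 < d" "\<And>k. 1 \<le> k \<Longrightarrow> j k \<omega> < ennreal d \<Longrightarrow> h k \<omega> \<le> ennreal (e / 2)"
          using elim(1)[rule_format, OF e2] by blast
        obtain N where N: "\<And>k. N \<le> k \<Longrightarrow> t k < e / 2"
          using order_tendstoD(2)[OF t_lim e2] unfolding eventually_sequentially by blast
        have "(\<Sum>k. ennreal (\<gamma> k) * j k \<omega>) < \<infinity>"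
          using elim(2) by (simp add: less_top)
        \<comment> \<open>The time must exceed 0, so that \<open>d\<close> applies, and
          \<open>N\<close>, so that the remaining error is below half of \<open>e\<close>.\<close>
        from suminf_weighted_eq_infinity_imp_small[OF \<gamma>(1,2) this d(1), of "max 1 N"]
        obtain k where k: "max 1 N \<le> k" "j k \<omega> < ennreal d" by blast
        have "Y k \<omega> \<le> ennreal (e / 2) + ennreal (e / 2)"
          unfolding Y_def using k d(2)[of k] N[of k] by (intro add_mono ennreal_leI) auto
        also have "\<dots> = ennreal e" using e by (simp add: ennreal_plus[symmetric] del: ennreal_plus)
        finally show "\<exists>k. Y k \<omega> \<le> ennreal e" ..
      qed
    qed
  qed
  then show ?thesis
  proof eventually_elim
    case (elim \<omega>)
    show ?case
      by (rule tendsto_sandwich[where f="\<lambda>_. 0" and h="\<lambda>k. Y k \<omega>"]) (use elim in \<open>auto simp: Y_def add_increasing2\<close>)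
  qed
qed

subsection \<open>Independence of the next direction from the past\<close>

text \<open>The joint law of the past and the next variable is a product, so the next one may be
  integrated out with the past frozen. Grouping an independent family yields variables in product
  spaces, so the next variable appears as a family over the index set \<open>{k}\<close>.\<close>

lemma (in prob_space) nn_integral_indep_next:
  fixes X :: "nat \<Rightarrow> 'a \<Rightarrow> 'b::euclidean_space"
  assumes ind: "indep_vars (\<lambda>_. borel) X UNIV"
    and f: "f \<in> borel_measurable (Pi\<^sub>M {..<k} (\<lambda>_. borel) \<Otimes>\<^sub>M borel)"
  shows "(\<integral>\<^sup>+\<omega>. f (restrict (\<lambda>i. X i \<omega>) {..<k}, X k \<omega>) \<partial>M)
       = (\<integral>\<^sup>+\<omega>. \<integral>\<^sup>+t. f (restrict (\<lambda>i. X i \<omega>) {..<k}, t) \<partial>distr M borel (X k) \<partial>M)"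
proof -
  let ?S = "Pi\<^sub>M {..<k} (\<lambda>_. borel) :: (nat \<Rightarrow> 'b) measure"
  let ?X = "\<lambda>\<omega>. restrict (\<lambda>i. X i \<omega>) {..<k}"
  let ?T = "Pi\<^sub>M {k} (\<lambda>_. borel) :: (nat \<Rightarrow> 'b) measure"
  let ?R = "\<lambda>\<omega>. restrict (\<lambda>i. X i \<omega>) {k}"
  have iv: "indep_var ?S ?X ?T ?R"
    by (rule indep_var_restrict[OF ind]) auto
  then have rv: "random_variable ?S ?X" "random_variable ?T ?R"
    by (auto dest: indep_var_rv1 indep_var_rv2)
  have comp: "(\<lambda>r. r k) \<in> borel_measurable ?T"
    by (rule measurable_component_singleton) simp
  have fT: "(\<lambda>z. f (fst z, snd z k)) \<in> borel_measurable (?S \<Otimes>\<^sub>M ?T)"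
    by (intro measurable_compose[OF _ f] measurable_Pair measurable_fst measurable_compose[OF measurable_snd comp])
  interpret D: prob_space "distr M ?T ?R" using rv by (intro prob_space_distr)
  have sets: "sets (distr M ?S ?X \<Otimes>\<^sub>M distr M ?T ?R) = sets (?S \<Otimes>\<^sub>M ?T)"
    by (intro sets_pair_measure_cong sets_distr)
  have "(\<integral>\<^sup>+\<omega>. f (?X \<omega>, X k \<omega>) \<partial>M) = (\<integral>\<^sup>+z. f (fst z, snd z k) \<partial>distr M (?S \<Otimes>\<^sub>M ?T) (\<lambda>\<omega>. (?X \<omega>, ?R \<omega>)))"
    using rv fT by (subst nn_integral_distr) (auto intro: measurable_Pair)
  also have "\<dots> = (\<integral>\<^sup>+z. f (fst z, snd z k) \<partial>(distr M ?S ?X \<Otimes>\<^sub>M distr M ?T ?R))"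
    using iv by (simp add: indep_var_distribution_eq)
  also have "\<dots> = (\<integral>\<^sup>+x. \<integral>\<^sup>+r. f (x, r k) \<partial>distr M ?T ?R \<partial>distr M ?S ?X)"
  proof -
    have "(\<lambda>z. f (fst z, snd z k)) \<in> borel_measurable (distr M ?S ?X \<Otimes>\<^sub>M distr M ?T ?R)"
      using fT by (simp only: measurable_cong_sets[OF sets refl])
    from D.nn_integral_fst[OF this, symmetric] show ?thesis by simp
  qed
  also have "\<dots> = (\<integral>\<^sup>+\<omega>. \<integral>\<^sup>+r. f (?X \<omega>, r k) \<partial>distr M ?T ?R \<partial>M)"
    using rv(1)
  proof (rule nn_integral_distr)
    have "case_prod (\<lambda>x r. f (x, r k)) \<in> borel_measurable (?S \<Otimes>\<^sub>M distr M ?T ?R)"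
      using fT by (simp add: split_beta' measurable_cong_sets[OF sets_pair_measure_cong[OF refl sets_distr] refl])
    then have "(\<lambda>x. \<integral>\<^sup>+r. f (x, r k) \<partial>distr M ?T ?R) \<in> borel_measurable ?S"
      by (rule D.borel_measurable_nn_integral)
    then show "(\<lambda>x. \<integral>\<^sup>+r. f (x, r k) \<partial>distr M ?T ?R) \<in> borel_measurable (distr M ?S ?X)"
      by (simp only: measurable_cong_sets[OF sets_distr refl])
  qed
  also have "\<dots> = (\<integral>\<^sup>+\<omega>. \<integral>\<^sup>+t. f (?X \<omega>, t) \<partial>distr M borel (X k) \<partial>M)"
  proof (intro nn_integral_cong)
    fix \<omega> assume \<omega>: "\<omega> \<in> space M"
    have "?X \<omega> \<in> space ?S" using measurable_space[OF rv(1) \<omega>] .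
    then have fx: "(\<lambda>t. f (?X \<omega>, t)) \<in> borel_measurable borel"
      by (intro measurable_compose[OF measurable_Pair1' f])
    have "X k = (\<lambda>\<omega>. ?R \<omega> k)" by auto
    then have Xk: "distr M borel (X k) = distr (distr M ?T ?R) borel (\<lambda>r. r k)"
      using rv(2) comp by (subst distr_distr) (auto simp: o_def)
    show "(\<integral>\<^sup>+r. f (?X \<omega>, r k) \<partial>distr M ?T ?R) = (\<integral>\<^sup>+t. f (?X \<omega>, t) \<partial>distr M borel (X k))"
      unfolding Xk using comp fx by (subst nn_integral_distr[of "\<lambda>r. r k"]) auto
  qed
  finally show ?thesis .
qed

subsection \<open>The Wasserstein space is a metric space\<close>

lemma couplingsI:
  fixes \<sigma> \<eta> :: "'a::euclidean_space measure"
  assumes \<pi>: "sets \<pi> = sets (borel \<Otimes>\<^sub>M borel)" and sets: "sets \<sigma> = sets borel" "sets \<eta> = sets borel"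
    and 1: "\<And>A. A \<in> sets borel \<Longrightarrow> emeasure \<pi> (A \<times> UNIV) = emeasure \<sigma> A"
    and 2: "\<And>A. A \<in> sets borel \<Longrightarrow> emeasure \<pi> (UNIV \<times> A) = emeasure \<eta> A"
  shows "\<pi> \<in> couplings \<sigma> \<eta>"
proof -
  have sp: "space \<pi> = UNIV"
    using sets_eq_imp_space_eq[OF \<pi>] by (auto simp: space_pair_measure)
  have m: "fst \<in> borel_measurable \<pi>" "snd \<in> borel_measurable \<pi>"
    by (simp_all add: measurable_cong_sets[OF \<pi> refl])
  have "distr \<pi> borel fst = \<sigma>"
  proof (rule measure_eqI)
    fix A assume "A \<in> sets (distr \<pi> borel fst)"
    then have A: "A \<in> sets borel" by simp
    have "fst -` A \<inter> space \<pi> = A \<times> UNIV" by (auto simp: sp)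
    then show "emeasure (distr \<pi> borel fst) A = emeasure \<sigma> A"
      using 1[OF A] m A by (simp add: emeasure_distr)
  qed (simp add: sets)
  moreover have "distr \<pi> borel snd = \<eta>"
  proof (rule measure_eqI)
    fix A assume "A \<in> sets (distr \<pi> borel snd)"
    then have A: "A \<in> sets borel" by simp
    have "snd -` A \<inter> space \<pi> = UNIV \<times> A" by (auto simp: sp)
    then show "emeasure (distr \<pi> borel snd) A = emeasure \<eta> A"
      using 2[OF A] m A by (simp add: emeasure_distr)
  qed (simp add: sets)
  ultimately show ?thesis
    using \<pi> by (simp add: couplings_def)
qed

lemma coupling_cost_measurable [measurable]:
  "(\<lambda>z. ennreal ((dist (fst z) (snd z))\<^sup>2)) \<in> borel_measurable (borel \<Otimes>\<^sub>M (borel :: 'a::euclidean_space measure))"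
  by measurable

lemma W2_cost: "W2 \<sigma> \<eta> = sqrt (enn2real (INF \<pi>\<in>couplings \<sigma> \<eta>. coupling_cost \<pi>))"
  by (simp add: W2_def coupling_cost_def)

lemma W2_nonneg: "0 \<le> W2 \<sigma> \<eta>"
  by (simp add: W2_cost)

lemma pair_measure_coupling:
  fixes \<sigma> \<eta> :: "'a::euclidean_space measure"
  assumes \<sigma>: "\<sigma> \<in> W2_space" and \<eta>: "\<eta> \<in> W2_space"
  shows "\<sigma> \<Otimes>\<^sub>M \<eta> \<in> couplings \<sigma> \<eta>" and "coupling_cost (\<sigma> \<Otimes>\<^sub>M \<eta>) < \<infinity>"
proof -
  note s = sets_W2_space[OF \<sigma>] sets_W2_space[OF \<eta>]
  interpret S: prob_space \<sigma> by (rule prob_space_W2_space[OF \<sigma>])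
  interpret E: prob_space \<eta> by (rule prob_space_W2_space[OF \<eta>])
  have sp: "space \<sigma> = UNIV" "space \<eta> = UNIV"
    using sets_eq_imp_space_eq[OF s(1)] sets_eq_imp_space_eq[OF s(2)] by auto
  have one: "emeasure \<sigma> UNIV = 1" "emeasure \<eta> UNIV = 1"
    using S.emeasure_space_1 E.emeasure_space_1 sp by auto
  have pc: "sets (\<sigma> \<Otimes>\<^sub>M \<eta>) = sets (borel \<Otimes>\<^sub>M borel)"
    by (intro sets_pair_measure_cong s)
  show c: "\<sigma> \<Otimes>\<^sub>M \<eta> \<in> couplings \<sigma> \<eta>"
  proof (rule couplingsI[OF pc s])
    fix A :: "'a set" assume A: "A \<in> sets borel"
    have U: "UNIV \<in> sets \<sigma>" "UNIV \<in> sets \<eta>" using s by simp_all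
    show "emeasure (\<sigma> \<Otimes>\<^sub>M \<eta>) (A \<times> UNIV) = emeasure \<sigma> A" "emeasure (\<sigma> \<Otimes>\<^sub>M \<eta>) (UNIV \<times> A) = emeasure \<eta> A"
      using A U s by (simp_all add: E.emeasure_pair_measure_Times one)
  qed
  note m = measurable_cong_sets[OF couplings_sets[OF c] refl]
  have "coupling_cost (\<sigma> \<Otimes>\<^sub>M \<eta>) \<le> (\<integral>\<^sup>+z. 2 * ennreal ((norm (fst z))\<^sup>2) + 2 * ennreal ((norm (snd z))\<^sup>2) \<partial>(\<sigma> \<Otimes>\<^sub>M \<eta>))"
    unfolding coupling_cost_def
  proof (intro nn_integral_mono ennreal_square_split)
    fix z :: "'a \<times> 'a"
    show "(dist (fst z) (snd z))\<^sup>2 \<le> 2 * (norm (fst z))\<^sup>2 + 2 * (norm (snd z))\<^sup>2"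
      using norm_add_square_le[of "fst z" "- snd z"] by (simp add: dist_norm)
  qed
  also have "\<dots> = 2 * (\<integral>\<^sup>+z. ennreal ((norm (fst z))\<^sup>2) \<partial>(\<sigma> \<Otimes>\<^sub>M \<eta>)) + 2 * (\<integral>\<^sup>+z. ennreal ((norm (snd z))\<^sup>2) \<partial>(\<sigma> \<Otimes>\<^sub>M \<eta>))"
    by (subst nn_integral_add) (simp_all add: m nn_integral_cmult)
  also have "\<dots> = 2 * (\<integral>\<^sup>+x. ennreal ((norm x)\<^sup>2) \<partial>\<sigma>) + 2 * (\<integral>\<^sup>+x. ennreal ((norm x)\<^sup>2) \<partial>\<eta>)"
    using couplings_nn_integral[OF c, of "\<lambda>x. ennreal ((norm x)\<^sup>2)"] by simp
  also have "\<dots> < \<infinity>"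
    using \<sigma> \<eta> by (auto simp: W2_space_def integrable_iff_bounded ennreal_mult_less_top)
  finally show "coupling_cost (\<sigma> \<Otimes>\<^sub>M \<eta>) < \<infinity>" .
qed

text \<open>The independent coupling has finite cost, so the infimum is finite and
  \<open>enn2real\<close> does not hide an infinite value as 0. The strict inequality leaves room
  for a coupling without an optimal one being available.\<close>

lemma W2_less_imp_coupling:
  assumes \<sigma>: "\<sigma> \<in> W2_space" and \<eta>: "\<eta> \<in> W2_space" and r: "W2 \<sigma> \<eta> < r"
  shows "\<exists>\<pi>\<in>couplings \<sigma> \<eta>. coupling_cost \<pi> < ennreal (r\<^sup>2)"
proof -
  let ?I = "INF \<pi>\<in>couplings \<sigma> \<eta>. coupling_cost \<pi>"
  have "?I \<le> coupling_cost (\<sigma> \<Otimes>\<^sub>M \<eta>)"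
    by (intro INF_lower pair_measure_coupling \<sigma> \<eta>)
  then have fin: "?I < \<infinity>"
    using pair_measure_coupling(2)[OF \<sigma> \<eta>] by (rule le_less_trans)
  have "0 < r" using W2_nonneg[of \<sigma> \<eta>] r by linarith
  have "(W2 \<sigma> \<eta>)\<^sup>2 < r\<^sup>2"
    using r W2_nonneg by (intro power_strict_mono) auto
  then have "enn2real ?I < r\<^sup>2"
    by (simp add: W2_cost)
  then have "?I < ennreal (r\<^sup>2)"
    using fin \<open>0 < r\<close> by (cases ?I) (auto simp: ennreal_less_iff)
  then show ?thesis
    by (simp add: INF_less_iff)
qed

lemma W2_le_coupling:
  assumes \<pi>: "\<pi> \<in> couplings \<sigma> \<eta>" and c: "coupling_cost \<pi> \<le> ennreal (r\<^sup>2)" and r: "0 \<le> r"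
  shows "W2 \<sigma> \<eta> \<le> r"
proof -
  have "(INF \<pi>\<in>couplings \<sigma> \<eta>. coupling_cost \<pi>) \<le> ennreal (r\<^sup>2)"
    using c by (rule INF_lower2[OF \<pi>])
  then have "enn2real (INF \<pi>\<in>couplings \<sigma> \<eta>. coupling_cost \<pi>) \<le> r\<^sup>2"
    by (rule enn2real_leI[OF zero_le_power2])
  then show ?thesis
    unfolding W2_cost using r by (intro real_le_lsqrt) auto
qed

lemma couplings_swap:
  fixes \<sigma> \<eta> :: "'a::euclidean_space measure"
  assumes \<pi>: "\<pi> \<in> couplings \<sigma> \<eta>"
  shows "distr \<pi> (borel \<Otimes>\<^sub>M borel) (\<lambda>z. (snd z, fst z)) \<in> couplings \<eta> \<sigma>"
    and "coupling_cost (distr \<pi> (borel \<Otimes>\<^sub>M borel) (\<lambda>z. (snd z, fst z))) = coupling_cost \<pi>"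
proof -
  have m: "(\<lambda>z. (snd z, fst z)) \<in> \<pi> \<rightarrow>\<^sub>M borel \<Otimes>\<^sub>M borel"
    by (subst measurable_cong_sets[OF couplings_sets[OF \<pi>] refl]) measurable
  show "distr \<pi> (borel \<Otimes>\<^sub>M borel) (\<lambda>z. (snd z, fst z)) \<in> couplings \<eta> \<sigma>"
    using couplings_fst[OF \<pi>] couplings_snd[OF \<pi>]
    by (simp add: couplings_def distr_distr[OF _ m] o_def)
  show "coupling_cost (distr \<pi> (borel \<Otimes>\<^sub>M borel) (\<lambda>z. (snd z, fst z))) = coupling_cost \<pi>"
    unfolding coupling_cost_def by (subst nn_integral_distr[OF m]) (simp_all add: dist_commute)
qed

lemma W2_commute: "W2 \<sigma> \<eta> = W2 \<eta> (\<sigma> :: 'a::euclidean_space measure)"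
proof -
  have "(INF \<pi>\<in>couplings \<sigma> \<eta>. coupling_cost \<pi>) \<le> (INF \<pi>\<in>couplings \<eta> \<sigma>. coupling_cost \<pi>)" for \<sigma> \<eta> :: "'a measure"
  proof (rule INF_greatest)
    fix \<pi> assume "\<pi> \<in> couplings \<eta> \<sigma>"
    from INF_lower[OF couplings_swap(1)[OF this], of coupling_cost] couplings_swap(2)[OF this]
    show "(INF \<pi>\<in>couplings \<sigma> \<eta>. coupling_cost \<pi>) \<le> coupling_cost \<pi>" by simp
  qed
  then show ?thesis
    unfolding W2_cost by (intro arg_cong[where f=sqrt] arg_cong[where f=enn2real] antisym)
qed

lemma W2_self:
  assumes \<sigma>: "\<sigma> \<in> W2_space"
  shows "W2 \<sigma> (\<sigma> :: 'a::euclidean_space measure) = 0"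
proof -
  note s = sets_W2_space[OF \<sigma>]
  let ?\<pi> = "distr \<sigma> (borel \<Otimes>\<^sub>M borel) (\<lambda>x. (x, x))"
  have m: "(\<lambda>x. (x, x)) \<in> \<sigma> \<rightarrow>\<^sub>M borel \<Otimes>\<^sub>M borel"
    by (subst measurable_cong_sets[OF s refl]) measurable
  have "distr \<sigma> borel (\<lambda>x. x) = \<sigma>"
    using s by (intro distr_id2) simp
  then have "?\<pi> \<in> couplings \<sigma> \<sigma>"
    by (simp add: couplings_def distr_distr[OF _ m] o_def)
  moreover have "coupling_cost ?\<pi> = 0"
    unfolding coupling_cost_def by (subst nn_integral_distr[OF m]) simp_all
  ultimately show ?thesis
    using W2_le_coupling[of ?\<pi> \<sigma> \<sigma> 0] W2_nonneg[of \<sigma> \<sigma>] by simp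
qed

text \<open>A coupling of small cost carries the mass of \<open>C\<close> into the closed
  \<open>r\<close>-neighbourhood of \<open>C\<close>, up to pairs more than \<open>r\<close> apart.
  These neighbourhoods shrink to \<open>C\<close> because it is closed, so the infimum 0 need not be
  attained.\<close>

lemma W2_eq_0_measure_closed_le:
  fixes \<sigma> \<eta> :: "'a::euclidean_space measure"
  assumes \<sigma>: "\<sigma> \<in> W2_space" and \<eta>: "\<eta> \<in> W2_space" and 0: "W2 \<sigma> \<eta> = 0" and C: "closed C"
  shows "measure \<sigma> C \<le> measure \<eta> C"
proof (cases "C = {}")
  case False
  interpret E: prob_space \<eta> by (rule prob_space_W2_space[OF \<eta>])
  have infdist_m [measurable]: "(\<lambda>y. infdist y C) \<in> borel_measurable borel"
    by (intro borel_measurable_continuous_onI continuous_on_infdist continuous_on_id)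
  let ?C = "\<lambda>r. {y. infdist y C \<le> r}"
  have Cm: "C \<in> sets borel" "?C r \<in> sets borel" for r
    using C by (auto simp: borel_closed)
  have le: "measure \<sigma> C \<le> measure \<eta> (?C r) + r" if r: "0 < r" for r
  proof -
    \<comment> \<open>A cost below \<open>r ^ 3\<close> is chosen so that Chebyshev's inequality,
      which divides by \<open>r\<^sup>2\<close>, bounds the far pairs by \<open>r\<close>.\<close>
    have "W2 \<sigma> \<eta> < sqrt (r ^ 3)" using 0 r by simp
    from W2_less_imp_coupling[OF \<sigma> \<eta> this] obtain \<pi>
      where \<pi>: "\<pi> \<in> couplings \<sigma> \<eta>" and cost: "coupling_cost \<pi> < ennreal ((sqrt (r ^ 3))\<^sup>2)" by blast
    have sq: "(sqrt (r ^ 3))\<^sup>2 = r ^ 3" using r by simp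
    interpret \<pi>: prob_space \<pi>
      by (rule couplings_prob_space[OF \<pi> prob_space_W2_space[OF \<sigma>]])
    have sp: "space \<pi> = UNIV" by (rule couplings_space[OF \<pi>])
    have m: "{z. snd z \<in> ?C r} \<in> sets \<pi>" "{z. r < dist (fst z) (snd z)} \<in> sets \<pi>"
      unfolding couplings_sets[OF \<pi>]
      by (rule sets_Collect_UNIV; (simp add: space_pair_measure; fail | measurable))+
    have "emeasure \<pi> {z. r < dist (fst z) (snd z)} \<le> ennreal (1 / r\<^sup>2) * coupling_cost \<pi>"
      by (rule emeasure_dist_gt_le_coupling_cost[OF \<pi> r])
    also have "\<dots> \<le> ennreal (1 / r\<^sup>2) * ennreal (r ^ 3)"
      using cost unfolding sq by (intro mult_left_mono less_imp_le) auto
    also have "\<dots> = ennreal r"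
      using r by (simp add: ennreal_mult[symmetric] power3_eq_cube power2_eq_square)
    finally have far: "measure \<pi> {z. r < dist (fst z) (snd z)} \<le> r"
      using r by (simp add: \<pi>.emeasure_eq_measure)
    have "measure \<sigma> C = measure \<pi> {z. fst z \<in> C}"
      using couplings_measure(1)[OF \<pi> Cm(1)] ..
    also have "\<dots> \<le> measure \<pi> ({z. snd z \<in> ?C r} \<union> {z. r < dist (fst z) (snd z)})"
    proof (rule \<pi>.finite_measure_mono)
      show "{z. fst z \<in> C} \<subseteq> {z. snd z \<in> ?C r} \<union> {z. r < dist (fst z) (snd z)}"
      proof
        fix z :: "'a \<times> 'a" assume "z \<in> {z. fst z \<in> C}"
        then have "infdist (snd z) C \<le> dist (snd z) (fst z)"
          by (intro infdist_le) simp
        then show "z \<in> {z. snd z \<in> ?C r} \<union> {z. r < dist (fst z) (snd z)}"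
          by (simp add: dist_commute) linarith
      qed
    qed (use m in blast)
    also have "\<dots> \<le> measure \<pi> {z. snd z \<in> ?C r} + measure \<pi> {z. r < dist (fst z) (snd z)}"
      using m by (intro measure_Un_le)
    also have "\<dots> \<le> measure \<eta> (?C r) + r"
      using couplings_measure(2)[OF \<pi> Cm(2), of r] far by simp
    finally show ?thesis .
  qed
  have "(\<lambda>n. measure \<eta> (?C (1 / real (Suc n)))) \<longlonglongrightarrow> measure \<eta> (\<Inter>n. ?C (1 / real (Suc n)))"
  proof (rule E.finite_Lim_measure_decseq)
    show "range (\<lambda>n. ?C (1 / real (Suc n))) \<subseteq> sets \<eta>"
      using Cm(2) by (auto simp: sets_W2_space[OF \<eta>])
    show "decseq (\<lambda>n. ?C (1 / real (Suc n)))"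
      by (auto simp: decseq_def intro: order_trans[OF _ frac_le])
  qed
  also have "(\<Inter>n. ?C (1 / real (Suc n))) = C"
  proof (intro set_eqI iffI)
    fix y assume y: "y \<in> (\<Inter>n. ?C (1 / real (Suc n)))"
    have "infdist y C \<le> 0"
      by (rule LIMSEQ_le_const[OF LIMSEQ_inverse_real_of_nat]) (use y in \<open>auto simp: inverse_eq_divide\<close>)
    then have "infdist y C = 0" using infdist_nonneg[of y C] by linarith
    then show "y \<in> C" using in_closed_iff_infdist_zero[OF C False] by simp
  qed (simp add: infdist_zero)
  finally have "(\<lambda>n. measure \<eta> (?C (1 / real (Suc n))) + 1 / real (Suc n)) \<longlonglongrightarrow> measure \<eta> C + 0"
    using LIMSEQ_inverse_real_of_nat by (intro tendsto_add) (simp_all add: inverse_eq_divide)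
  then have "measure \<sigma> C \<le> measure \<eta> C + 0"
    by (rule LIMSEQ_le_const) (use le in auto)
  then show ?thesis by simp
qed simp

lemma W2_eq_0_imp_eq:
  fixes \<sigma> \<eta> :: "'a::euclidean_space measure"
  assumes \<sigma>: "\<sigma> \<in> W2_space" and \<eta>: "\<eta> \<in> W2_space" and 0: "W2 \<sigma> \<eta> = 0"
  shows "\<sigma> = \<eta>"
proof -
  interpret S: prob_space \<sigma> by (rule prob_space_W2_space[OF \<sigma>])
  interpret E: prob_space \<eta> by (rule prob_space_W2_space[OF \<eta>])
  have gen: "sets (borel :: 'a measure) = sigma_sets UNIV (Collect closed)"
    unfolding borel_eq_closed by simp
  show ?thesis
  proof (rule measure_eqI_generator_eq[where \<Omega>=UNIV and E="Collect closed" and A="\<lambda>_. UNIV"])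
    show "Int_stable (Collect closed :: 'a set set)"
      by (auto simp: Int_stable_def)
    show "emeasure \<sigma> X = emeasure \<eta> X" if "X \<in> Collect closed" for X
      using that W2_eq_0_measure_closed_le[OF \<sigma> \<eta> 0, of X] W2_eq_0_measure_closed_le[OF \<eta> \<sigma>, of X] 0 W2_commute[of \<sigma> \<eta>]
      by (simp add: S.emeasure_eq_measure E.emeasure_eq_measure)
  qed (auto simp: sets_W2_space \<sigma> \<eta> gen[symmetric] S.emeasure_eq_measure)
qed

section \<open>Approximate gluing and the triangle inequality\<close>

lemma small_cells:
  fixes e :: real
  assumes e: "0 < e"
  obtains c :: "'a::euclidean_space \<Rightarrow> nat" where
    "c \<in> borel \<rightarrow>\<^sub>M count_space UNIV" "\<And>x y. c x = c y \<Longrightarrow> dist x y \<le> e"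
proof -
  obtain D :: "'a set" where D: "countable D" "\<And>X. open X \<Longrightarrow> X \<noteq> {} \<Longrightarrow> \<exists>d\<in>D. d \<in> X"
    using countable_dense_exists by blast
  define d where "d = from_nat_into D"
  have "D \<noteq> {}" using D(2)[of UNIV] by auto
  then have ran: "range d = D" using D(1) by (simp add: d_def)
  \<comment> \<open>The first point of a dense sequence within half of \<open>e\<close> names the
    cell, so two points of one cell are within \<open>e\<close> of each other. An index function
    encodes the countable partition and keeps measurability elementary.\<close>
  define c where "c x = (LEAST i. dist x (d i) < e / 2)" for x
  have near: "dist x (d (c x)) < e / 2" for x
  proof -
    obtain y where "y \<in> D" "y \<in> ball x (e / 2)"
      using D(2)[of "ball x (e / 2)"] e by auto
    then obtain i where "dist x (d i) < e / 2" using ran by (auto simp: image_iff)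
    then show ?thesis unfolding c_def by (rule LeastI)
  qed
  show ?thesis
  proof
    show "c \<in> borel \<rightarrow>\<^sub>M count_space UNIV"
      unfolding c_def[abs_def] by measurable
    show "dist x y \<le> e" if "c x = c y" for x y
      using near[of x] near[of y] that dist_triangle2[of x y "d (c x)"] by (simp add: dist_commute)
  qed
qed

text \<open>Cauchy-Schwarz with weights. If \<open>A\<close> and \<open>B\<close> bound the L2 norms
  of the two summands, integrating the right-hand side gives at most \<open>(A + B)\<^sup>2\<close>:
  this is Minkowski's inequality in a pointwise form without roots.\<close>

lemma square_add_div_le:
  fixes a b A B :: real
  assumes "0 < A" "0 < B"
  shows "(a + b)\<^sup>2 \<le> (A + B) * (a\<^sup>2 / A + b\<^sup>2 / B)"
proof -
  have "(A + B) * (a\<^sup>2 / A + b\<^sup>2 / B) - (a + b)\<^sup>2 = (a * B - b * A)\<^sup>2 / (A * B)"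
    using assms by (simp add: field_simps power2_eq_square)
  also have "\<dots> \<ge> 0" using assms by simp
  finally show ?thesis by simp
qed

lemma square_add3_div_le:
  fixes a b A B e :: real
  assumes "0 < A" "0 < B" "0 < e"
  shows "(a + b + e)\<^sup>2 \<le> (A + B + e) * (a\<^sup>2 / A + b\<^sup>2 / B + e)"
proof -
  have "(a + b + e)\<^sup>2 \<le> (A + B + e) * ((a + b)\<^sup>2 / (A + B) + e\<^sup>2 / e)"
    using assms by (intro square_add_div_le) auto
  also have "\<dots> \<le> (A + B + e) * (a\<^sup>2 / A + b\<^sup>2 / B + e)"
  proof (intro mult_left_mono add_mono)
    show "(a + b)\<^sup>2 / (A + B) \<le> a\<^sup>2 / A + b\<^sup>2 / B"
      using square_add_div_le[OF assms(1,2), of a b] assms by (simp add: pos_divide_le_eq mult.commute)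
    show "e\<^sup>2 / e \<le> e" using assms by (simp add: power2_eq_square)
  qed (use assms in auto)
  finally show ?thesis .
qed

lemma borel_measurable_cell_weight:
  fixes c :: "'a::euclidean_space \<Rightarrow> nat" and q :: "nat \<Rightarrow> ennreal"
  assumes c: "c \<in> borel \<rightarrow>\<^sub>M count_space UNIV"
    and f: "f \<in> borel_measurable N" and g: "g \<in> borel_measurable N"
  shows "(\<lambda>z. if c (f z) = c (g z) then q (c (f z)) else 0) \<in> borel_measurable N"
proof (rule measurable_If)
  have c': "(\<lambda>x. real (c x)) \<in> borel_measurable borel" "(\<lambda>x. q (c x)) \<in> borel_measurable borel"
    by (rule measurable_compose[OF c]; simp)+
  show "(\<lambda>z. q (c (f z))) \<in> borel_measurable N"
    by (rule measurable_compose[OF f c'(2)])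
  show "{z \<in> space N. c (f z) = c (g z)} \<in> sets N"
    using borel_measurable_eq[OF measurable_compose[OF f c'(1)] measurable_compose[OF g c'(1)]] by simp
qed simp

text \<open>
  Exact gluing needs disintegration. Coupling \<open>\<pi>\<^sub>1\<close> and \<open>\<pi>\<^sub>2\<close> independently, conditionally on their
  middle points falling into the same cell of a fine countable partition, costs only \<open>e\<close> and
  needs nothing beyond a density with respect to the product measure.
\<close>

lemma approximate_gluing:
  fixes \<sigma> \<eta> \<tau> :: "'a::euclidean_space measure"
  assumes \<sigma>: "\<sigma> \<in> W2_space" and \<eta>: "\<eta> \<in> W2_space" and \<tau>: "\<tau> \<in> W2_space"
    and \<pi>1: "\<pi>1 \<in> couplings \<sigma> \<eta>" and \<pi>2: "\<pi>2 \<in> couplings \<eta> \<tau>"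
    and A: "0 < A" "coupling_cost \<pi>1 \<le> ennreal (A\<^sup>2)" and B: "0 < B" "coupling_cost \<pi>2 \<le> ennreal (B\<^sup>2)"
    and e: "0 < e"
  shows "\<exists>\<pi>\<in>couplings \<sigma> \<tau>. coupling_cost \<pi> \<le> ennreal ((A + B + e)\<^sup>2)"
proof -
  obtain c :: "'a \<Rightarrow> nat" where c: "c \<in> borel \<rightarrow>\<^sub>M count_space UNIV"
    and near: "\<And>x y. c x = c y \<Longrightarrow> dist x y \<le> e"
    by (rule small_cells[OF e]) blast
  interpret E: prob_space \<eta> by (rule prob_space_W2_space[OF \<eta>])
  interpret p1: prob_space \<pi>1 by (rule couplings_prob_space[OF \<pi>1 prob_space_W2_space[OF \<sigma>]])
  interpret p2: prob_space \<pi>2 by (rule couplings_prob_space[OF \<pi>2 prob_space_W2_space[OF \<eta>]])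
  interpret P: pair_sigma_finite \<pi>1 \<pi>2 ..
  let ?R = "borel \<Otimes>\<^sub>M borel :: ('a \<times> 'a) measure"
  let ?M = "\<pi>1 \<Otimes>\<^sub>M \<pi>2"
  have sM: "sets ?M = sets (?R \<Otimes>\<^sub>M ?R)"
    by (intro sets_pair_measure_cong couplings_sets[OF \<pi>1] couplings_sets[OF \<pi>2])
  note mM = measurable_cong_sets[OF sM refl]
  note m1 = measurable_cong_sets[OF couplings_sets[OF \<pi>1] refl]
  note m2 = measurable_cong_sets[OF couplings_sets[OF \<pi>2] refl]
  define p where "p i = measure \<eta> (c -` {i})" for i
  have cell [measurable]: "c -` {i} \<in> sets borel" for i
    using measurable_sets[OF c, of "{i}"] by simp
  \<comment> \<open>The density is \<open>1 / p i\<close> on the pairs whose middle points share the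
    cell \<open>i\<close>, and 0 elsewhere. Integrating out either pair gives
    \<open>p i * (1 / p i) = 1\<close>, so the laws of both pairs survive.\<close>
  define w where "w u v = (if c (snd u) = c (fst v) then ennreal (1 / p (c (snd u))) else 0)" for u v :: "'a \<times> 'a"
  have [measurable]: "c \<in> borel \<rightarrow>\<^sub>M count_space UNIV" by (rule c)
  have wR [measurable]: "(\<lambda>z. w (fst z) (snd z)) \<in> borel_measurable (?R \<Otimes>\<^sub>M ?R)"
    unfolding w_def by (rule borel_measurable_cell_weight[OF c]) measurable
  \<comment> \<open>Cells of mass 0, where \<open>1 / p i\<close> is 0 by convention, form a
    countable union of null sets.\<close>
  have pos: "AE y in \<eta>. 0 < p (c y)"
  proof -
    have sp: "space \<eta> = UNIV" by (rule space_W2_space[OF \<eta>])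
    have "(\<Union>i\<in>{i. p i = 0}. c -` {i}) \<in> null_sets \<eta>"
      by (rule null_sets_UN') (auto simp: p_def null_sets_def E.emeasure_eq_measure sets_W2_space[OF \<eta>])
    then show ?thesis
      by (rule AE_I') (auto simp: p_def zero_less_measure_iff not_less measure_le_0_iff)
  qed
  have one1: "AE u in \<pi>1. (\<integral>\<^sup>+v. w u v \<partial>\<pi>2) = 1"
    using couplings_AE(2)[OF \<pi>1 pos]
  proof eventually_elim
    case (elim u)
    have "(\<integral>\<^sup>+v. w u v \<partial>\<pi>2) = (\<integral>\<^sup>+v. (\<lambda>y. ennreal (1 / p (c (snd u))) * indicator (c -` {c (snd u)}) y) (fst v) \<partial>\<pi>2)"
      by (intro nn_integral_cong) (auto simp: w_def indicator_def)
    also have "\<dots> = (\<integral>\<^sup>+y. ennreal (1 / p (c (snd u))) * indicator (c -` {c (snd u)}) y \<partial>\<eta>)"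
      by (rule couplings_nn_integral(1)[OF \<pi>2]) measurable
    also have "\<dots> = ennreal (1 / p (c (snd u))) * emeasure \<eta> (c -` {c (snd u)})"
      by (rule nn_integral_cmult_indicator) (simp add: sets_W2_space[OF \<eta>])
    also have "\<dots> = 1"
      using elim by (simp add: E.emeasure_eq_measure p_def[symmetric] ennreal_mult[symmetric])
    finally show ?case .
  qed
  have one2: "AE v in \<pi>2. (\<integral>\<^sup>+u. w u v \<partial>\<pi>1) = 1"
    using couplings_AE(1)[OF \<pi>2 pos]
  proof eventually_elim
    case (elim v)
    have "(\<integral>\<^sup>+u. w u v \<partial>\<pi>1) = (\<integral>\<^sup>+u. (\<lambda>y. ennreal (1 / p (c (fst v))) * indicator (c -` {c (fst v)}) y) (snd u) \<partial>\<pi>1)"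
      by (intro nn_integral_cong) (auto simp: w_def indicator_def)
    also have "\<dots> = (\<integral>\<^sup>+y. ennreal (1 / p (c (fst v))) * indicator (c -` {c (fst v)}) y \<partial>\<eta>)"
      by (rule couplings_nn_integral(2)[OF \<pi>1]) measurable
    also have "\<dots> = ennreal (1 / p (c (fst v))) * emeasure \<eta> (c -` {c (fst v)})"
      by (rule nn_integral_cmult_indicator) (simp add: sets_W2_space[OF \<eta>])
    also have "\<dots> = 1"
      using elim by (simp add: E.emeasure_eq_measure p_def[symmetric] ennreal_mult[symmetric])
    finally show ?case .
  qed
  have marg1: "(\<integral>\<^sup>+z. w (fst z) (snd z) * f (fst z) \<partial>?M) = (\<integral>\<^sup>+u. f u \<partial>\<pi>1)"
    if [measurable]: "f \<in> borel_measurable ?R" for f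
  proof -
    have "(\<lambda>z. w (fst z) (snd z) * f (fst z)) \<in> borel_measurable ?M"
      unfolding mM by measurable
    from p2.nn_integral_fst[OF this]
    have "(\<integral>\<^sup>+z. w (fst z) (snd z) * f (fst z) \<partial>?M) = (\<integral>\<^sup>+u. \<integral>\<^sup>+v. w u v * f u \<partial>\<pi>2 \<partial>\<pi>1)" by simp
    also have "\<dots> = (\<integral>\<^sup>+u. (\<integral>\<^sup>+v. w u v \<partial>\<pi>2) * f u \<partial>\<pi>1)"
    proof (intro nn_integral_cong nn_integral_multc)
      fix u show "(\<lambda>v. w u v) \<in> borel_measurable \<pi>2"
        unfolding m2 w_def by (rule borel_measurable_cell_weight[OF c]) measurable
    qed
    also have "\<dots> = (\<integral>\<^sup>+u. f u \<partial>\<pi>1)"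
      using one1 by (intro nn_integral_cong_AE) (auto elim: eventually_mono)
    finally show ?thesis .
  qed
  have marg2: "(\<integral>\<^sup>+z. w (fst z) (snd z) * f (snd z) \<partial>?M) = (\<integral>\<^sup>+v. f v \<partial>\<pi>2)"
    if [measurable]: "f \<in> borel_measurable ?R" for f
  proof -
    have "(\<lambda>z. w (fst z) (snd z) * f (snd z)) \<in> borel_measurable ?M"
      unfolding mM by measurable
    from P.nn_integral_snd[OF this]
    have "(\<integral>\<^sup>+z. w (fst z) (snd z) * f (snd z) \<partial>?M) = (\<integral>\<^sup>+v. \<integral>\<^sup>+u. w u v * f v \<partial>\<pi>1 \<partial>\<pi>2)"
      by (simp add: split_beta')
    also have "\<dots> = (\<integral>\<^sup>+v. (\<integral>\<^sup>+u. w u v \<partial>\<pi>1) * f v \<partial>\<pi>2)"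
    proof (intro nn_integral_cong nn_integral_multc)
      fix v show "(\<lambda>u. w u v) \<in> borel_measurable \<pi>1"
        unfolding m1 w_def by (rule borel_measurable_cell_weight[OF c]) measurable
    qed
    also have "\<dots> = (\<integral>\<^sup>+v. f v \<partial>\<pi>2)"
      using one2 by (intro nn_integral_cong_AE) (auto elim: eventually_mono)
    finally show ?thesis .
  qed
  let ?g = "\<lambda>z. (fst (fst z), snd (snd z)) :: 'a \<times> 'a"
  have wM: "(\<lambda>z. w (fst z) (snd z)) \<in> borel_measurable ?M"
    unfolding mM by measurable
  define \<Gamma> where "\<Gamma> = density ?M (\<lambda>z. w (fst z) (snd z))"
  have sG: "sets \<Gamma> = sets (?R \<Otimes>\<^sub>M ?R)" by (simp add: \<Gamma>_def sM)
  have g: "?g \<in> \<Gamma> \<rightarrow>\<^sub>M ?R"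
    unfolding measurable_cong_sets[OF sG refl] by measurable
  have int: "(\<integral>\<^sup>+y. f y \<partial>distr \<Gamma> ?R ?g) = (\<integral>\<^sup>+z. w (fst z) (snd z) * f (?g z) \<partial>?M)"
    if [measurable]: "f \<in> borel_measurable ?R" for f
  proof -
    have "(\<integral>\<^sup>+y. f y \<partial>distr \<Gamma> ?R ?g) = (\<integral>\<^sup>+z. f (?g z) \<partial>\<Gamma>)"
      by (rule nn_integral_distr[OF g]) simp
    also have "\<dots> = (\<integral>\<^sup>+z. w (fst z) (snd z) * f (?g z) \<partial>?M)"
      unfolding \<Gamma>_def
    proof (rule nn_integral_density[OF wM])
      show "(\<lambda>z. f (?g z)) \<in> borel_measurable ?M" unfolding mM by measurable
    qed
    finally show ?thesis .
  qed
  have "distr \<Gamma> ?R ?g \<in> couplings \<sigma> \<tau>"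
  proof (rule couplingsI)
    fix S :: "'a set" assume S [measurable]: "S \<in> sets borel"
    have "emeasure (distr \<Gamma> ?R ?g) (S \<times> UNIV) = (\<integral>\<^sup>+y. indicator (S \<times> UNIV) y \<partial>distr \<Gamma> ?R ?g)"
      by (rule nn_integral_indicator[symmetric]) simp
    also have "\<dots> = (\<integral>\<^sup>+y. indicator S (fst y) \<partial>distr \<Gamma> ?R ?g)"
      by (intro nn_integral_cong) (auto simp: indicator_def)
    also have "\<dots> = (\<integral>\<^sup>+z. w (fst z) (snd z) * indicator S (fst (fst z)) \<partial>?M)"
      by (subst int) simp_all
    also have "\<dots> = (\<integral>\<^sup>+u. indicator S (fst u) \<partial>\<pi>1)"
      by (rule marg1[of "\<lambda>u. indicator S (fst u)"]) measurable
    also have "\<dots> = emeasure \<sigma> S"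
      using couplings_nn_integral(1)[OF \<pi>1, of "indicator S"] by (simp add: sets_W2_space[OF \<sigma>])
    finally show "emeasure (distr \<Gamma> ?R ?g) (S \<times> UNIV) = emeasure \<sigma> S" .
    have "emeasure (distr \<Gamma> ?R ?g) (UNIV \<times> S) = (\<integral>\<^sup>+y. indicator (UNIV \<times> S) y \<partial>distr \<Gamma> ?R ?g)"
      by (rule nn_integral_indicator[symmetric]) simp
    also have "\<dots> = (\<integral>\<^sup>+y. indicator S (snd y) \<partial>distr \<Gamma> ?R ?g)"
      by (intro nn_integral_cong) (auto simp: indicator_def)
    also have "\<dots> = (\<integral>\<^sup>+z. w (fst z) (snd z) * indicator S (snd (snd z)) \<partial>?M)"
      by (subst int) simp_all
    also have "\<dots> = (\<integral>\<^sup>+v. indicator S (snd v) \<partial>\<pi>2)"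
      by (rule marg2[of "\<lambda>v. indicator S (snd v)"]) measurable
    also have "\<dots> = emeasure \<tau> S"
      using couplings_nn_integral(2)[OF \<pi>2, of "indicator S"] by (simp add: sets_W2_space[OF \<tau>])
    finally show "emeasure (distr \<Gamma> ?R ?g) (UNIV \<times> S) = emeasure \<tau> S" .
  qed (simp_all add: sets_W2_space \<sigma> \<tau>)
  moreover have "coupling_cost (distr \<Gamma> ?R ?g) \<le> ennreal ((A + B + e)\<^sup>2)"
  proof -
    let ?K = "ennreal (A + B + e)"
    let ?d = "\<lambda>u::'a \<times> 'a. ennreal ((dist (fst u) (snd u))\<^sup>2)"
    have "coupling_cost (distr \<Gamma> ?R ?g) = (\<integral>\<^sup>+z. w (fst z) (snd z) * ennreal ((dist (fst (fst z)) (snd (snd z)))\<^sup>2) \<partial>?M)"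
      unfolding coupling_cost_def by (subst int) simp_all
    also have "\<dots> \<le> (\<integral>\<^sup>+z. ?K * (ennreal (1 / A) * (w (fst z) (snd z) * ?d (fst z))
        + ennreal (1 / B) * (w (fst z) (snd z) * ?d (snd z)) + ennreal e * (w (fst z) (snd z) * 1)) \<partial>?M)"
    proof (rule nn_integral_mono)
      fix z :: "('a \<times> 'a) \<times> 'a \<times> 'a"
      show "w (fst z) (snd z) * ennreal ((dist (fst (fst z)) (snd (snd z)))\<^sup>2)
        \<le> ?K * (ennreal (1 / A) * (w (fst z) (snd z) * ?d (fst z))
        + ennreal (1 / B) * (w (fst z) (snd z) * ?d (snd z)) + ennreal e * (w (fst z) (snd z) * 1))"
      proof (cases "c (snd (fst z)) = c (fst (snd z))")
        case True
        let ?a = "dist (fst (fst z)) (snd (fst z))" and ?b = "dist (fst (snd z)) (snd (snd z))"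
        have "dist (fst (fst z)) (snd (snd z)) \<le> ?a + dist (snd (fst z)) (fst (snd z)) + ?b"
          using dist_triangle[of "fst (fst z)" "snd (snd z)" "snd (fst z)"]
            dist_triangle[of "snd (fst z)" "snd (snd z)" "fst (snd z)"] by linarith
        also have "\<dots> \<le> ?a + ?b + e"
          using near[OF True] by linarith
        finally have "(dist (fst (fst z)) (snd (snd z)))\<^sup>2 \<le> (?a + ?b + e)\<^sup>2"
          by (rule power_mono) simp
        \<comment> \<open>After this bound the integrand is linear in the two squared distances, and
          each of them depends on one pair only, so the marginal formulas apply.\<close>
        also have "\<dots> \<le> (A + B + e) * (?a\<^sup>2 / A + ?b\<^sup>2 / B + e)"
          by (rule square_add3_div_le[OF A(1) B(1) e])
        finally have "ennreal ((dist (fst (fst z)) (snd (snd z)))\<^sup>2) \<le> ennreal ((A + B + e) * (?a\<^sup>2 / A + ?b\<^sup>2 / B + e))"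
          by (rule ennreal_leI)
        also have "\<dots> = ?K * (ennreal (1 / A) * ?d (fst z) + ennreal (1 / B) * ?d (snd z) + ennreal e)"
          using A(1) B(1) e by (simp add: ennreal_mult[symmetric] ennreal_plus[symmetric] del: ennreal_plus)
        finally have "w (fst z) (snd z) * ennreal ((dist (fst (fst z)) (snd (snd z)))\<^sup>2)
          \<le> w (fst z) (snd z) * (?K * (ennreal (1 / A) * ?d (fst z) + ennreal (1 / B) * ?d (snd z) + ennreal e))"
          by (rule mult_left_mono) simp
        then show ?thesis by (simp only: distrib_left ac_simps mult_1_right mult_1_left)
      qed (simp add: w_def)
    qed
    also have "\<dots> = ?K * (ennreal (1 / A) * coupling_cost \<pi>1 + ennreal (1 / B) * coupling_cost \<pi>2 + ennreal e)"
    proof -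
      have k: "(\<lambda>z. w (fst z) (snd z) * ?d (fst z)) \<in> borel_measurable ?M"
        "(\<lambda>z. w (fst z) (snd z) * ?d (snd z)) \<in> borel_measurable ?M"
        "(\<lambda>z. w (fst z) (snd z) * 1) \<in> borel_measurable ?M"
        unfolding mM by measurable
      have "(\<integral>\<^sup>+u. 1 \<partial>\<pi>1) = 1" by (simp add: p1.emeasure_space_1)
      then show ?thesis
        unfolding coupling_cost_def
        using marg1[of ?d] marg2[of ?d] marg1[of "\<lambda>_. 1"] k
        by (simp add: nn_integral_cmult nn_integral_add)
    qed
    also have "\<dots> \<le> ?K * (ennreal (1 / A) * ennreal (A\<^sup>2) + ennreal (1 / B) * ennreal (B\<^sup>2) + ennreal e)"
      by (intro mult_left_mono add_mono A B order_refl) simp_all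
    also have "\<dots> = ennreal ((A + B + e)\<^sup>2)"
      using A(1) B(1) e
      by (simp add: ennreal_mult[symmetric] ennreal_plus[symmetric] power2_eq_square del: ennreal_plus)
    finally show ?thesis .
  qed
  ultimately show ?thesis by blast
qed

lemma W2_triangle:
  fixes \<sigma> \<eta> \<tau> :: "'a::euclidean_space measure"
  assumes \<sigma>: "\<sigma> \<in> W2_space" and \<eta>: "\<eta> \<in> W2_space" and \<tau>: "\<tau> \<in> W2_space"
  shows "W2 \<sigma> \<tau> \<le> W2 \<sigma> \<eta> + W2 \<eta> \<tau>"
proof (rule field_le_epsilon)
  fix e :: real assume "0 < e"
  then have e: "0 < e / 3" by simp
  let ?A = "W2 \<sigma> \<eta> + e / 3" and ?B = "W2 \<eta> \<tau> + e / 3"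
  have "W2 \<sigma> \<eta> < ?A" "W2 \<eta> \<tau> < ?B" using e by simp_all
  from W2_less_imp_coupling[OF \<sigma> \<eta> this(1)] W2_less_imp_coupling[OF \<eta> \<tau> this(2)]
  obtain \<pi>1 \<pi>2 where \<pi>: "\<pi>1 \<in> couplings \<sigma> \<eta>" "coupling_cost \<pi>1 < ennreal (?A\<^sup>2)"
    "\<pi>2 \<in> couplings \<eta> \<tau>" "coupling_cost \<pi>2 < ennreal (?B\<^sup>2)" by blast
  have pos: "0 < ?A" "0 < ?B"
    using e W2_nonneg[of \<sigma> \<eta>] W2_nonneg[of \<eta> \<tau>] by linarith+
  obtain \<pi> where "\<pi> \<in> couplings \<sigma> \<tau>" "coupling_cost \<pi> \<le> ennreal ((?A + ?B + e / 3)\<^sup>2)"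
    using approximate_gluing[OF \<sigma> \<eta> \<tau> \<pi>(1,3) pos(1) less_imp_le[OF \<pi>(2)] pos(2) less_imp_le[OF \<pi>(4)] e] by blast
  then have "W2 \<sigma> \<tau> \<le> ?A + ?B + e / 3"
    using pos e by (intro W2_le_coupling) auto
  then show "W2 \<sigma> \<tau> \<le> W2 \<sigma> \<eta> + W2 \<eta> \<tau> + e" by simp
qed

lemma Metric_space_W2: "Metric_space (W2_space :: 'a::euclidean_space measure set) W2"
proof
  show "W2 x y = 0 \<longleftrightarrow> x = y" if "x \<in> W2_space" "y \<in> W2_space" for x y :: "'a measure"
    using that W2_self W2_eq_0_imp_eq by blast
qed (auto simp: W2_nonneg W2_commute intro: W2_triangle)

subsection \<open>Compactness\<close>

text \<open>The arguments below work along couplings rather than with distances, so the convergent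
  subsequence comes with near-optimal ones. The slack \<open>1 / real (Suc j)\<close> supplies the
  strict inequality that their existence requires.\<close>

lemma W2_compact_subsequence:
  fixes K :: "'a::euclidean_space measure set"
  assumes K: "W2_compact K" and \<tau>: "\<And>j. \<tau> j \<in> K"
  shows "\<exists>\<eta>\<in>K. \<exists>r :: nat \<Rightarrow> nat. strict_mono r \<and> (\<lambda>j. W2 (\<tau> (r j)) \<eta>) \<longlonglongrightarrow> 0 \<and>
    (\<exists>\<pi>. (\<forall>j. \<pi> j \<in> couplings (\<tau> (r j)) \<eta>) \<and> (\<lambda>j. coupling_cost (\<pi> j)) \<longlonglongrightarrow> 0)"
proof -
  interpret W: Metric_space "W2_space :: 'a measure set" W2 by (rule Metric_space_W2)
  have KM: "K \<subseteq> W2_space"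
    using K by (simp add: W2_compact_def W.compactin_sequentially)
  have "range \<tau> \<subseteq> K" using \<tau> by auto
  then obtain \<eta> r where \<eta>: "\<eta> \<in> K" "strict_mono r" "limitin W.mtopology (\<tau> \<circ> r) \<eta> sequentially"
    using K unfolding W2_compact_def W.compactin_sequentially by blast
  have lim: "(\<lambda>j. W2 (\<tau> (r j)) \<eta>) \<longlonglongrightarrow> 0"
  proof (rule order_tendstoI)
    fix a :: real assume "0 < a"
    then show "eventually (\<lambda>j. W2 (\<tau> (r j)) \<eta> < a) sequentially"
      using \<eta>(3) unfolding W.limitin_metric by (auto elim: eventually_mono)
  next
    fix a :: real assume "a < 0"
    then show "eventually (\<lambda>j. a < W2 (\<tau> (r j)) \<eta>) sequentially"
      by (intro always_eventually allI less_le_trans[OF _ W2_nonneg])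
  qed
  have "\<exists>\<pi>\<in>couplings (\<tau> (r j)) \<eta>. coupling_cost \<pi> < ennreal ((W2 (\<tau> (r j)) \<eta> + 1 / real (Suc j))\<^sup>2)" for j
    using KM \<tau> \<eta>(1) by (intro W2_less_imp_coupling) auto
  then obtain \<pi> where \<pi>: "\<And>j. \<pi> j \<in> couplings (\<tau> (r j)) \<eta>"
    "\<And>j. coupling_cost (\<pi> j) < ennreal ((W2 (\<tau> (r j)) \<eta> + 1 / real (Suc j))\<^sup>2)" by metis
  have "(\<lambda>j. ennreal ((W2 (\<tau> (r j)) \<eta> + 1 / real (Suc j))\<^sup>2)) \<longlonglongrightarrow> ennreal ((0 + 0)\<^sup>2)"
    using LIMSEQ_inverse_real_of_nat lim
    by (intro tendsto_ennrealI tendsto_power tendsto_add) (simp_all add: inverse_eq_divide)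
  then have "(\<lambda>j. coupling_cost (\<pi> j)) \<longlonglongrightarrow> 0"
    by (intro tendsto_sandwich[where f="\<lambda>_. 0" and g="\<lambda>j. coupling_cost (\<pi> j)"
          and h="\<lambda>j. ennreal ((W2 (\<tau> (r j)) \<eta> + 1 / real (Suc j))\<^sup>2)"])
      (use less_imp_le[OF \<pi>(2)] in auto)
  with \<eta> \<pi>(1) lim show ?thesis by blast
qed

context
  fixes \<mu> :: "'a::euclidean_space measure" and K :: "'a measure set"
  assumes \<mu>: "\<mu> \<in> W2_ac" and K_ac: "K \<subseteq> W2_ac" and K: "W2_compact K"
begin

text \<open>Along a sequence of energies exceeding every \<open>n\<close>, a convergent subsequence
  would have its energies bounded in terms of the finite energy of the limit.\<close>

lemma slice_energy_bounded: "\<exists>C\<ge>0. \<forall>\<sigma>\<in>K. slice_energy \<mu> \<sigma> \<le> ennreal C"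
proof (rule ccontr)
  assume neg: "\<not> ?thesis"
  have "\<exists>\<sigma>\<in>K. ennreal (real n) < slice_energy \<mu> \<sigma>" for n
  proof (rule ccontr)
    assume "\<not> ?thesis"
    then have "\<forall>\<sigma>\<in>K. slice_energy \<mu> \<sigma> \<le> ennreal (real n)" by (auto simp: not_less)
    with neg show False using of_nat_0_le_iff by blast
  qed
  then obtain \<tau> where \<tau>: "\<And>n. \<tau> n \<in> K" "\<And>n. ennreal (real n) < slice_energy \<mu> (\<tau> n)" by metis
  from W2_compact_subsequence[where \<tau>=\<tau>, OF K \<tau>(1)] obtain \<eta> r \<pi> where \<eta>: "\<eta> \<in> K" and r: "strict_mono (r :: nat \<Rightarrow> nat)"
    and \<pi>: "\<And>j. \<pi> j \<in> couplings (\<tau> (r j)) \<eta>" "(\<lambda>j. coupling_cost (\<pi> j)) \<longlonglongrightarrow> 0" by blast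
  have ac: "\<tau> (r j) \<in> W2_ac" "\<eta> \<in> W2_ac" for j using \<tau>(1) \<eta> K_ac by auto
  let ?d = "\<lambda>j. coupling_defect \<mu> (\<tau> (r j)) \<eta> (\<pi> j)"
  have "?d \<longlonglongrightarrow> 0"
    by (rule coupling_defect_tendsto_0[OF ac W2_acD[OF \<mu>] \<pi>])
  from order_tendstoD(2)[OF this, of 1] obtain N where N: "\<And>j. N \<le> j \<Longrightarrow> ?d j < 1"
    by (auto simp: eventually_sequentially)
  define E where "E = 2 + 2 * slice_energy \<mu> \<eta>"
  have "E < \<infinity>"
    using slice_energy_finite[OF W2_acD[OF \<mu>] ac(2)] by (simp add: E_def ennreal_mult_less_top)
  then obtain x where x: "0 \<le> x" "E = ennreal x" by (cases E) auto
  obtain m where m: "x < real m" using reals_Archimedean2 by blast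
  let ?j = "max N m"
  have "ennreal (real (r ?j)) < slice_energy \<mu> (\<tau> (r ?j))" by (rule \<tau>(2))
  also have "\<dots> \<le> 2 * ?d ?j + 2 * slice_energy \<mu> \<eta>"
    by (rule slice_energy_le_defect(1)[OF W2_acD[OF \<mu>] ac \<pi>(1)])
  also have "\<dots> \<le> 2 * 1 + 2 * slice_energy \<mu> \<eta>"
    using N[of ?j] by (intro add_right_mono mult_left_mono) auto
  also have "\<dots> = ennreal x" using x(2) by (simp add: E_def)
  finally have "real (r ?j) < x" using x by (simp add: ennreal_less_iff)
  moreover have "m \<le> r ?j"
    using seq_suble[OF r, of ?j] by linarith
  ultimately show False using m by linarith
qed

context
  assumes fixed: "\<And>\<eta>. \<eta> \<in> K \<Longrightarrow> AE x in \<eta>. H_deriv \<mu> \<eta> x = 0 \<Longrightarrow> \<eta> = \<mu>"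
begin

lemma grad_energy_eq_0_imp_target:
  assumes "\<eta> \<in> K" "grad_energy \<mu> \<eta> = 0" shows "\<eta> = \<mu>"
  using assms K_ac \<mu> by (intro fixed grad_energy_eq_0D) (auto intro: W2_acD)

text \<open>A violating sequence would have vanishing gradients and a limit in \<open>K\<close> of
  zero gradient, hence the limit \<mu>. As \<mu> has energy 0, comparison along the couplings forces
  the energies to 0 as well.\<close>

lemma small_gradient_imp_small_energy:
  assumes e: "0 < (e::real)"
  shows "\<exists>d>0. \<forall>\<sigma>\<in>K. grad_energy \<mu> \<sigma> < ennreal d \<longrightarrow> slice_energy \<mu> \<sigma> \<le> ennreal e"
proof (rule ccontr)
  assume neg: "\<not> ?thesis"
  have "\<exists>\<sigma>\<in>K. grad_energy \<mu> \<sigma> < ennreal (1 / real (Suc n)) \<and> ennreal e < slice_energy \<mu> \<sigma>" for n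
    using neg[unfolded not_ex, rule_format, of "1 / real (Suc n)"] by (auto simp: not_le)
  then obtain \<tau> where \<tau>: "\<And>n. \<tau> n \<in> K" "\<And>n. grad_energy \<mu> (\<tau> n) < ennreal (1 / real (Suc n))"
    "\<And>n. ennreal e < slice_energy \<mu> (\<tau> n)" by metis
  from W2_compact_subsequence[where \<tau>=\<tau>, OF K \<tau>(1)] obtain \<eta> r \<pi> where \<eta>: "\<eta> \<in> K" and r: "strict_mono (r :: nat \<Rightarrow> nat)"
    and \<pi>: "\<And>j. \<pi> j \<in> couplings (\<tau> (r j)) \<eta>" "(\<lambda>j. coupling_cost (\<pi> j)) \<longlonglongrightarrow> 0" by blast
  have ac: "\<tau> (r j) \<in> W2_ac" "\<eta> \<in> W2_ac" for j using \<tau>(1) \<eta> K_ac by auto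
  let ?d = "\<lambda>j. coupling_defect \<mu> (\<tau> (r j)) \<eta> (\<pi> j)"
  have d0: "?d \<longlonglongrightarrow> 0"
    by (rule coupling_defect_tendsto_0[OF ac W2_acD[OF \<mu>] \<pi>])
  have "(\<lambda>n. ennreal (1 / real (Suc n))) \<longlonglongrightarrow> ennreal 0"
    using LIMSEQ_inverse_real_of_nat by (intro tendsto_ennrealI) (simp add: inverse_eq_divide)
  then have "(\<lambda>n. grad_energy \<mu> (\<tau> n)) \<longlonglongrightarrow> 0"
    by (intro tendsto_sandwich[where f="\<lambda>_. 0" and g="\<lambda>n. grad_energy \<mu> (\<tau> n)"
          and h="\<lambda>n. ennreal (1 / real (Suc n))"]) (use less_imp_le[OF \<tau>(2)] in auto)
  from LIMSEQ_subseq_LIMSEQ[OF this r]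
  have g0: "(\<lambda>j. grad_energy \<mu> (\<tau> (r j))) \<longlonglongrightarrow> 0" by (simp add: o_def)
  have "(\<lambda>j. 2 * grad_energy \<mu> (\<tau> (r j)) + 2 * ?d j) \<longlonglongrightarrow> 2 * 0 + 2 * 0"
    by (intro tendsto_add ennreal_tendsto_cmult g0 d0) auto
  then have "grad_energy \<mu> \<eta> \<le> 2 * 0 + 2 * 0"
    by (rule LIMSEQ_le_const) (use grad_energy_le_defect[OF W2_acD[OF \<mu>] ac \<pi>(1)] in auto)
  then have "\<eta> = \<mu>" by (intro grad_energy_eq_0_imp_target \<eta>) simp
  then have "slice_energy \<mu> (\<tau> (r j)) \<le> 2 * ?d j" for j
    using slice_energy_le_defect(1)[OF W2_acD[OF \<mu>] ac \<pi>(1), of j] slice_energy_self[OF \<mu>] by simp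
  then have "ennreal e \<le> 2 * ?d j" for j
    using less_imp_le[OF \<tau>(3)[of "r j"]] order_trans by blast
  moreover have "(\<lambda>j. 2 * ?d j) \<longlonglongrightarrow> 2 * 0"
    by (intro ennreal_tendsto_cmult d0) auto
  ultimately have "ennreal e \<le> 2 * 0"
    by (intro LIMSEQ_le_const[where X="\<lambda>j. 2 * ?d j"]) auto
  then show False using e by simp
qed

text \<open>A subsequence staying away from \<mu> would have a limit in \<open>K\<close> of energy
  0. The gradient is bounded by the energy, so the same hypothesis identifies the limit as \<mu>;
  that measures are determined by their slices is never invoked.\<close>

lemma small_energy_imp_W2_tendsto:
  assumes \<tau>: "\<And>j. \<tau> j \<in> K" and H: "(\<lambda>j. slice_energy \<mu> (\<tau> j)) \<longlonglongrightarrow> 0"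
  shows "(\<lambda>j. W2 (\<tau> j) \<mu>) \<longlonglongrightarrow> 0"
proof (rule ccontr)
  assume "\<not> ?thesis"
  then obtain e where e: "0 < e" and inf: "\<forall>N. \<exists>j\<ge>N. e \<le> W2 (\<tau> j) \<mu>"
    by (auto simp: LIMSEQ_iff not_less W2_nonneg)
  then have "infinite {j. e \<le> W2 (\<tau> j) \<mu>}"
    by (simp add: infinite_nat_iff_unbounded_le)
  from infinite_enumerate[OF this] obtain s where s: "strict_mono (s :: nat \<Rightarrow> nat)" "\<And>n. e \<le> W2 (\<tau> (s n)) \<mu>"
    by auto
  from W2_compact_subsequence[where \<tau>="\<lambda>j. \<tau> (s j)", OF K] \<tau> obtain \<eta> r \<pi> where \<eta>: "\<eta> \<in> K" and r: "strict_mono (r :: nat \<Rightarrow> nat)"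
    and W: "(\<lambda>j. W2 (\<tau> (s (r j))) \<eta>) \<longlonglongrightarrow> 0"
    and \<pi>: "\<And>j. \<pi> j \<in> couplings (\<tau> (s (r j))) \<eta>" "(\<lambda>j. coupling_cost (\<pi> j)) \<longlonglongrightarrow> 0"
    by blast
  have ac: "\<tau> (s (r j)) \<in> W2_ac" "\<eta> \<in> W2_ac" for j using \<tau> \<eta> K_ac by auto
  let ?d = "\<lambda>j. coupling_defect \<mu> (\<tau> (s (r j))) \<eta> (\<pi> j)"
  have d0: "?d \<longlonglongrightarrow> 0"
    by (rule coupling_defect_tendsto_0[OF ac W2_acD[OF \<mu>] \<pi>])
  have h0: "(\<lambda>j. slice_energy \<mu> (\<tau> (s (r j)))) \<longlonglongrightarrow> 0"
    using LIMSEQ_subseq_LIMSEQ[OF LIMSEQ_subseq_LIMSEQ[OF H s(1)] r] by (simp add: o_def)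
  have "(\<lambda>j. 2 * ?d j + 2 * slice_energy \<mu> (\<tau> (s (r j)))) \<longlonglongrightarrow> 2 * 0 + 2 * 0"
    by (intro tendsto_add ennreal_tendsto_cmult h0 d0) auto
  then have "slice_energy \<mu> \<eta> \<le> 2 * 0 + 2 * 0"
    by (rule LIMSEQ_le_const) (use slice_energy_le_defect(2)[OF W2_acD[OF \<mu>] ac \<pi>(1)] in auto)
  then have "grad_energy \<mu> \<eta> = 0"
    using grad_energy_le[OF W2_acD[OF \<mu>] W2_acD[OF ac(2)]] by simp
  then have "\<eta> = \<mu>" by (intro grad_energy_eq_0_imp_target \<eta>)
  then have "e \<le> 0"
    using W s(2) by (intro LIMSEQ_le_const[where X="\<lambda>j. W2 (\<tau> (s (r j))) \<eta>"]) auto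
  then show False using e by simp
qed

end

end

subsection \<open>The random iteration\<close>

text \<open>Makes the iterate a function of the past directions, and lets the next direction be
  altered without changing it.\<close>

lemma slice_iter_cong:
  "(\<And>i. i < k \<Longrightarrow> \<theta> i = \<theta>' i) \<Longrightarrow> slice_iter \<mu> \<sigma>\<^sub>0 \<gamma> \<theta> k = slice_iter \<mu> \<sigma>\<^sub>0 \<gamma> \<theta>' k"
  by (induction k) auto

lemma slice_iter_measurable:
  fixes \<mu> \<sigma>\<^sub>0 :: "'a::euclidean_space measure"
  assumes \<mu>: "\<mu> \<in> W2_space" and \<sigma>: "\<sigma>\<^sub>0 \<in> W2_space"
    and \<theta>: "\<And>i. i < k \<Longrightarrow> (\<lambda>w. \<theta> w i) \<in> borel_measurable N"
  shows "(\<lambda>w. slice_iter \<mu> \<sigma>\<^sub>0 \<gamma> (\<theta> w) k) \<in> N \<rightarrow>\<^sub>M subprob_algebra borel"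
  using \<theta>
proof (induction k)
  case 0
  then show ?case using W2_space_in_subprob[OF \<sigma>] by simp
next
  case (Suc k)
  have "(\<lambda>w. (slice_iter \<mu> \<sigma>\<^sub>0 \<gamma> (\<theta> w) k, \<theta> w k)) \<in> N \<rightarrow>\<^sub>M subprob_algebra borel \<Otimes>\<^sub>M borel"
    using Suc by (intro measurable_Pair) auto
  from measurable_compose[OF this slice_step_measurable[OF \<mu>, of "\<gamma> k"]]
  show ?case unfolding slice_iter_step by simp
qed

theorem corollary1:
  fixes \<sigma>\<^sub>0 \<mu> :: "(real ^ 'n) measure"
    and K :: "(real ^ 'n) measure set"
    and \<gamma> :: "nat \<Rightarrow> real"
    and P :: "'w measure"
    and \<theta> :: "nat \<Rightarrow> 'w \<Rightarrow> real ^ 'n"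
  assumes "\<sigma>\<^sub>0 \<in> W2_ac" and "\<mu> \<in> W2_ac"
    and A1_K: "K \<subseteq> W2_ac" "W2_compact K"
    and A1_i: "\<And>g \<phi> k. \<lbrakk>\<And>j. g j \<in> {0..1}; \<And>j. \<phi> j \<in> sphere 0 1; k \<ge> 1\<rbrakk>
                 \<Longrightarrow> slice_iter \<mu> \<sigma>\<^sub>0 g \<phi> k \<in> K"
    and A1_ii: "\<And>\<eta>. \<lbrakk>\<eta> \<in> K; AE x in \<eta>. H_deriv \<mu> \<eta> x = 0\<rbrakk> \<Longrightarrow> \<eta> = \<mu>"
    and A2: "\<And>k. \<gamma> k \<in> {0..1}"
            "(\<Sum>k. ennreal (\<gamma> k)) = \<infinity>" "(\<Sum>k. ennreal ((\<gamma> k)\<^sup>2)) < \<infinity>"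
    and "prob_space P"
    and indep: "prob_space.indep_vars P (\<lambda>_. borel) \<theta> UNIV"
    and unif: "\<And>k. distr P borel (\<theta> k) = uniform_sphere"
  shows "AE \<omega> in P. (\<lambda>k. W2 (slice_iter \<mu> \<sigma>\<^sub>0 \<gamma> (\<lambda>j. \<theta> j \<omega>) k) \<mu>) \<longlonglongrightarrow> 0"
proof -
  interpret prob_space P by fact
  note \<mu> = \<open>\<mu> \<in> W2_ac\<close> and \<sigma>0 = \<open>\<sigma>\<^sub>0 \<in> W2_ac\<close>
  note \<mu>' = W2_acD[OF \<mu>] and \<sigma>0' = W2_acD[OF \<sigma>0]
  have rv: "\<theta> k \<in> borel_measurable P" for k
    using indep by (auto simp: indep_vars_def)
  have "AE t in distr P borel (\<theta> k). t \<in> sphere 0 1" for k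
    unfolding unif by (rule AE_uniform_sphere)
  then have "AE \<omega> in P. \<theta> k \<omega> \<in> sphere 0 1" for k
    by (rule AE_distrD[OF rv])
  then have sph: "AE \<omega> in P. \<forall>k. \<theta> k \<omega> \<in> sphere 0 1"
    unfolding AE_all_countable by (rule allI)
  define S where "S k \<omega> = slice_iter \<mu> \<sigma>\<^sub>0 \<gamma> (\<lambda>j. \<theta> j \<omega>) k" for k \<omega>
  \<comment> \<open>Assumption A1_i concerns deterministic directions and is applied to each outcome
    separately; outcomes with a direction off the sphere form a null set.\<close>
  have S_K: "S k \<omega> \<in> K" if "\<forall>k. \<theta> k \<omega> \<in> sphere 0 1" "1 \<le> k" for k \<omega>
    unfolding S_def using that by (intro A1_i A2) auto
  have S_ac: "S k \<omega> \<in> W2_ac" if "\<forall>k. \<theta> k \<omega> \<in> sphere 0 1" for k \<omega>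
  proof (cases "k = 0")
    case False
    then show ?thesis using S_K[OF that, of k] A1_K by auto
  qed (simp add: S_def \<sigma>0)
  have step_ac: "slice_step \<mu> (\<gamma> k) (S k \<omega>) \<phi> \<in> W2_ac"
    if \<omega>: "\<forall>k. \<theta> k \<omega> \<in> sphere 0 1" and \<phi>: "\<phi> \<in> sphere 0 1" for k \<omega> \<phi>
  proof -
    \<comment> \<open>Altering only direction \<open>k\<close> leaves the iterate at time
      \<open>k\<close> unchanged and realizes a step in any unit direction as an iterate of the
      scheme. So A1_i supplies its absolute continuity.\<close>
    let ?\<psi> = "(\<lambda>j. \<theta> j \<omega>)(k := \<phi>)"
    have "slice_iter \<mu> \<sigma>\<^sub>0 \<gamma> ?\<psi> (Suc k) = slice_step \<mu> (\<gamma> k) (S k \<omega>) \<phi>"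
      unfolding slice_iter_step S_def by (subst slice_iter_cong[of k ?\<psi> "\<lambda>j. \<theta> j \<omega>"]) simp_all
    moreover have "slice_iter \<mu> \<sigma>\<^sub>0 \<gamma> ?\<psi> (Suc k) \<in> K"
      using \<omega> \<phi> by (intro A1_i A2) auto
    ultimately show ?thesis using A1_K by auto
  qed
  obtain C0 where C0: "0 \<le> C0" "\<And>\<sigma>. \<sigma> \<in> K \<Longrightarrow> slice_energy \<mu> \<sigma> \<le> ennreal C0"
    using slice_energy_bounded[OF \<mu> A1_K] by blast
  obtain c where c: "0 \<le> c" "slice_energy \<mu> \<sigma>\<^sub>0 = ennreal c"
    using slice_energy_finite[OF \<mu>' \<sigma>0] by (cases "slice_energy \<mu> \<sigma>\<^sub>0") auto
  \<comment> \<open>The initial measure need not belong to \<open>K\<close>, so its own energy is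
    included in the bound.\<close>
  define C where "C = max C0 c"
  have C: "slice_energy \<mu> (S k \<omega>) \<le> ennreal C" if "\<forall>k. \<theta> k \<omega> \<in> sphere 0 1" for k \<omega>
  proof (cases "k = 0")
    case True
    then show ?thesis using c by (simp add: S_def C_def ennreal_leI)
  next
    case False
    then have "slice_energy \<mu> (S k \<omega>) \<le> ennreal C0" using S_K[OF that, of k] by (intro C0) simp
    also have "\<dots> \<le> ennreal C" by (simp add: C_def ennreal_leI)
    finally show ?thesis .
  qed
  let ?Q = "\<lambda>k. Pi\<^sub>M {..<k} (\<lambda>_. borel) :: (nat \<Rightarrow> real ^ 'n) measure"
  define X where "X k \<omega> = restrict (\<lambda>i. \<theta> i \<omega>) {..<k}" for k \<omega>
  have X: "X k \<in> P \<rightarrow>\<^sub>M ?Q k" for k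
    unfolding X_def[abs_def] by (intro measurable_restrict rv)
  have Xs: "X k \<in> space P \<rightarrow> space (?Q k)" for k
    using measurable_space[OF X] by auto
  \<comment> \<open>The past at time \<open>k\<close>, generated by the first \<open>k\<close>
    directions. As a preimage algebra it presents each event through a set \<open>B\<close> of
    direction sequences, the form to which \<open>nn_integral_indep_next\<close> applies.\<close>
  define F where "F k = vimage_algebra (space P) (X k) (?Q k)" for k
  have setsF: "sets (F k) = {X k -` B \<inter> space P | B. B \<in> sets (?Q k)}" for k
    unfolding F_def by (rule sets_vimage_algebra2[OF Xs])
  have XF: "X k \<in> F k \<rightarrow>\<^sub>M ?Q k" for k
    unfolding F_def by (rule measurable_vimage_algebra1[OF Xs])
  define G where "G k \<xi> = slice_iter \<mu> \<sigma>\<^sub>0 \<gamma> \<xi> k" for k \<xi>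
  have G: "G k \<in> ?Q k \<rightarrow>\<^sub>M subprob_algebra borel" for k
    unfolding G_def[abs_def] by (intro slice_iter_measurable \<mu>' \<sigma>0' measurable_component_singleton) simp
  have SG: "S k \<omega> = G k (X k \<omega>)" for k \<omega>
    unfolding S_def G_def X_def by (rule slice_iter_cong) simp
  have "AE \<omega> in P. (\<lambda>k. slice_energy \<mu> (S k \<omega>)) \<longlonglongrightarrow> 0"
  proof (rule descent_tendsto_0[where F=F and j="\<lambda>k \<omega>. grad_energy \<mu> (S k \<omega>)" and \<gamma>=\<gamma> and C=C])
    show "prob_space P" by fact
    show "subalgebra P (F k)" for k
      unfolding subalgebra_def setsF using measurable_sets[OF X] by (auto simp: F_def)
    show "sets (F k) \<subseteq> sets (F (Suc k))" for k
    proof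
      fix A assume "A \<in> sets (F k)"
      then obtain B where B: "B \<in> sets (?Q k)" "A = X k -` B \<inter> space P" unfolding setsF by blast
      have res: "(\<lambda>\<xi>. restrict \<xi> {..<k}) \<in> ?Q (Suc k) \<rightarrow>\<^sub>M ?Q k"
        by (rule measurable_restrict_subset) auto
      have "X k \<omega> = restrict (X (Suc k) \<omega>) {..<k}" for \<omega>
        by (auto simp: X_def restrict_def fun_eq_iff)
      then have "A = X (Suc k) -` ((\<lambda>\<xi>. restrict \<xi> {..<k}) -` B \<inter> space (?Q (Suc k))) \<inter> space P"
        using B(2) Xs[of "Suc k"] by auto
      then show "A \<in> sets (F (Suc k))"
        unfolding setsF using measurable_sets[OF res B(1)] by blast
    qed
    show "(\<lambda>\<omega>. slice_energy \<mu> (S k \<omega>)) \<in> borel_measurable (F k)" for k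
      unfolding SG by (rule measurable_compose[OF measurable_compose[OF XF G] borel_measurable_slice_energy[OF \<mu>']])
    show "(\<lambda>\<omega>. grad_energy \<mu> (S k \<omega>)) \<in> borel_measurable (F k)" for k
      unfolding SG by (rule measurable_compose[OF measurable_compose[OF XF G] borel_measurable_grad_energy[OF \<mu>']])
    show "0 \<le> \<gamma> k" for k using A2(1)[of k] by simp
    show "0 \<le> C" using C0(1) by (simp add: C_def)
    show "(\<integral>\<^sup>+\<omega>. slice_energy \<mu> (S 0 \<omega>) \<partial>P) < \<infinity>"
      using slice_energy_finite[OF \<mu>' \<sigma>0] by (simp add: S_def emeasure_space_1)
    show "AE \<omega> in P. \<forall>e>0. \<exists>d>0. \<forall>k\<ge>1. grad_energy \<mu> (S k \<omega>) < ennreal d \<longrightarrow> slice_energy \<mu> (S k \<omega>) \<le> ennreal e"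
      using sph
    proof eventually_elim
      case (elim \<omega>)
      show ?case
      proof (intro allI impI)
        fix e :: real assume "0 < e"
        from small_gradient_imp_small_energy[OF \<mu> A1_K A1_ii this]
        show "\<exists>d>0. \<forall>k\<ge>1. grad_energy \<mu> (S k \<omega>) < ennreal d \<longrightarrow> slice_energy \<mu> (S k \<omega>) \<le> ennreal e"
          using S_K[OF elim] by blast
      qed
    qed
    show "(\<integral>\<^sup>+\<omega>. slice_energy \<mu> (S (Suc k) \<omega>) * indicator A \<omega> \<partial>P)
          + ennreal (\<gamma> k) * (\<integral>\<^sup>+\<omega>. grad_energy \<mu> (S k \<omega>) * indicator A \<omega> \<partial>P)
       \<le> (\<integral>\<^sup>+\<omega>. (slice_energy \<mu> (S k \<omega>) + ennreal ((\<gamma> k)\<^sup>2 * C)) * indicator A \<omega> \<partial>P)"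
      if A: "A \<in> sets (F k)" for k A
    proof -
      obtain B where B: "B \<in> sets (?Q k)" "A = X k -` B \<inter> space P" using A unfolding setsF by blast
      have indA: "indicator A \<omega> = (indicator B (X k \<omega>) :: ennreal)" if "\<omega> \<in> space P" for \<omega>
        using that B(2) by (simp add: indicator_def)
      let ?e = "\<lambda>z. slice_energy \<mu> (slice_step \<mu> (\<gamma> k) (G k (fst z)) (snd z))"
      \<comment> \<open>The next energy on a past event, written as a function of the past
        directions and the next one; independence then replaces the latter by an average over the
        sphere.\<close>
      let ?f = "\<lambda>z. ?e z * indicator B (fst z)"
      have e: "?e \<in> borel_measurable (?Q k \<Otimes>\<^sub>M borel)"
      proof -
        have "(\<lambda>z. (G k (fst z), snd z)) \<in> ?Q k \<Otimes>\<^sub>M borel \<rightarrow>\<^sub>M subprob_algebra borel \<Otimes>\<^sub>M borel"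
          by (intro measurable_Pair measurable_snd measurable_compose[OF measurable_fst G])
        from measurable_compose[OF measurable_compose[OF this slice_step_measurable[OF \<mu>', of "\<gamma> k"]] borel_measurable_slice_energy[OF \<mu>']]
        show ?thesis by simp
      qed
      have f: "?f \<in> borel_measurable (?Q k \<Otimes>\<^sub>M borel)"
        by (intro borel_measurable_times_ennreal e measurable_compose[OF measurable_fst borel_measurable_indicator[OF B(1)]])
      interpret U: prob_space "uniform_sphere :: (real ^ 'n) measure" by (rule prob_space_uniform_sphere)
      let ?I = "\<lambda>\<omega>. \<integral>\<^sup>+\<phi>. slice_energy \<mu> (slice_step \<mu> (\<gamma> k) (S k \<omega>) \<phi>) \<partial>uniform_sphere"
      have I: "?I \<in> borel_measurable P"
      proof -
        have "(\<lambda>(\<xi>, \<phi>). ?e (\<xi>, \<phi>)) \<in> borel_measurable (?Q k \<Otimes>\<^sub>M uniform_sphere)"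
          using e by (simp add: split_beta' measurable_cong_sets[OF sets_pair_measure_cong[OF refl sets_uniform_sphere] refl])
        from measurable_compose[OF X U.borel_measurable_nn_integral[OF this]]
        show ?thesis by (simp add: SG)
      qed
      have AP: "A \<in> sets P" using B measurable_sets[OF X] by blast
      have gP: "(\<lambda>\<omega>. grad_energy \<mu> (S k \<omega>)) \<in> borel_measurable P"
        unfolding SG by (rule measurable_compose[OF measurable_compose[OF X G] borel_measurable_grad_energy[OF \<mu>']])
      have "(\<integral>\<^sup>+\<omega>. slice_energy \<mu> (S (Suc k) \<omega>) * indicator A \<omega> \<partial>P) = (\<integral>\<^sup>+\<omega>. ?f (X k \<omega>, \<theta> k \<omega>) \<partial>P)"
      proof (rule nn_integral_cong)
        fix \<omega> assume "\<omega> \<in> space P"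
        moreover have "S (Suc k) \<omega> = slice_step \<mu> (\<gamma> k) (S k \<omega>) (\<theta> k \<omega>)"
          unfolding S_def by (rule slice_iter_step)
        ultimately show "slice_energy \<mu> (S (Suc k) \<omega>) * indicator A \<omega> = ?f (X k \<omega>, \<theta> k \<omega>)"
          by (simp only: indA SG fst_conv snd_conv)
      qed
      also have "\<dots> = (\<integral>\<^sup>+\<omega>. \<integral>\<^sup>+\<phi>. ?f (X k \<omega>, \<phi>) \<partial>uniform_sphere \<partial>P)"
        using nn_integral_indep_next[OF indep f] unfolding X_def unif .
      also have "\<dots> = (\<integral>\<^sup>+\<omega>. ?I \<omega> * indicator A \<omega> \<partial>P)"
      proof (rule nn_integral_cong)
        fix \<omega> assume \<omega>: "\<omega> \<in> space P"
        have "(\<lambda>\<phi>. ?e (X k \<omega>, \<phi>)) \<in> borel_measurable uniform_sphere"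
          unfolding measurable_cong_sets[OF sets_uniform_sphere refl]
          by (rule measurable_compose[OF measurable_Pair1'[OF measurable_space[OF X \<omega>]] e])
        from nn_integral_multc[OF this, of "indicator B (X k \<omega>)"]
        show "(\<integral>\<^sup>+\<phi>. ?f (X k \<omega>, \<phi>) \<partial>uniform_sphere) = ?I \<omega> * indicator A \<omega>"
          by (simp only: indA[OF \<omega>] SG fst_conv snd_conv)
      qed
      finally have "(\<integral>\<^sup>+\<omega>. slice_energy \<mu> (S (Suc k) \<omega>) * indicator A \<omega> \<partial>P)
          + ennreal (\<gamma> k) * (\<integral>\<^sup>+\<omega>. grad_energy \<mu> (S k \<omega>) * indicator A \<omega> \<partial>P)
        = (\<integral>\<^sup>+\<omega>. ?I \<omega> * indicator A \<omega> + ennreal (\<gamma> k) * (grad_energy \<mu> (S k \<omega>) * indicator A \<omega>) \<partial>P)"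
        using I AP gP by (simp add: nn_integral_add nn_integral_cmult)
      also have "\<dots> \<le> (\<integral>\<^sup>+\<omega>. (slice_energy \<mu> (S k \<omega>) + ennreal ((\<gamma> k)\<^sup>2 * C)) * indicator A \<omega> \<partial>P)"
      proof (rule nn_integral_mono_AE)
        show "AE \<omega> in P. ?I \<omega> * indicator A \<omega> + ennreal (\<gamma> k) * (grad_energy \<mu> (S k \<omega>) * indicator A \<omega>)
          \<le> (slice_energy \<mu> (S k \<omega>) + ennreal ((\<gamma> k)\<^sup>2 * C)) * indicator A \<omega>"
          using sph
        proof eventually_elim
          case (elim \<omega>)
          have \<gamma>0: "0 \<le> \<gamma> k" using A2(1)[of k] by simp
          \<comment> \<open>Half of the decrease is given away, since the descent lemma is stated
            with weight \<open>\<gamma> k\<close>.\<close>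
          have "?I \<omega> + ennreal (\<gamma> k) * grad_energy \<mu> (S k \<omega>) \<le> ?I \<omega> + ennreal (2 * \<gamma> k) * grad_energy \<mu> (S k \<omega>)"
            using \<gamma>0 by (intro add_left_mono mult_right_mono ennreal_leI) auto
          also have "\<dots> \<le> ennreal (1 + (\<gamma> k)\<^sup>2) * slice_energy \<mu> (S k \<omega>)"
            by (rule slice_step_energy_le[OF \<mu>' S_ac[OF elim] \<gamma>0 step_ac[OF elim]])
          also have "\<dots> = slice_energy \<mu> (S k \<omega>) + ennreal ((\<gamma> k)\<^sup>2) * slice_energy \<mu> (S k \<omega>)"
            by (simp add: distrib_right)
          also have "\<dots> \<le> slice_energy \<mu> (S k \<omega>) + ennreal ((\<gamma> k)\<^sup>2) * ennreal C"
            by (intro add_left_mono mult_left_mono C[OF elim]) simp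
          also have "ennreal ((\<gamma> k)\<^sup>2) * ennreal C = ennreal ((\<gamma> k)\<^sup>2 * C)"
            using C0(1) by (intro ennreal_mult[symmetric]) (auto simp: C_def)
          finally show ?case
            by (simp add: indicator_def)
        qed
      qed
      finally show ?thesis .
    qed
  qed (use A2 in auto)
  with sph show ?thesis
  proof eventually_elim
    case (elim \<omega>)
    \<comment> \<open>The sequence is shifted by one because only the iterates from index 1 on are
      known to lie in \<open>K\<close>; the limit is not affected.\<close>
    have "(\<lambda>k. W2 (S (Suc k) \<omega>) \<mu>) \<longlonglongrightarrow> 0"
    proof (rule small_energy_imp_W2_tendsto[OF \<mu> A1_K A1_ii])
      show "S (Suc k) \<omega> \<in> K" for k using elim(1) by (intro S_K) auto
      show "(\<lambda>k. slice_energy \<mu> (S (Suc k) \<omega>)) \<longlonglongrightarrow> 0"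
        using elim(2) by (rule LIMSEQ_Suc)
    qed
    then show ?case
      unfolding S_def by (rule LIMSEQ_imp_Suc)
  qed
qed

end
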